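(* Let $\mu_0=\mathcal N(m_0,C_0)$, $\mu_1=\mathcal N(m_1,C_1)$ be Gaussian measures on $\mathcal H$ and $\epsilon>0$. Then $$S^\epsilon_{d^2}(\mu_0,\mu_1)=\|m_0-m_1\|^2+\frac\epsilon4\mathrm{Tr}\big[M^\epsilon_{00}-2M^\epsilon_{01}+M^\epsilon_{11}\big]+\frac\epsilon4\log\left[\frac{\det(I+\frac12M^\epsilon_{01})^2}{\det(I+\frac12M^\epsilon_{00})\det(I+\frac12M^\epsilon_{11})}\right].$$
   Context: $\mathcal H$ real separable Hilbert space; $\mathcal N(m,C)$ Gaussian measure with covariance $C$ positive trace class. $\mathrm{OT}^\epsilon_{d^2}(\mu,\nu)=\min_{\gamma\in\mathrm{Joint}(\mu,\nu)}\{\int\|x-y\|^2d\gamma+\epsilon\mathrm{KL}(\gamma\|\mu\otimes\nu)\}$ ($\mathrm{Joint}$: couplings; $\mathrm{KL}$: Kullback–Leibler divergence). Sinkhorn divergence: $S^\epsilon_{d^2}(\mu,\nu)=\mathrm{OT}^\epsilon_{d^2}(\mu,\nu)-\frac12(\mathrm{OT}^\epsilon_{d^2}(\mu,\mu)+\mathrm{OT}^\epsilon_{d^2}(\nu,\nu))$. For $i,j\in\{0,1\}$, $M^\epsilon_{ij}=-I+(I+\frac{16}{\epsilon^2}C_i^{1/2}C_jC_i^{1/2})^{1/2}$. $\det$ is the Fredholm determinant. *)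

theory Defs
  imports "HOL-Analysis.Analysis" "HOL-Probability.Probability"
begin

text \<open>Ambient space: a real separable Hilbert space, i.e. a type of class
  real_inner + complete_space + second_countable_topology (polish_space).
  Operators are bounded linear maps (blinfun).\<close>

definition selfadj_op :: "('a::real_inner \<Rightarrow>\<^sub>L 'a) \<Rightarrow> bool" where
  "selfadj_op A \<longleftrightarrow> (\<forall>x y. inner (A x) y = inner x (A y))"

definition positive_op :: "('a::real_inner \<Rightarrow>\<^sub>L 'a) \<Rightarrow> bool" where
  "positive_op A \<longleftrightarrow> selfadj_op A \<and> (\<forall>x. 0 \<le> inner (A x) x)"

definition onb :: "'a::real_inner set \<Rightarrow> bool" where
  "onb B \<longleftrightarrow> (\<forall>b\<in>B. norm b = 1) \<and> (\<forall>a\<in>B. \<forall>b\<in>B. a \<noteq> b \<longrightarrow> inner a b = 0)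
      \<and> closure (span B) = UNIV"

definition pos_trace_class :: "('a::real_inner \<Rightarrow>\<^sub>L 'a) \<Rightarrow> bool" where
  "pos_trace_class A \<longleftrightarrow> positive_op A \<and> (\<exists>B. onb B \<and> (\<lambda>b. inner (A b) b) summable_on B)"

definition op_trace :: "('a::real_inner \<Rightarrow>\<^sub>L 'a) \<Rightarrow> real" where
  "op_trace A = infsum (\<lambda>b. inner (A b) b) (SOME B. onb B)"

definition op_sqrt :: "('a::real_inner \<Rightarrow>\<^sub>L 'a) \<Rightarrow> ('a \<Rightarrow>\<^sub>L 'a)" where
  "op_sqrt A = (THE R. positive_op R \<and> R o\<^sub>L R = A)"

text \<open>Fredholm determinant of a self-adjoint operator T = I + A (A trace class):
  the (unconditionally convergent) product of the eigenvalues of T, taken over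
  an orthonormal basis of eigenvectors of T.\<close>
definition eigen_onb :: "('a::real_inner \<Rightarrow>\<^sub>L 'a) \<Rightarrow> 'a set \<Rightarrow> bool" where
  "eigen_onb T B \<longleftrightarrow> onb B \<and> (\<forall>b\<in>B. \<exists>l::real. T b = l *\<^sub>R b)"

definition fredholm_det :: "('a::real_inner \<Rightarrow>\<^sub>L 'a) \<Rightarrow> real" where
  "fredholm_det T = (let B = (SOME B. eigen_onb T B) in
      Lim (finite_subsets_at_top B) (\<lambda>F. \<Prod>b\<in>F. inner (T b) b))"

definition gaussian_measure :: "'a::{real_inner,polish_space} measure \<Rightarrow> 'a \<Rightarrow> ('a \<Rightarrow>\<^sub>L 'a) \<Rightarrow> bool" where
  "gaussian_measure \<mu> m C \<longleftrightarrow> prob_space \<mu> \<and> sets \<mu> = sets borel \<and>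
     (\<forall>h. (\<integral>x. cis (inner x h) \<partial>\<mu>) = cis (inner m h) * complex_of_real (exp (- inner (C h) h / 2)))"

definition joint :: "'a::{real_inner,polish_space} measure \<Rightarrow> 'a measure \<Rightarrow> ('a \<times> 'a) measure set" where
  "joint \<mu> \<nu> = {\<gamma>. prob_space \<gamma> \<and> sets \<gamma> = sets (borel :: ('a \<times> 'a) measure) \<and>
      distr \<gamma> borel fst = \<mu> \<and> distr \<gamma> borel snd = \<nu>}"

definition KL_ext :: "'b measure \<Rightarrow> 'b measure \<Rightarrow> ereal" where
  "KL_ext \<gamma> P = (if absolutely_continuous P \<gamma> \<and> integrable \<gamma> (entropy_density (exp 1) P \<gamma>)
      then ereal (KL_divergence (exp 1) P \<gamma>) else \<infinity>)"

definition OT_eps :: "real \<Rightarrow> 'a::{real_inner,polish_space} measure \<Rightarrow> 'a measure \<Rightarrow> ereal" where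
  "OT_eps \<epsilon> \<mu> \<nu> = (INF \<gamma>\<in>joint \<mu> \<nu>.
      enn2ereal (\<integral>\<^sup>+ p. ennreal ((norm (fst p - snd p))\<^sup>2) \<partial>\<gamma>) + ereal \<epsilon> * KL_ext \<gamma> (\<mu> \<Otimes>\<^sub>M \<nu>))"

definition sinkhorn_div :: "real \<Rightarrow> 'a::{real_inner,polish_space} measure \<Rightarrow> 'a measure \<Rightarrow> ereal" where
  "sinkhorn_div \<epsilon> \<mu> \<nu> = OT_eps \<epsilon> \<mu> \<nu> - (OT_eps \<epsilon> \<mu> \<mu> + OT_eps \<epsilon> \<nu> \<nu>) / 2"

definition M_eps :: "real \<Rightarrow> ('a::real_inner \<Rightarrow>\<^sub>L 'a) \<Rightarrow> ('a \<Rightarrow>\<^sub>L 'a) \<Rightarrow> ('a \<Rightarrow>\<^sub>L 'a)" where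
  "M_eps \<epsilon> Ci Cj = - id_blinfun + op_sqrt (id_blinfun + (16 / \<epsilon>\<^sup>2) *\<^sub>R (op_sqrt Ci o\<^sub>L Cj o\<^sub>L op_sqrt Ci))"

end

theory Submission
  imports Defs
begin

text \<open>Let \<open>R\<^sub>i\<close> be the square root of \<open>C\<^sub>i\<close> and diagonalise \<open>R\<^sub>0 C\<^sub>1 R\<^sub>0\<close> with eigenvalues \<open>s\<^sub>k\<^sup>2\<close>. For \<open>s\<^sub>k > 0\<close>
  this gives vectors \<open>u\<^sub>k, v\<^sub>k\<close> with \<open>C\<^sub>0 u\<^sub>k = s\<^sub>k v\<^sub>k\<close> and \<open>C\<^sub>1 v\<^sub>k = s\<^sub>k u\<^sub>k\<close>, such that the functionals
  \<open>\<xi>\<^sub>k = \<langle>x - m\<^sub>0, u\<^sub>k\<rangle>\<close> and \<open>\<eta>\<^sub>k = \<langle>y - m\<^sub>1, v\<^sub>k\<rangle>\<close> are two i.i.d. standard normal families, and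
  \<open>\<langle>x - m\<^sub>0, y - m\<^sub>1\<rangle> = \<Sum>\<^sub>k s\<^sub>k \<xi>\<^sub>k \<eta>\<^sub>k\<close> in \<open>L\<^sup>2(\<mu>\<^sub>0 \<otimes> \<mu>\<^sub>1)\<close>. The transport problem thus splits into one-dimensional ones.
  Upper bound: for a finite set \<open>F\<close> of indices, the product over \<open>F\<close> of the optimal bivariate normal densities is the
  density of a coupling whose cost is explicit; let \<open>F\<close> grow. Lower bound: the limit of the logarithms of these
  densities is a sum of a function of \<open>x\<close>, a function of \<open>y\<close> and \<open>- \<parallel>x - y\<parallel>\<^sup>2 / \<epsilon>\<close>, and its exponential has mass at most
  1 by Fatou's lemma; the Donsker-Varadhan inequality then bounds the cost of every coupling.\<close>

section \<open>Orthonormal systems\<close>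

text \<open>The obstacle is that \<open>C0\<close> and \<open>C1\<close> need not be injective and
  their inverse roots are unbounded, so the measures cannot be whitened on the whole space. Each
  mode with \<open>s > 0\<close> still gives genuine vectors: for an eigenvector \<open>b\<close> of
  \<open>R0 C1 R0\<close> take \<open>v = R0 b / s\<close> and \<open>u = C1 v / s\<close>; then
  \<open>R0 u = b\<close>, and \<xi>, \<eta> are continuous functionals. Modes with
  \<open>s = 0\<close> contribute nothing. The constants come from dimension one. The cross term of
  \<open>-(norm (x - y))^2 / \<epsilon>\<close> gives each mode the coefficient
  \<open>b = 2 s / \<epsilon>\<close>. A normalised density
  \<open>exp (b x y - m/4 (x^2 + y^2))\<close> keeps standard normal marginals when
  \<open>b^2 = m (m + 2) / 4\<close>, that is, \<open>(m + 1)^2 = 1 + 16 s^2 / \<epsilon>^2\<close>: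
  this is the eigenvalue in \<open>M_eps\<close>. Since the cost is an infimum, finite sets of modes
  suffice above and no limiting coupling is constructed. Below, the series of cross terms converges
  only in the square mean for the product measure, which says nothing about integrals under another
  coupling; so the limiting log density keeps the inner product itself.\<close>

definition orthonormal :: "'a::real_inner set \<Rightarrow> bool" where
  "orthonormal S \<longleftrightarrow> (\<forall>b\<in>S. norm b = 1) \<and> (\<forall>a\<in>S. \<forall>b\<in>S. a \<noteq> b \<longrightarrow> inner a b = 0)"

lemma onb_orthonormal: "onb B \<Longrightarrow> orthonormal B"
  by (auto simp: onb_def orthonormal_def)

lemma orthonormal_inner:
  "orthonormal S \<Longrightarrow> a \<in> S \<Longrightarrow> b \<in> S \<Longrightarrow> inner a b = (if a = b then 1 else 0)"
  by (auto simp: orthonormal_def dot_square_norm)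

text \<open>Turns limits along \<open>finite_subsets_at_top S\<close> into limits of sequences, as
  monotone convergence, Fatou's lemma and the choice of subsequences require. The sets come from an
  enumeration of \<open>S\<close>.\<close>

lemma countable_exhaustion:
  assumes "countable S"
  obtains F :: "nat \<Rightarrow> 'a set" where "\<And>n. finite (F n)" "\<And>n. F n \<subseteq> S" "incseq F"
    "filterlim F (finite_subsets_at_top S) sequentially"
proof
  let ?F = "\<lambda>n. {b\<in>S. to_nat_on S b < n}"
  have inj: "inj_on (to_nat_on S) S"
    using assms by (rule inj_on_to_nat_on)
  show fin: "finite (?F n)" for n
    by (rule inj_on_finite[of "to_nat_on S" _ "{..<n}"]) (auto intro: inj_on_subset[OF inj])
  show "incseq ?F"
    by (auto simp: incseq_def)
  show "filterlim ?F (finite_subsets_at_top S) sequentially"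
    unfolding filterlim_finite_subsets_at_top
  proof (intro allI impI)
    fix X assume X: "finite X \<and> X \<subseteq> S"
    show "\<forall>\<^sub>F n in sequentially. finite (?F n) \<and> X \<subseteq> ?F n \<and> ?F n \<subseteq> S"
    proof (rule eventually_sequentiallyI[of "Suc (Max (to_nat_on S ` X))"])
      fix n assume n: "Suc (Max (to_nat_on S ` X)) \<le> n"
      have "to_nat_on S x < n" if "x \<in> X" for x
      proof -
        have "to_nat_on S x \<le> Max (to_nat_on S ` X)" using X that by (intro Max_ge) auto
        then show ?thesis using n by linarith
      qed
      then show "finite (?F n) \<and> X \<subseteq> ?F n \<and> ?F n \<subseteq> S"
        using X fin by auto
    qed
  qed
qed auto

text \<open>Distinct elements are at distance sqrt 2, so the balls of radius 1/2 around them are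
  disjoint, and each contains its own point of a countable dense set.\<close>

lemma orthonormal_countable:
  fixes S :: "'a::{real_inner,second_countable_topology} set"
  assumes "orthonormal S"
  shows "countable S"
proof -
  obtain D :: "'a set" where D: "countable D" "\<And>X. open X \<Longrightarrow> X \<noteq> {} \<Longrightarrow> \<exists>d\<in>D. d \<in> X"
    using countable_dense_setE by blast
  have "\<exists>d\<in>D. d \<in> ball b (1/2)" for b :: 'a
    by (rule D(2)) auto
  then obtain f where f: "\<And>b. f b \<in> D" "\<And>b. f b \<in> ball b (1/2)"
    by metis
  have "inj_on f S"
  proof (rule inj_onI, rule ccontr)
    fix a b assume ab: "a \<in> S" "b \<in> S" "f a = f b" "a \<noteq> b"
    have "dist a b < 1/2 + 1/2"
      using f(2)[of a] f(2)[of b] ab(3) by (metis dist_commute dist_triangle_less_add mem_ball)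
    moreover have "(dist a b)\<^sup>2 = 2"
      using ab assms unfolding dist_norm power2_norm_eq_inner
      by (simp add: inner_diff_left inner_diff_right orthonormal_inner)
    ultimately show False
      using power_mono[of "dist a b" 1 2] by simp
  qed
  moreover have "f ` S \<subseteq> D" using f by auto
  ultimately show ?thesis
    using D(1) countable_image_inj_on countable_subset by blast
qed

lemma orthonormal_sum_inner:
  assumes "orthonormal S" "finite F" "F \<subseteq> S" "a \<in> S"
  shows "inner (\<Sum>b\<in>F. c b *\<^sub>R b) a = (if a \<in> F then c a else 0)"
proof -
  have "inner (\<Sum>b\<in>F. c b *\<^sub>R b) a = (\<Sum>b\<in>F. if b = a then c b else 0)"
    unfolding inner_sum_left using assms by (intro sum.cong) (auto simp: orthonormal_inner)
  then show ?thesis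
    using assms by (simp add: sum.delta')
qed

lemma orthonormal_sum_norm:
  assumes "orthonormal S" "finite F" "F \<subseteq> S"
  shows "(norm (\<Sum>b\<in>F. c b *\<^sub>R b))\<^sup>2 = (\<Sum>b\<in>F. (c b)\<^sup>2)"
proof -
  have "(norm (\<Sum>b\<in>F. c b *\<^sub>R b))\<^sup>2 = (\<Sum>a\<in>F. inner (\<Sum>b\<in>F. c b *\<^sub>R b) (c a *\<^sub>R a))"
    unfolding power2_norm_eq_inner inner_sum_right[symmetric] ..
  also have "\<dots> = (\<Sum>a\<in>F. c a * inner (\<Sum>b\<in>F. c b *\<^sub>R b) a)"
    by (intro sum.cong) auto
  also have "\<dots> = (\<Sum>b\<in>F. (c b)\<^sup>2)"
    using assms by (intro sum.cong) (auto simp: orthonormal_sum_inner[OF assms] subset_iff power2_eq_square)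
  finally show ?thesis .
qed

lemma bessel_residual:
  assumes "orthonormal S" "finite F" "F \<subseteq> S"
  shows "(norm (x - (\<Sum>b\<in>F. inner x b *\<^sub>R b)))\<^sup>2 = (norm x)\<^sup>2 - (\<Sum>b\<in>F. (inner x b)\<^sup>2)"
proof -
  let ?p = "\<Sum>b\<in>F. inner x b *\<^sub>R b"
  have "inner x ?p = (\<Sum>b\<in>F. (inner x b)\<^sup>2)"
    by (simp add: inner_sum_right power2_eq_square)
  then show ?thesis
    using orthonormal_sum_norm[OF assms, of "inner x"]
    by (simp add: power2_norm_eq_inner inner_diff_left inner_diff_right inner_commute)
qed

lemma bessel_finite:
  assumes "orthonormal S" "finite F" "F \<subseteq> S"
  shows "(\<Sum>b\<in>F. (inner x b)\<^sup>2) \<le> (norm x)\<^sup>2"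
  using bessel_residual[OF assms, of x] by (smt (verit) zero_le_power2)

lemma bessel_summable:
  assumes "orthonormal S"
  shows "(\<lambda>b. (inner x b)\<^sup>2) summable_on S"
  by (rule nonneg_bdd_above_summable_on)
    (auto intro!: bdd_aboveI[of _ "(norm x)\<^sup>2"] bessel_finite[OF assms])

text \<open>Along an exhaustion the squared distance of two partial sums is the difference of their
  sums of squares, so the partial sums are Cauchy. Vectors and operators are later built from
  prescribed coordinates in this way.\<close>

lemma riesz_fischer:
  fixes S :: "'a::{real_inner,complete_space,second_countable_topology} set"
  assumes S: "orthonormal S" and c: "(\<lambda>b. (c b)\<^sup>2) summable_on S"
  obtains y where "y \<in> closure (span S)" "\<And>b. b \<in> S \<Longrightarrow> inner y b = c b"
    "((\<lambda>b. (c b)\<^sup>2) has_sum (norm y)\<^sup>2) S"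
proof -
  obtain F where F: "\<And>n. finite (F n)" "\<And>n. F n \<subseteq> S" "incseq F"
    "filterlim F (finite_subsets_at_top S) sequentially"
    using countable_exhaustion[OF orthonormal_countable[OF S]] by blast
  define T where "T n = (\<Sum>b\<in>F n. c b *\<^sub>R b)" for n
  define t where "t n = (\<Sum>b\<in>F n. (c b)\<^sup>2)" for n
  have hs: "((\<lambda>b. (c b)\<^sup>2) has_sum infsum (\<lambda>b. (c b)\<^sup>2) S) S"
    using c by simp
  have tlim: "t \<longlonglongrightarrow> infsum (\<lambda>b. (c b)\<^sup>2) S"
    unfolding t_def using filterlim_compose[OF hs[unfolded has_sum_def] F(4)] .
  have diff: "(norm (T n - T m))\<^sup>2 = t n - t m" if "m \<le> n" for m n
  proof -
    have sub: "F m \<subseteq> F n" using F(3) that by (auto simp: incseq_def)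
    have "T n - T m = (\<Sum>b\<in>F n - F m. c b *\<^sub>R b)"
      unfolding T_def using F(1) sub by (subst sum_diff) auto
    moreover have "t n - t m = (\<Sum>b\<in>F n - F m. (c b)\<^sup>2)"
      unfolding t_def using F(1) sub by (subst sum_diff) auto
    ultimately show ?thesis
      using orthonormal_sum_norm[OF S, of "F n - F m" c] F(1,2) by auto
  qed
  have "Cauchy T"
  proof (rule CauchyI')
    fix e :: real assume e: "e > 0"
    obtain N where N: "\<And>m n. m \<ge> N \<Longrightarrow> n \<ge> N \<Longrightarrow> dist (t m) (t n) < e\<^sup>2"
      using LIMSEQ_imp_Cauchy[OF tlim] e unfolding Cauchy_def by (meson zero_less_power)
    show "\<exists>M. \<forall>m\<ge>M. \<forall>n>m. dist (T m) (T n) < e"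
    proof (intro exI allI impI)
      fix m n assume "m \<ge> N" "n > m"
      then have "(norm (T n - T m))\<^sup>2 < e\<^sup>2"
        using diff[of m n] N[of m n] by (auto simp: dist_real_def)
      then show "dist (T m) (T n) < e"
        using e by (simp add: dist_norm norm_minus_commute power2_less_imp_less)
    qed
  qed
  then obtain y where y: "T \<longlonglongrightarrow> y"
    using Cauchy_convergent convergent_def by blast
  have "y \<in> closure (span S)"
  proof -
    have "T n \<in> span S" for n
      unfolding T_def using F(2) by (intro span_sum span_mul span_base) blast
    then show ?thesis using y unfolding closure_sequential by blast
  qed
  moreover have "inner y b = c b" if "b \<in> S" for b
  proof -
    have "(\<lambda>n. inner (T n) b) \<longlonglongrightarrow> inner y b"
      by (intro tendsto_intros y)
    moreover have "\<forall>\<^sub>F n in sequentially. {b} \<subseteq> F n"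
      using F(4) that unfolding filterlim_finite_subsets_at_top by (auto elim!: allE[of _ "{b}"] elim: eventually_mono)
    then have "\<forall>\<^sub>F n in sequentially. inner (T n) b = c b"
      by eventually_elim (use orthonormal_sum_inner[OF S F(1) F(2) that] in \<open>auto simp: T_def\<close>)
    then have "(\<lambda>n. inner (T n) b) \<longlonglongrightarrow> c b"
      by (rule tendsto_eventually)
    ultimately show ?thesis
      using LIMSEQ_unique by blast
  qed
  moreover have "((\<lambda>b. (c b)\<^sup>2) has_sum (norm y)\<^sup>2) S"
  proof -
    have "(\<lambda>n. (norm (T n))\<^sup>2) \<longlonglongrightarrow> (norm y)\<^sup>2"
      by (intro tendsto_intros y)
    moreover have "(norm (T n))\<^sup>2 = t n" for n
      unfolding T_def t_def by (rule orthonormal_sum_norm[OF S F(1) F(2)])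
    ultimately have "infsum (\<lambda>b. (c b)\<^sup>2) S = (norm y)\<^sup>2"
      using tlim LIMSEQ_unique by auto
    then show ?thesis using hs by simp
  qed
  ultimately show thesis using that by blast
qed

lemma onb_dense_closed:
  assumes "onb B" "closed {x. P x}" "subspace {x. P x}" "\<And>b. b \<in> B \<Longrightarrow> P b"
  shows "P x"
proof -
  have "span B \<subseteq> {x. P x}"
    using assms(3,4) by (intro span_minimal) auto
  then have "closure (span B) \<subseteq> {x. P x}"
    using assms(2) closure_minimal by blast
  then show ?thesis
    using assms(1) by (auto simp: onb_def)
qed

lemma onb_orthogonal_zero:
  assumes "onb B" "\<And>b. b \<in> B \<Longrightarrow> inner z b = 0"
  shows "z = 0"
proof -
  have "inner z x = 0" for x
  proof (rule onb_dense_closed[OF assms(1)])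
    show "closed {x. inner z x = 0}"
      by (intro closed_Collect_eq continuous_intros)
    show "subspace {x. inner z x = 0}"
      by (auto simp: subspace_def inner_add_right)
  qed (use assms in auto)
  from this[of z] show ?thesis by simp
qed

lemma onb_eqI:
  assumes "onb B" "\<And>b. b \<in> B \<Longrightarrow> inner x b = inner y b"
  shows "x = y"
  using onb_orthogonal_zero[OF assms(1), of "x - y"] assms(2) by (simp add: inner_diff_left)

lemma blinfun_onb_eqI:
  fixes S T :: "'a::real_inner \<Rightarrow>\<^sub>L 'b::real_normed_vector"
  assumes "onb B" "\<And>b. b \<in> B \<Longrightarrow> S b = T b"
  shows "S = T"
proof (rule blinfun_eqI)
  fix x
  show "S x = T x"
  proof (rule onb_dense_closed[OF assms(1)])
    show "closed {x. S x = T x}"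
      by (intro closed_Collect_eq continuous_intros)
    show "subspace {x. S x = T x}"
      by (auto simp: subspace_def blinfun.add_right blinfun.scaleR_right)
  qed (use assms in auto)
qed

text \<open>The vector with the coefficients of \<open>x\<close> lies in the closed span, and its
  difference from \<open>x\<close> is orthogonal to \<open>S\<close>, hence zero. This is the
  criterion applied to the family that Zorn's lemma provides.\<close>

lemma orthonormal_maximal_onb:
  fixes S :: "'a::{real_inner,complete_space,second_countable_topology} set"
  assumes S: "orthonormal S" and max: "\<And>z. (\<And>b. b \<in> S \<Longrightarrow> inner z b = 0) \<Longrightarrow> z = 0"
  shows "onb S"
proof -
  have "x \<in> closure (span S)" for x
  proof -
    obtain y where y: "y \<in> closure (span S)" "\<And>b. b \<in> S \<Longrightarrow> inner y b = inner x b"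
      using riesz_fischer[OF S bessel_summable[OF S, of x]] by blast
    have "x - y = 0" by (rule max) (simp add: inner_diff_left y)
    then show ?thesis using y by simp
  qed
  then show ?thesis using S by (auto simp: onb_def orthonormal_def)
qed

lemma parseval:
  fixes B :: "'a::{real_inner,complete_space,second_countable_topology} set"
  assumes B: "onb B"
  shows "((\<lambda>b. (inner x b)\<^sup>2) has_sum (norm x)\<^sup>2) B"
proof -
  obtain y where y: "\<And>b. b \<in> B \<Longrightarrow> inner y b = inner x b" "((\<lambda>b. (inner x b)\<^sup>2) has_sum (norm y)\<^sup>2) B"
    using riesz_fischer[OF onb_orthonormal[OF B] bessel_summable[OF onb_orthonormal[OF B], of x]] by blast
  have "y = x" using onb_eqI[OF B] y(1) by blast
  then show ?thesis using y(2) by simp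
qed

text \<open>Bounded multipliers preserve square summability of coordinates, so
  \<open>riesz_fischer\<close> gives each value; comparing Parseval sums gives the norm
  bound.\<close>

lemma diagonal_operator_exists:
  fixes B :: "'a::{real_inner,complete_space,second_countable_topology} set"
  assumes B: "onb B" and l: "\<And>b. b \<in> B \<Longrightarrow> \<bar>l b\<bar> \<le> L"
  obtains D :: "'a \<Rightarrow>\<^sub>L 'a" where "\<And>x b. b \<in> B \<Longrightarrow> inner (D x) b = l b * inner x b"
proof -
  note o = onb_orthonormal[OF B]
  have sq: "(l b * inner x b)\<^sup>2 \<le> L\<^sup>2 * (inner x b)\<^sup>2" if "b \<in> B" for b x
    using l[OF that] by (auto simp: power_mult_distrib intro!: mult_right_mono abs_le_square_iff[THEN iffD1])
  have sumL: "(\<lambda>b. L\<^sup>2 * (inner x b)\<^sup>2) summable_on B" for x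
    by (intro summable_on_cmult_right bessel_summable o)
  have sm: "(\<lambda>b. (l b * inner x b)\<^sup>2) summable_on B" for x
    by (rule summable_on_comparison_test[OF sumL sq]) auto
  have "\<exists>y. (\<forall>b\<in>B. inner y b = l b * inner x b) \<and> ((\<lambda>b. (l b * inner x b)\<^sup>2) has_sum (norm y)\<^sup>2) B" for x
    using riesz_fischer[OF o sm, of x] by metis
  then obtain d where d: "\<And>x b. b \<in> B \<Longrightarrow> inner (d x) b = l b * inner x b"
    "\<And>x. ((\<lambda>b. (l b * inner x b)\<^sup>2) has_sum (norm (d x))\<^sup>2) B"
    by metis
  have "bounded_linear d"
  proof (rule bounded_linear_intro[of _ "\<bar>L\<bar>"])
    show "d (x + y) = d x + d y" for x y
      by (rule onb_eqI[OF B]) (simp add: d(1) inner_add_left algebra_simps)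
    show "d (r *\<^sub>R x) = r *\<^sub>R d x" for r x
      by (rule onb_eqI[OF B]) (simp add: d(1) algebra_simps)
    show "norm (d x) \<le> norm x * \<bar>L\<bar>" for x
    proof -
      have "(norm (d x))\<^sup>2 \<le> L\<^sup>2 * (norm x)\<^sup>2"
        using has_sum_mono[OF d(2) has_sum_cmult_right[OF parseval[OF B, of x]] sq] by simp
      then show ?thesis
        by (metis abs_norm_cancel abs_le_square_iff abs_mult mult.commute power_mult_distrib)
    qed
  qed
  then show thesis
    using that[of "Blinfun d"] d(1) by (simp add: bounded_linear_Blinfun_apply)
qed

section \<open>Spectral theorem for positive trace class operators\<close>

text \<open>Discriminant of the nonnegative quadratic polynomial in \<open>t\<close> obtained from
  the form at \<open>x + t y\<close>. The form may be degenerate, so a vanishing leading coefficient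
  is a separate case.\<close>

lemma positive_op_cauchy_schwarz:
  assumes "positive_op A"
  shows "(inner (A x) y)\<^sup>2 \<le> inner (A x) x * inner (A y) y"
proof -
  have sa: "inner (A y) x = inner (A x) y"
    using assms unfolding positive_op_def selfadj_op_def by (metis inner_commute)
  have q: "0 \<le> inner (A x) x + 2 * t * inner (A x) y + t\<^sup>2 * inner (A y) y" for t
  proof -
    have "0 \<le> inner (A (x + t *\<^sub>R y)) (x + t *\<^sub>R y)"
      using assms by (simp add: positive_op_def)
    also have "\<dots> = inner (A x) x + 2 * t * inner (A x) y + t\<^sup>2 * inner (A y) y"
      using sa by (simp add: blinfun.add_right blinfun.scaleR_right inner_add_left inner_add_right
          power2_eq_square algebra_simps)
    finally show ?thesis .
  qed
  let ?a = "inner (A x) x" and ?b = "inner (A x) y" and ?c = "inner (A y) y"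
  have c0: "0 \<le> ?c" using assms by (simp add: positive_op_def)
  show ?thesis
  proof (cases "?c = 0")
    case True
    have "?b = 0"
    proof (rule ccontr)
      assume "?b \<noteq> 0"
      \<comment> \<open>With the quadratic coefficient gone, this \<open>t\<close> gives the
        polynomial the value -1.\<close>
      then show False
        using q[of "- (?a + 1) / (2 * ?b)"] True by (simp add: field_simps)
    qed
    then show ?thesis using True by simp
  next
    case False
    have "0 \<le> ?a - ?b\<^sup>2 / ?c"
      using q[of "- ?b / ?c"] False by (simp add: power2_eq_square field_simps)
    then show ?thesis
      using c0 False by (simp add: field_simps)
  qed
qed

lemma positive_op_inner_le:
  "inner (A x) x \<le> norm A * (norm x)\<^sup>2" for A :: "'a::real_inner \<Rightarrow>\<^sub>L 'a"
proof -
  have "inner (A x) x \<le> norm (A x) * norm x" by (rule norm_cauchy_schwarz)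
  also have "\<dots> \<le> (norm A * norm x) * norm x" by (intro mult_right_mono norm_blinfun) auto
  finally show ?thesis by (simp add: power2_eq_square mult.assoc)
qed

text \<open>Induction on \<open>F\<close>: each new vector adds a compact segment, and sums of
  compact sets are compact.\<close>

lemma compact_bounded_combinations:
  fixes F :: "'a::real_normed_vector set"
  assumes "finite F"
  shows "compact {\<Sum>b\<in>F. c b *\<^sub>R b |c. \<forall>b\<in>F. \<bar>c b\<bar> \<le> R}"
  using assms
proof induction
  case empty
  show ?case by simp
next
  case (insert a F)
  let ?K = "{\<Sum>b\<in>F. c b *\<^sub>R b |c. \<forall>b\<in>F. \<bar>c b\<bar> \<le> R}"
  let ?L = "(\<lambda>t. t *\<^sub>R a) ` {-R..R}"
  have "{\<Sum>b\<in>insert a F. c b *\<^sub>R b |c. \<forall>b\<in>insert a F. \<bar>c b\<bar> \<le> R} = {x + y |x y. x \<in> ?L \<and> y \<in> ?K}"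
    (is "?l = ?r")
  proof (intro equalityI subsetI)
    fix z assume "z \<in> ?l"
    then obtain c where "\<forall>b\<in>insert a F. \<bar>c b\<bar> \<le> R" "z = c a *\<^sub>R a + (\<Sum>b\<in>F. c b *\<^sub>R b)"
      using insert.hyps by auto
    moreover from this have "c a *\<^sub>R a \<in> ?L" by (intro imageI) (auto simp: abs_le_iff)
    ultimately show "z \<in> ?r" by fastforce
  next
    fix z assume "z \<in> ?r"
    then obtain x y where xy: "x \<in> ?L" "y \<in> ?K" "z = x + y" by blast
    obtain t where "\<bar>t\<bar> \<le> R" "x = t *\<^sub>R a" using xy(1) by (force simp: abs_le_iff)
    moreover obtain c where "\<forall>b\<in>F. \<bar>c b\<bar> \<le> R" "y = (\<Sum>b\<in>F. c b *\<^sub>R b)" using xy(2) by blast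
    ultimately have tc: "\<bar>t\<bar> \<le> R" "\<forall>b\<in>F. \<bar>c b\<bar> \<le> R" "z = t *\<^sub>R a + (\<Sum>b\<in>F. c b *\<^sub>R b)"
      using xy(3) by auto
    have "(\<Sum>b\<in>F. (c(a := t)) b *\<^sub>R b) = (\<Sum>b\<in>F. c b *\<^sub>R b)"
      using insert.hyps by (intro sum.cong) auto
    then have "z = (\<Sum>b\<in>insert a F. (c(a := t)) b *\<^sub>R b)"
      using insert.hyps tc by simp
    moreover have "\<forall>b\<in>insert a F. \<bar>(c(a := t)) b\<bar> \<le> R" using tc by auto
    ultimately show "z \<in> ?l" by blast
  qed
  moreover have "compact ?L"
    by (intro compact_continuous_image continuous_intros compact_Icc)
  ultimately show ?case
    using compact_sums[OF _ insert.IH] by simp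
qed

text \<open>Cauchy-Schwarz for the form of \<open>A\<close> bounds the square of
  \<open>inner (A x) b\<close> by \<open>norm A * inner (A b) b\<close> on the unit ball. The trace
  thus controls the tails of all \<open>A x\<close> at once, and the image stays close to a compact
  set of finite combinations.\<close>

lemma pos_trace_class_compact:
  fixes A :: "'a::{real_inner,complete_space,second_countable_topology} \<Rightarrow>\<^sub>L 'a"
  assumes "pos_trace_class A"
  shows "compact (closure (A ` cball 0 1))"
  unfolding compact_eq_totally_bounded
proof (intro conjI allI impI)
  show "Topological_Spaces.complete (closure (A ` cball 0 1))"
    by (simp add: complete_eq_closed)
  fix e :: real assume e: "0 < e"
  obtain B where B: "onb B" "(\<lambda>b. inner (A b) b) summable_on B" and A: "positive_op A"
    using assms by (auto simp: pos_trace_class_def)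
  define s where "s = infsum (\<lambda>b. inner (A b) b) B"
  have hs: "((\<lambda>b. inner (A b) b) has_sum s) B" using B(2) by (simp add: s_def)
  \<comment> \<open>Makes \<open>(norm A + 1) * d\<close> the square of \<open>e/4\<close>; the
    added 1 covers \<open>A = 0\<close>.\<close>
  define d where "d = (e/4)\<^sup>2 / (norm A + 1)"
  have "d > 0" using e by (auto simp: d_def intro!: divide_pos_pos add_nonneg_pos)
  then have "\<forall>\<^sub>F F in finite_subsets_at_top B. dist (\<Sum>b\<in>F. inner (A b) b) s < d"
    using hs unfolding has_sum_def tendsto_iff by blast
  then obtain F where F: "finite F" "F \<subseteq> B" "dist (\<Sum>b\<in>F. inner (A b) b) s < d"
    unfolding eventually_finite_subsets_at_top by blast
  let ?K = "{\<Sum>b\<in>F. c b *\<^sub>R b |c. \<forall>b\<in>F. \<bar>c b\<bar> \<le> norm A}"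
  have approx: "\<exists>k\<in>?K. dist (A x) k \<le> e/4" if x: "norm x \<le> 1" for x
  proof
    let ?p = "\<Sum>b\<in>F. inner (A x) b *\<^sub>R b"
    have nAx: "norm (A x) \<le> norm A"
      using norm_blinfun[of A x] x by (meson mult_left_le norm_ge_zero order_trans)
    have "\<bar>inner (A x) b\<bar> \<le> norm A" if "b \<in> F" for b
    proof -
      have "norm b = 1" using that F(2) B(1) by (auto simp: onb_def)
      then show ?thesis using Cauchy_Schwarz_ineq2[of "A x" b] nAx by simp
    qed
    then show "?p \<in> ?K" by blast
    have Axx: "inner (A x) x \<le> norm A"
    proof -
      have "inner (A x) x \<le> norm A * (norm x)\<^sup>2" by (rule positive_op_inner_le)
      also have "\<dots> \<le> norm A" using x by (simp add: mult_left_le power_le_one)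
      finally show ?thesis .
    qed
    have "((\<lambda>b. (inner (A x) b)\<^sup>2) has_sum ((norm (A x))\<^sup>2 - (\<Sum>b\<in>F. (inner (A x) b)\<^sup>2))) (B - F)"
      by (intro has_sum_Diff parseval B has_sum_finite F)
    moreover have "((\<lambda>b. norm A * inner (A b) b) has_sum norm A * (s - (\<Sum>b\<in>F. inner (A b) b))) (B - F)"
      by (intro has_sum_cmult_right has_sum_Diff hs has_sum_finite F)
    moreover have "(inner (A x) b)\<^sup>2 \<le> norm A * inner (A b) b" for b
    proof -
      have "(inner (A x) b)\<^sup>2 \<le> inner (A x) x * inner (A b) b"
        by (rule positive_op_cauchy_schwarz[OF A])
      also have "\<dots> \<le> norm A * inner (A b) b"
        using A Axx by (intro mult_right_mono) (auto simp: positive_op_def)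
      finally show ?thesis .
    qed
    ultimately have "(norm (A x))\<^sup>2 - (\<Sum>b\<in>F. (inner (A x) b)\<^sup>2) \<le> norm A * (s - (\<Sum>b\<in>F. inner (A b) b))"
      using has_sum_mono by blast
    also have "\<dots> \<le> (norm A + 1) * d"
    proof (rule mult_mono)
      show "s - (\<Sum>b\<in>F. inner (A b) b) \<le> d" using F(3) by (simp add: dist_real_def)
      have "(\<Sum>b\<in>F. inner (A b) b) \<le> s"
        using has_sum_mono2[OF has_sum_finite[OF F(1)] hs F(2)] A by (auto simp: positive_op_def)
      then show "0 \<le> s - (\<Sum>b\<in>F. inner (A b) b)" by simp
    qed auto
    also have "\<dots> = (e/4)\<^sup>2" by (simp add: d_def add_nonneg_eq_0_iff)
    finally have "(norm (A x - ?p))\<^sup>2 \<le> (e/4)\<^sup>2"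
      using bessel_residual[OF onb_orthonormal[OF B(1)] F(1,2), of "A x"] by simp
    then have "norm (A x - ?p) \<le> e/4"
      by (rule power2_le_imp_le) (use e in simp)
    then show "dist (A x) ?p \<le> e/4" by (simp only: dist_norm)
  qed
  have "compact ?K" using F(1) by (rule compact_bounded_combinations)
  then have "\<exists>k. finite k \<and> ?K \<subseteq> (\<Union>x\<in>k. ball x (e/2))"
    using compact_eq_totally_bounded[of ?K] e half_gt_zero by blast
  then obtain k where k: "finite k \<and> ?K \<subseteq> (\<Union>x\<in>k. ball x (e/2))" ..

  have "closure (A ` cball 0 1) \<subseteq> (\<Union>x\<in>k. ball x e)"
  proof
    fix y assume "y \<in> closure (A ` cball 0 1)"
    then have "\<exists>a\<in>A ` cball 0 1. dist a y < e/4"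
      using e closure_approachable[of y "A ` cball 0 1"] by (metis divide_pos_pos zero_less_numeral)
    then obtain x where x: "norm x \<le> 1" "dist (A x) y < e/4" by auto
    obtain p where p: "p \<in> ?K" "dist (A x) p \<le> e/4" using approx[OF x(1)] by blast
    obtain q where q: "q \<in> k" "dist q p < e/2" using subsetD[OF conjunct2[OF k] p(1)] by (meson UN_E mem_ball)
    have "dist q y \<le> dist q p + (dist (A x) p + dist (A x) y)"
      using dist_triangle[of q y p] dist_triangle3[of p y "A x"] by linarith
    then have "dist q y < e" using x p q by simp
    then show "y \<in> (\<Union>x\<in>k. ball x e)" using q(1) by auto
  qed
  then show "\<exists>k. finite k \<and> closure (A ` cball 0 1) \<subseteq> (\<Union>x\<in>k. ball x e)"
    using k by blast
qed

text \<open>The supremum \<open>l\<close> of the Rayleigh quotient on \<open>V\<close> is attained: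
  for a maximising sequence \<open>A X - l X\<close> tends to 0, compactness makes
  \<open>A X\<close> converge along a subsequence, and dividing by \<open>l > 0\<close> makes
  \<open>X\<close> converge. If \<open>l = 0\<close>, then \<open>A\<close> vanishes on
  \<open>V\<close>.\<close>

lemma eigenvector_in_invariant_subspace:
  fixes A :: "'a::real_inner \<Rightarrow>\<^sub>L 'a"
  assumes A: "positive_op A" and cpt: "compact (closure (A ` cball 0 1))"
    and V: "subspace V" "closed V" "\<And>x. x \<in> V \<Longrightarrow> A x \<in> V"
    and z: "z \<in> V" "z \<noteq> 0"
  obtains x l where "x \<in> V" "norm x = 1" "A x = l *\<^sub>R x"
proof -
  define Q where "Q = {inner (A x) x |x. x \<in> V \<and> norm x = 1}"
  define l where "l = Sup Q"
  let ?z = "z /\<^sub>R norm z"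
  have zV: "?z \<in> V" "norm ?z = 1" using V(1) z by (auto simp: subspace_def)
  have bdd: "bdd_above Q"
    using positive_op_inner_le[of A] by (auto simp: Q_def intro!: bdd_aboveI[of _ "norm A"]) (metis mult.right_neutral one_power2)
  have ne: "Q \<noteq> {}" using zV by (auto simp: Q_def)
  have le: "inner (A x) x \<le> l * (norm x)\<^sup>2" if x: "x \<in> V" for x
  proof (cases "x = 0")
    case False
    have "inner (A (x /\<^sub>R norm x)) (x /\<^sub>R norm x) \<le> l"
      unfolding l_def using x False V(1) by (intro cSup_upper bdd) (auto simp: Q_def subspace_def intro!: exI[of _ "x /\<^sub>R norm x"])
    then show ?thesis
      using False by (simp add: blinfun.scaleR_right field_simps power2_eq_square)
  qed simp
  have l0: "0 \<le> l"
    using le[OF zV(1)] A zV(2) by (metis mult.right_neutral one_power2 order_trans positive_op_def)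
  \<comment> \<open>Cauchy-Schwarz for the form of \<open>A\<close> at \<open>x\<close> and
    \<open>A x\<close>, with the Rayleigh bound used at \<open>A x\<close>. This is what makes the
    residual of a maximising sequence small.\<close>
  have le2: "(norm (A x))\<^sup>2 \<le> l * inner (A x) x" if x: "x \<in> V" for x
  proof (cases "A x = 0")
    case False
    have "((norm (A x))\<^sup>2)\<^sup>2 \<le> inner (A x) x * inner (A (A x)) (A x)"
      using positive_op_cauchy_schwarz[OF A, of x "A x"] by (simp add: power2_norm_eq_inner)
    also have "\<dots> \<le> inner (A x) x * (l * (norm (A x))\<^sup>2)"
      using A by (intro mult_left_mono le V(3) x) (auto simp: positive_op_def)
    finally show ?thesis
      using False by (simp add: power2_eq_square algebra_simps)
  qed (use l0 A in \<open>auto simp: positive_op_def\<close>)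
  show thesis
  proof (cases "l = 0")
    case True
    then have "A ?z = 0 *\<^sub>R ?z" using le2[OF zV(1)] by simp
    then show thesis using that zV by blast
  next
    case False
    then have lpos: "l > 0" using l0 by simp
    have "\<exists>x. x \<in> V \<and> norm x = 1 \<and> l - 1 / real (Suc n) < inner (A x) x" for n :: nat
    proof -
      have "l - 1 / real (Suc n) < Sup Q" by (simp add: l_def)
      then show ?thesis using less_cSup_iff[OF ne bdd] by (auto simp: Q_def)
    qed
    then obtain X where X: "\<And>n. X n \<in> V" "\<And>n. norm (X n) = 1"
      "\<And>n. l - 1 / real (Suc n) < inner (A (X n)) (X n)"
      by metis
    have "\<forall>n. A (X n) \<in> closure (A ` cball 0 1)"
      using X(2) by (intro allI subsetD[OF closure_subset] imageI) simp
    then obtain y r where r: "strict_mono (r :: nat \<Rightarrow> nat)" "((\<lambda>n. A (X n)) \<circ> r) \<longlonglongrightarrow> y"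
      using cpt[unfolded compact_def, rule_format, of "\<lambda>n. A (X n)"] by blast
    have res: "(norm (A (X n) - l *\<^sub>R X n))\<^sup>2 \<le> l * (1 / real (Suc n))" for n
    proof -
      have "(norm (A (X n) - l *\<^sub>R X n))\<^sup>2 = (norm (A (X n)))\<^sup>2 - 2 * l * inner (A (X n)) (X n) + l\<^sup>2"
        using X(2)[of n] unfolding power2_norm_eq_inner
        by (simp add: inner_diff_left inner_diff_right inner_commute norm_eq_1 power2_eq_square algebra_simps)
      also have "\<dots> \<le> l * (l - inner (A (X n)) (X n))"
        using le2[OF X(1)[of n]] by (simp add: power2_eq_square algebra_simps)
      also have "\<dots> \<le> l * (1 / real (Suc n))"
        using X(3)[of n] lpos by (intro mult_left_mono) auto
      finally show ?thesis .
    qed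
    have "(\<lambda>n. (norm (A (X n) - l *\<^sub>R X n))\<^sup>2) \<longlonglongrightarrow> 0"
    proof (rule tendsto_sandwich[OF _ _ tendsto_const])
      show "(\<lambda>n. l * (1 / real (Suc n))) \<longlonglongrightarrow> 0"
        using tendsto_mult_right_zero[OF LIMSEQ_Suc[OF lim_1_over_n]] by simp
    qed (use res in auto)
    then have "(\<lambda>n. A (X n) - l *\<^sub>R X n) \<longlonglongrightarrow> 0"
      by (simp add: tendsto_norm_zero_iff)
    then have "(\<lambda>n. A (X (r n)) - l *\<^sub>R X (r n)) \<longlonglongrightarrow> 0"
      using LIMSEQ_subseq_LIMSEQ[OF _ r(1)] by (auto simp: o_def)
    from tendsto_diff[OF r(2) this] have lX: "(\<lambda>n. l *\<^sub>R X (r n)) \<longlonglongrightarrow> y" by (simp add: o_def)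
    from tendsto_scaleR[OF tendsto_const[of "inverse l"] this]
    have Xr: "(\<lambda>n. X (r n)) \<longlonglongrightarrow> y /\<^sub>R l" using lpos by simp
    have "y /\<^sub>R l \<in> V" by (rule closed_sequentially[OF V(2) _ Xr]) (use X(1) in simp)
    moreover have "norm (y /\<^sub>R l) = 1"
      using tendsto_norm[OF Xr] X(2) by (simp add: LIMSEQ_const_iff)
    moreover have "A (y /\<^sub>R l) = l *\<^sub>R (y /\<^sub>R l)"
    proof -
      have "(\<lambda>n. A (X (r n))) \<longlonglongrightarrow> A (y /\<^sub>R l)" by (intro tendsto_intros Xr)
      then have "A (y /\<^sub>R l) = y" using r(2) LIMSEQ_unique by (auto simp: o_def)
      then show ?thesis using lpos by simp
    qed
    ultimately show thesis using that by blast
  qed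
qed

text \<open>Zorn's lemma for orthonormal sets of eigenvectors. The orthogonal complement of a
  maximal set is closed and, by self-adjointness, invariant; if it were nonzero it would contain one
  more eigenvector.\<close>

theorem pos_trace_class_eigen_onb:
  fixes A :: "'a::{real_inner,complete_space,second_countable_topology} \<Rightarrow>\<^sub>L 'a"
  assumes "pos_trace_class A"
  obtains B where "eigen_onb A B"
proof -
  have A: "positive_op A" using assms by (simp add: pos_trace_class_def)
  define \<F> where "\<F> = {S. orthonormal S \<and> (\<forall>b\<in>S. \<exists>l. A b = l *\<^sub>R b)}"
  have "\<exists>M\<in>\<F>. \<forall>X\<in>\<F>. M \<subseteq> X \<longrightarrow> X = M"
  proof (rule subset_Zorn')
    fix C assume "subset.chain \<F> C"
    then have C: "C \<subseteq> \<F>" "\<And>X Y. X \<in> C \<Longrightarrow> Y \<in> C \<Longrightarrow> X \<subseteq> Y \<or> Y \<subseteq> X"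
      by (auto simp: subset_chain_def)
    have "inner a b = 0" if "a \<in> \<Union>C" "b \<in> \<Union>C" "a \<noteq> b" for a b
    proof -
      obtain X where "X \<in> C" "a \<in> X" "b \<in> X" using \<open>a \<in> \<Union>C\<close> \<open>b \<in> \<Union>C\<close> C(2) by blast
      then show ?thesis using C(1) \<open>a \<noteq> b\<close> by (auto simp: \<F>_def orthonormal_def)
    qed
    then show "\<Union>C \<in> \<F>"
      using C(1) unfolding \<F>_def orthonormal_def by blast
  qed
  then obtain S where S: "orthonormal S" "\<And>b. b \<in> S \<Longrightarrow> \<exists>l. A b = l *\<^sub>R b"
    and max: "\<And>X. X \<in> \<F> \<Longrightarrow> S \<subseteq> X \<Longrightarrow> X = S"
    by (auto simp: \<F>_def)
  have "onb S"
  proof (rule orthonormal_maximal_onb[OF S(1)], rule ccontr)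
    fix z assume z: "\<And>b. b \<in> S \<Longrightarrow> inner z b = 0" "z \<noteq> 0"
    define V where "V = {x. \<forall>b\<in>S. inner x b = 0}"
    have "subspace V" by (auto simp: V_def subspace_def inner_add_left)
    moreover have "closed V"
    proof -
      have "V = (\<Inter>b\<in>S. {x. inner x b = 0})" by (auto simp: V_def)
      then show ?thesis by (auto intro!: closed_INT closed_Collect_eq continuous_intros)
    qed
    moreover have "A x \<in> V" if "x \<in> V" for x
    proof -
      have "inner (A x) b = 0" if b: "b \<in> S" for b
      proof -
        obtain l where "A b = l *\<^sub>R b" using S(2) b by blast
        then have "inner (A x) b = l * inner x b"
          using A by (simp add: positive_op_def selfadj_op_def)
        then show ?thesis using \<open>x \<in> V\<close> b by (simp add: V_def)
      qed
      then show ?thesis by (simp add: V_def)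
    qed
    moreover have "z \<in> V" using z(1) by (simp add: V_def)
    ultimately obtain x l where x: "x \<in> V" "norm x = 1" "A x = l *\<^sub>R x"
      using eigenvector_in_invariant_subspace[OF A pos_trace_class_compact[OF assms]] z(2) by metis
    have "insert x S \<in> \<F>"
      using S x by (auto simp: \<F>_def orthonormal_def V_def inner_commute)
    then have "x \<in> S" using max by blast
    then have "inner x x = 0" using x(1) by (simp add: V_def)
    then show False using x(2) by auto
  qed
  then show thesis using that S(2) by (auto simp: eigen_onb_def)
qed

section \<open>Square roots, traces and determinants\<close>

lemma diagonal_selfadj_exists:
  fixes B :: "'a::{real_inner,complete_space,second_countable_topology} set"
  assumes B: "onb B" and l: "\<And>b. b \<in> B \<Longrightarrow> \<bar>l b\<bar> \<le> L"
  obtains D :: "'a \<Rightarrow>\<^sub>L 'a" where "selfadj_op D" "\<And>b. b \<in> B \<Longrightarrow> D b = l b *\<^sub>R b"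
proof -
  obtain D :: "'a \<Rightarrow>\<^sub>L 'a" where D: "\<And>x b. b \<in> B \<Longrightarrow> inner (D x) b = l b * inner x b"
    by (rule diagonal_operator_exists[OF B l]) auto
  have eig: "D b = l b *\<^sub>R b" if b: "b \<in> B" for b
  proof (rule onb_eqI[OF B])
    fix b' assume b': "b' \<in> B"
    show "inner (D b) b' = inner (l b *\<^sub>R b) b'"
      using D[OF b', of b] orthonormal_inner[OF onb_orthonormal[OF B] b b'] by auto
  qed
  have "inner (D x) y = inner x (D y)" for x y
  proof (rule onb_dense_closed[OF B, where P = "\<lambda>y. inner (D x) y = inner x (D y)"])
    show "closed {y. inner (D x) y = inner x (D y)}"
      by (intro closed_Collect_eq continuous_intros)
    show "subspace {y. inner (D x) y = inner x (D y)}"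
      by (auto simp: subspace_def blinfun.add_right blinfun.scaleR_right inner_add_right)
  qed (simp add: D eig)
  then have "selfadj_op D" by (simp add: selfadj_op_def)
  then show thesis by (rule that) (rule eig)
qed

lemma positive_op_square:
  assumes "selfadj_op E"
  shows "positive_op (E o\<^sub>L E)"
proof -
  have adj: "inner (E x) y = inner x (E y)" for x y
    using assms unfolding selfadj_op_def by blast
  have "inner (E (E x)) y = inner x (E (E y))" for x y
    unfolding adj ..
  moreover have "0 \<le> inner (E (E x)) x" for x
    unfolding adj[of "E x" x] by (rule inner_ge_zero)
  ultimately show ?thesis by (simp only: positive_op_def selfadj_op_def blinfun_apply_blinfun_compose) blast
qed

text \<open>The root is built as the square of a diagonal operator with fourth roots as entries,
  because the square of a self-adjoint operator is positive without further computation.\<close>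

lemma eigenbasis_positive_op:
  fixes A :: "'a::{real_inner,complete_space,second_countable_topology} \<Rightarrow>\<^sub>L 'a"
  assumes B: "onb B" and l: "\<And>b. b \<in> B \<Longrightarrow> A b = l b *\<^sub>R b" "\<And>b. b \<in> B \<Longrightarrow> 0 \<le> l b"
  obtains R where "positive_op R" "R o\<^sub>L R = A" "\<And>b. b \<in> B \<Longrightarrow> R b = sqrt (l b) *\<^sub>R b"
proof -
  have le: "l b \<le> norm A" if "b \<in> B" for b
  proof -
    have "norm b = 1" using B that by (simp add: onb_def)
    then show ?thesis
      using norm_blinfun[of A b] l that by simp
  qed
  obtain E :: "'a \<Rightarrow>\<^sub>L 'a" where E: "selfadj_op E" "\<And>b. b \<in> B \<Longrightarrow> E b = sqrt (sqrt (l b)) *\<^sub>R b"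
    by (rule diagonal_selfadj_exists[OF B, of "\<lambda>b. sqrt (sqrt (l b))" "sqrt (sqrt (norm A))"])
      (use le l in auto)
  define R where "R = E o\<^sub>L E"
  have Rb: "R b = sqrt (l b) *\<^sub>R b" if "b \<in> B" for b
    using that l(2) by (simp add: R_def E blinfun.scaleR_right)
  have "R o\<^sub>L R = A"
    by (rule blinfun_onb_eqI[OF B]) (simp add: Rb l blinfun.scaleR_right)
  then show thesis
    using that Rb positive_op_square[OF E(1)] by (simp add: R_def)
qed

text \<open>Source of the uniqueness of positive roots: for \<open>l > 0\<close> the error
  \<open>R b - sqrt l b\<close> is mapped by \<open>R\<close> to \<open>- sqrt l\<close> times
  itself, which positivity allows only for the zero vector.\<close>

lemma positive_square_root_eigenvector:
  assumes R: "positive_op R" and b: "R (R b) = l *\<^sub>R b" "0 \<le> l"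
  shows "R b = sqrt l *\<^sub>R b"
proof (cases "l = 0")
  case True
  have "inner (R b) (R b) = inner (R (R b)) b"
    using R by (simp add: positive_op_def selfadj_op_def)
  then show ?thesis using True b by simp
next
  case False
  then have "0 < sqrt l" using b by simp
  define w where "w = R b - sqrt l *\<^sub>R b"
  have "R w = - sqrt l *\<^sub>R w"
    using b by (simp add: w_def blinfun.diff_right blinfun.scaleR_right scaleR_diff_right)
  then have "0 \<le> - sqrt l * inner w w"
    using R unfolding positive_op_def by (metis inner_scaleR_left)
  then have "inner w w \<le> 0"
    using \<open>0 < sqrt l\<close> by (simp add: mult_le_0_iff)
  then have "w = 0"
    using inner_gt_zero_iff[of w] by linarith
  then show ?thesis by (simp add: w_def)
qed

lemma eigen_onb_eigenvalue:
  assumes "eigen_onb A B" "b \<in> B"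
  shows "A b = inner (A b) b *\<^sub>R b"
proof -
  have nb: "norm b = 1" using assms by (auto simp: eigen_onb_def onb_def)
  obtain l where "A b = l *\<^sub>R b"
    using assms unfolding eigen_onb_def by meson
  with nb have "inner (A b) b = l" by (simp add: dot_square_norm)
  with \<open>A b = l *\<^sub>R b\<close> show ?thesis by simp
qed

text \<open>The \<open>THE\<close> in \<open>op_sqrt\<close> is resolved on the eigenbasis, where
  all positive roots take the same values.\<close>

lemma op_sqrt_eigen:
  fixes A :: "'a::{real_inner,complete_space,second_countable_topology} \<Rightarrow>\<^sub>L 'a"
  assumes A: "positive_op A" and B: "eigen_onb A B"
  shows op_sqrt_positive: "positive_op (op_sqrt A)"
    and op_sqrt_square: "op_sqrt A o\<^sub>L op_sqrt A = A"
    and op_sqrt_eigenvector: "b \<in> B \<Longrightarrow> op_sqrt A b = sqrt (inner (A b) b) *\<^sub>R b"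
proof -
  have onb: "onb B" using B by (simp add: eigen_onb_def)
  obtain R where R: "positive_op R" "R o\<^sub>L R = A" "\<And>b. b \<in> B \<Longrightarrow> R b = sqrt (inner (A b) b) *\<^sub>R b"
    using eigenbasis_positive_op[OF onb eigen_onb_eigenvalue[OF B]] A
    unfolding positive_op_def by (metis (no_types, lifting))
  have "op_sqrt A = R"
    unfolding op_sqrt_def
  proof (rule the_equality)
    fix S assume S: "positive_op S \<and> S o\<^sub>L S = A"
    show "S = R"
    proof (rule blinfun_onb_eqI[OF onb])
      fix b assume b: "b \<in> B"
      have "S (S b) = inner (A b) b *\<^sub>R b"
        using S eigen_onb_eigenvalue[OF B b] by (metis blinfun_apply_blinfun_compose)
      then show "S b = R b"
        using positive_square_root_eigenvector[of S b] S A R(3)[OF b] by (simp add: positive_op_def)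
    qed
  qed (use R in simp)
  with R show "positive_op (op_sqrt A)" "op_sqrt A o\<^sub>L op_sqrt A = A"
    "b \<in> B \<Longrightarrow> op_sqrt A b = sqrt (inner (A b) b) *\<^sub>R b" by auto
qed

lemma pos_trace_class_op_sqrt:
  fixes A :: "'a::{real_inner,complete_space,second_countable_topology} \<Rightarrow>\<^sub>L 'a"
  assumes "pos_trace_class A"
  shows "positive_op (op_sqrt A)" "op_sqrt A o\<^sub>L op_sqrt A = A"
  using pos_trace_class_eigen_onb[OF assms] op_sqrt_eigen assms
  by (metis pos_trace_class_def)+

lemma square_root_inner:
  assumes "positive_op R"
  shows "inner ((R o\<^sub>L R) x) x = (norm (R x))\<^sup>2"
  using assms by (simp add: positive_op_def selfadj_op_def power2_norm_eq_inner)

text \<open>Both sums equal the double sum of the squares of \<open>inner (R b) b'\<close>,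
  evaluated by Parseval in either order. With \<open>S = R\<close> it gives independence of the
  trace from the basis; with \<open>R = R1 R0\<close> it identifies the traces of
  \<open>R0 C1 R0\<close> and \<open>R1 C0 R1\<close>.\<close>

lemma hilbert_schmidt_swap:
  fixes R S :: "'a::{real_inner,complete_space,second_countable_topology} \<Rightarrow>\<^sub>L 'a"
  assumes B: "onb B" and B': "onb B'" and adj: "\<And>x y. inner (R x) y = inner x (S y)"
    and s: "((\<lambda>b. (norm (R b))\<^sup>2) has_sum s) B"
  shows "((\<lambda>b. (norm (S b))\<^sup>2) has_sum s) B'"
proof -
  let ?g = "\<lambda>(b, b'). (inner (R b) b')\<^sup>2"
  have row: "((\<lambda>b'. ?g (b, b')) has_sum (norm (R b))\<^sup>2) B'" for b
    using parseval[OF B', of "R b"] by simp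
  have "?g summable_on B \<times> B'"
    by (rule summable_on_SigmaI[OF row]) (use s in \<open>auto simp: summable_on_def\<close>)
  then have "(?g has_sum s) (B \<times> B')"
    using has_sum_SigmaI[OF row s] by blast
  then have "((\<lambda>(b', b). ?g (b, b')) has_sum s) (B' \<times> B)"
    unfolding has_sum_swap[of ?g] by (simp add: case_prod_unfold)
  then show ?thesis
  proof (rule has_sum_SigmaD)
    fix b'
    have "inner (S b') b = inner (R b) b'" for b
      using adj[of b b'] by (simp add: inner_commute)
    then show "((\<lambda>b. case (b', b) of (b', b) \<Rightarrow> ?g (b, b')) has_sum (norm (S b'))\<^sup>2) B"
      using parseval[OF B, of "S b'"] by simp
  qed
qed

text \<open>The diagonal entries are squared norms of the root, so their sum is the same in every
  orthonormal basis, including the one selected by \<open>SOME\<close>.\<close>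

lemma op_trace_has_sum:
  fixes A :: "'a::{real_inner,complete_space,second_countable_topology} \<Rightarrow>\<^sub>L 'a"
  assumes A: "pos_trace_class A" and B: "onb B"
  shows "((\<lambda>b. inner (A b) b) has_sum op_trace A) B"
proof -
  define R where "R = op_sqrt A"
  have R: "positive_op R" "R o\<^sub>L R = A"
    unfolding R_def by (rule pos_trace_class_op_sqrt[OF A])+
  have q: "inner (A x) x = (norm (R x))\<^sup>2" for x
    using square_root_inner[OF R(1), of x] R(2) by simp
  have adj: "inner (R x) y = inner x (R y)" for x y
    using R(1) by (simp add: positive_op_def selfadj_op_def)
  obtain B0 where B0: "onb B0" "(\<lambda>b. inner (A b) b) summable_on B0"
    using A by (auto simp: pos_trace_class_def)
  let ?s = "infsum (\<lambda>b. inner (A b) b) B0"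
  have s0: "((\<lambda>b. (norm (R b))\<^sup>2) has_sum ?s) B0"
    using B0(2) by (simp add: q)
  have s: "((\<lambda>b. inner (A b) b) has_sum ?s) B'" if "onb B'" for B'
    unfolding q using hilbert_schmidt_swap[OF B0(1) that adj s0[unfolded q]] by (simp add: q)
  have "onb (SOME B::'a set. onb B)" using B by (rule someI)
  from infsumI[OF s[OF this]] have "op_trace A = ?s" by (simp add: op_trace_def)
  then show ?thesis using s[OF B] by simp
qed

lemma pos_trace_class_conj:
  fixes C R :: "'a::{real_inner,complete_space,second_countable_topology} \<Rightarrow>\<^sub>L 'a"
  assumes C: "positive_op C" and R: "positive_op R" "pos_trace_class (R o\<^sub>L R)"
  shows "pos_trace_class (R o\<^sub>L C o\<^sub>L R)"
proof -
  have adj: "inner (R x) y = inner x (R y)" for x y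
    using R(1) by (simp add: positive_op_def selfadj_op_def)
  have pos: "positive_op (R o\<^sub>L C o\<^sub>L R)"
    unfolding positive_op_def selfadj_op_def
  proof (intro conjI allI)
    have "inner (C x) y = inner x (C y)" for x y
      using C by (simp add: positive_op_def selfadj_op_def)
    then show "inner ((R o\<^sub>L C o\<^sub>L R) x) y = inner x ((R o\<^sub>L C o\<^sub>L R) y)" for x y
      by (simp add: adj)
    have "0 \<le> inner (C (R x)) (R x)" for x
      using C by (simp add: positive_op_def)
    then show "0 \<le> inner ((R o\<^sub>L C o\<^sub>L R) x) x" for x
      by (simp add: adj[of "C (R x)" x])
  qed
  obtain B where B: "onb B" "(\<lambda>b. inner ((R o\<^sub>L R) b) b) summable_on B"
    using R(2) by (auto simp: pos_trace_class_def)
  have "(\<lambda>b. inner ((R o\<^sub>L C o\<^sub>L R) b) b) summable_on B"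
  proof (rule summable_on_comparison_test)
    show "(\<lambda>b. norm C * inner ((R o\<^sub>L R) b) b) summable_on B"
      by (intro summable_on_cmult_right B)
    show "inner ((R o\<^sub>L C o\<^sub>L R) b) b \<le> norm C * inner ((R o\<^sub>L R) b) b" for b
      using positive_op_inner_le[of C "R b"] square_root_inner[OF R(1), of b] adj[of "C (R b)" b] by simp
    show "0 \<le> inner ((R o\<^sub>L C o\<^sub>L R) b) b" for b
      using pos by (simp add: positive_op_def)
  qed
  then show ?thesis using pos B(1) by (auto simp: pos_trace_class_def)
qed

lemma sqrt_one_plus_le: "0 \<le> x \<Longrightarrow> sqrt (1 + x) - 1 \<le> x / 2"
proof -
  assume x: "0 \<le> x"
  have "sqrt (1 + x) \<le> 1 + x / 2"
    by (rule real_le_lsqrt) (use x in \<open>auto simp: power2_eq_square algebra_simps\<close>)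
  then show ?thesis by simp
qed

lemma selfadj_op_id_plus: "selfadj_op A \<Longrightarrow> selfadj_op (id_blinfun + c *\<^sub>R A)"
  by (simp add: selfadj_op_def blinfun.add_left blinfun.scaleR_left inner_add_left inner_add_right)

lemma positive_op_id_plus: "positive_op A \<Longrightarrow> 0 \<le> c \<Longrightarrow> positive_op (id_blinfun + c *\<^sub>R A)"
  by (simp add: positive_op_def selfadj_op_id_plus blinfun.add_left blinfun.scaleR_left inner_add_left)

text \<open>\<open>B\<close> is the unknown basis selected inside \<open>fredholm_det\<close>, so
  the spectral conditions stand as premises inside the conclusion, to be checked once
  \<open>B\<close> is in hand. For eigenvalues at least 1, \<open>ln t \<le> t - 1\<close> makes the
  logarithms summable.\<close>

lemma fredholm_det_eq_exp_sum:
  assumes "eigen_onb T B0"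
  obtains B where "eigen_onb T B"
    "(\<And>b. b \<in> B \<Longrightarrow> inner (T b) b \<ge> 1) \<Longrightarrow> (\<lambda>b. inner (T b) b - 1) summable_on B \<Longrightarrow>
      (\<lambda>b. ln (inner (T b) b)) summable_on B \<and>
      fredholm_det T = exp (infsum (\<lambda>b. ln (inner (T b) b)) B)"
proof
  let ?B = "SOME B. eigen_onb T B"
  show "eigen_onb T ?B" using assms by (rule someI)
  assume ge: "\<And>b. b \<in> ?B \<Longrightarrow> inner (T b) b \<ge> 1" and sm: "(\<lambda>b. inner (T b) b - 1) summable_on ?B"
  have ln: "(\<lambda>b. ln (inner (T b) b)) summable_on ?B"
  proof (rule summable_on_comparison_test[OF sm])
    show "ln (inner (T b) b) \<le> inner (T b) b - 1" if "b \<in> ?B" for b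
      using ge[OF that] by (intro ln_le_minus_one) simp
    show "0 \<le> ln (inner (T b) b)" if "b \<in> ?B" for b
      using ge[OF that] by simp
  qed
  have "((\<lambda>F. exp (\<Sum>b\<in>F. ln (inner (T b) b))) \<longlongrightarrow> exp (infsum (\<lambda>b. ln (inner (T b) b)) ?B))
      (finite_subsets_at_top ?B)"
    using has_sum_infsum[OF ln] unfolding has_sum_def by (intro tendsto_intros)
  moreover have "\<forall>\<^sub>F F in finite_subsets_at_top ?B. exp (\<Sum>b\<in>F. ln (inner (T b) b)) = (\<Prod>b\<in>F. inner (T b) b)"
  proof (rule eventually_finite_subsets_at_top_weakI)
    fix F assume F: "finite F" "F \<subseteq> ?B"
    show "exp (\<Sum>b\<in>F. ln (inner (T b) b)) = (\<Prod>b\<in>F. inner (T b) b)"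
      unfolding exp_sum[OF F(1)] using ge F(2) by (intro prod.cong) (force simp: subset_iff)+
  qed
  ultimately have "((\<lambda>F. \<Prod>b\<in>F. inner (T b) b) \<longlongrightarrow> exp (infsum (\<lambda>b. ln (inner (T b) b)) ?B))
      (finite_subsets_at_top ?B)"
    by (rule Lim_transform_eventually)
  then have "fredholm_det T = exp (infsum (\<lambda>b. ln (inner (T b) b)) ?B)"
    unfolding fredholm_det_def Let_def by (intro tendsto_Lim) auto
  then show "(\<lambda>b. ln (inner (T b) b)) summable_on ?B \<and>
      fredholm_det T = exp (infsum (\<lambda>b. ln (inner (T b) b)) ?B)"
    using ln by simp
qed

text \<open>A basis diagonalising \<open>id + N/2\<close> also diagonalises \<open>A\<close>, because \<open>(id + N)\<^sup>2 = id + c A\<close>; so the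
  eigenbasis chosen in \<open>fredholm_det\<close> is the one to work in.\<close>

lemma sqrt_id_plus_eigenbasis:
  fixes A :: "'a::{real_inner,complete_space,second_countable_topology} \<Rightarrow>\<^sub>L 'a"
  assumes A: "pos_trace_class A" and c: "0 < c"
  defines "N \<equiv> - id_blinfun + op_sqrt (id_blinfun + c *\<^sub>R A)"
  obtains B a where "onb B" "\<And>b. b \<in> B \<Longrightarrow> A b = a b *\<^sub>R b" "\<And>b. b \<in> B \<Longrightarrow> 0 \<le> a b"
    "(a has_sum op_trace A) B"
    "pos_trace_class N"
    "((\<lambda>b. sqrt (1 + c * a b) - 1) has_sum op_trace N) B"
    "((\<lambda>b. ln (1 + (sqrt (1 + c * a b) - 1) / 2)) has_sum ln (fredholm_det (id_blinfun + (1/2) *\<^sub>R N))) B"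
    "0 < fredholm_det (id_blinfun + (1/2) *\<^sub>R N)"
proof -
  let ?Q = "id_blinfun + c *\<^sub>R A" and ?T = "id_blinfun + (1/2) *\<^sub>R N"
  have Apos: "positive_op A" using A by (simp add: pos_trace_class_def)
  have Qpos: "positive_op ?Q" using Apos c by (simp add: positive_op_id_plus)
  \<comment> \<open>\<open>B0\<close> certifies that \<open>?T\<close> has an eigenbasis; the sums
    below run over the basis \<open>B\<close> that the determinant picks.\<close>
  obtain B0 where B0: "eigen_onb A B0" using pos_trace_class_eigen_onb[OF A] by blast
  have "?Q b = (1 + c * inner (A b) b) *\<^sub>R b" if "b \<in> B0" for b
    using eigen_onb_eigenvalue[OF B0 that]
    by (simp add: blinfun.add_left blinfun.scaleR_left scaleR_add_left) (metis scaleR_scaleR)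
  then have Q0: "eigen_onb ?Q B0" using B0 by (auto simp: eigen_onb_def)
  note sq = op_sqrt_eigen[OF Qpos Q0]
  have NB0: "N b = (sqrt (inner (?Q b) b) - 1) *\<^sub>R b" if "b \<in> B0" for b
    using sq(3)[OF that] by (simp add: N_def blinfun.add_left blinfun.diff_left blinfun.minus_left scaleR_diff_left)
  have "?T b = (1 + (sqrt (inner (?Q b) b) - 1) / 2) *\<^sub>R b" if "b \<in> B0" for b
    using NB0[OF that] by (simp add: blinfun.add_left blinfun.scaleR_left scaleR_add_left)
  then have T0: "eigen_onb ?T B0" using B0 unfolding eigen_onb_def by blast
  obtain B where B: "eigen_onb ?T B" and det: "(\<And>b. b \<in> B \<Longrightarrow> inner (?T b) b \<ge> 1) \<Longrightarrow> (\<lambda>b. inner (?T b) b - 1) summable_on B \<Longrightarrow>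
      (\<lambda>b. ln (inner (?T b) b)) summable_on B \<and>
      fredholm_det ?T = exp (infsum (\<lambda>b. ln (inner (?T b) b)) B)"
    using fredholm_det_eq_exp_sum[OF T0] by blast
  have onb: "onb B" using B by (simp add: eigen_onb_def)
  have nb: "norm b = 1" if "b \<in> B" for b using onb that by (simp add: onb_def)
  define a where "a b = inner (A b) b" for b
  have a0: "0 \<le> a b" for b using Apos by (simp add: a_def positive_op_def)
  have Ab: "A b = a b *\<^sub>R b" if b: "b \<in> B" for b
  proof -
    obtain l where l: "?T b = l *\<^sub>R b" using B b by (auto simp: eigen_onb_def)
    have S: "op_sqrt ?Q b = (2 * l - 1) *\<^sub>R b"
    proof -
      have "op_sqrt ?Q b = 2 *\<^sub>R ?T b - b"
        by (simp add: N_def blinfun.add_left blinfun.diff_left blinfun.minus_left blinfun.scaleR_left scaleR_add_right scaleR_2)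
      then show ?thesis using l by (simp add: scaleR_diff_left)
    qed
    have "?Q b = (2 * l - 1)\<^sup>2 *\<^sub>R b"
      using arg_cong[OF sq(2), of "\<lambda>X. X b"] S by (simp add: blinfun.scaleR_right power2_eq_square)
    then have "c *\<^sub>R A b = ((2 * l - 1)\<^sup>2 - 1) *\<^sub>R b"
      by (simp add: blinfun.add_left blinfun.scaleR_left scaleR_diff_left algebra_simps)
    then have "A b = (((2 * l - 1)\<^sup>2 - 1) / c) *\<^sub>R b"
      using c by (metis divide_inverse_commute less_irrefl scaleR_left_imp_eq scaleR_scaleR nonzero_eq_divide_eq mult.commute)
    then show ?thesis using nb[OF b] by (simp add: a_def dot_square_norm)
  qed
  have eA: "eigen_onb A B" using onb Ab by (auto simp: eigen_onb_def)
  have Qb: "?Q b = (1 + c * a b) *\<^sub>R b" if "b \<in> B" for b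
    using Ab[OF that] by (simp add: blinfun.add_left blinfun.scaleR_left scaleR_add_left)
  then have QB: "eigen_onb ?Q B" using onb by (auto simp: eigen_onb_def)
  have NB: "N b = (sqrt (1 + c * a b) - 1) *\<^sub>R b" if "b \<in> B" for b
  proof -
    have "inner (?Q b) b = 1 + c * a b" using Qb[OF that] nb[OF that] by (simp add: dot_square_norm)
    then show ?thesis
      using op_sqrt_eigen(3)[OF Qpos QB that]
      by (simp add: N_def blinfun.add_left blinfun.diff_left blinfun.minus_left scaleR_diff_left)
  qed
  have m0: "0 \<le> sqrt (1 + c * a b) - 1" for b using a0[of b] c by simp
  have as: "(a has_sum op_trace A) B"
    using op_trace_has_sum[OF A onb] by (simp add: a_def[abs_def])
  have msum: "(\<lambda>b. sqrt (1 + c * a b) - 1) summable_on B"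
  proof (rule summable_on_comparison_test)
    show "(\<lambda>b. c / 2 * a b) summable_on B"
      using as by (intro summable_on_cmult_right) (auto simp: summable_on_def)
    show "sqrt (1 + c * a b) - 1 \<le> c / 2 * a b" for b
      using sqrt_one_plus_le[of "c * a b"] a0[of b] c by simp
  qed (use m0 in auto)
  have Nbb: "inner (N b) b = sqrt (1 + c * a b) - 1" if "b \<in> B" for b
    using NB[OF that] nb[OF that] by (simp add: dot_square_norm)
  have Ntc: "pos_trace_class N"
  proof -
    obtain R where "positive_op R" "R o\<^sub>L R = N"
      using eigenbasis_positive_op[OF onb NB m0] by metis
    then have "positive_op N" using positive_op_square by (metis positive_op_def)
    moreover have "(\<lambda>b. inner (N b) b) summable_on B"
      using msum summable_on_cong[of B "\<lambda>b. inner (N b) b"] Nbb by auto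
    ultimately show ?thesis using onb by (auto simp: pos_trace_class_def)
  qed
  have Ntr: "((\<lambda>b. sqrt (1 + c * a b) - 1) has_sum op_trace N) B"
    using op_trace_has_sum[OF Ntc onb] has_sum_cong[of B "\<lambda>b. inner (N b) b"] Nbb by auto
  have Tb: "inner (?T b) b = 1 + (sqrt (1 + c * a b) - 1) / 2" if "b \<in> B" for b
    using NB[OF that] nb[OF that]
    by (simp add: blinfun.add_left blinfun.scaleR_left inner_add_left dot_square_norm)
  have ge1: "inner (?T b) b \<ge> 1" if "b \<in> B" for b using Tb[OF that] m0[of b] by simp
  have T1: "(\<lambda>b. inner (?T b) b - 1) summable_on B"
    using summable_on_cong[of B "\<lambda>b. inner (?T b) b - 1" "\<lambda>b. (sqrt (1 + c * a b) - 1) * (1/2)"] Tb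
      summable_on_cmult_left[OF msum, of "1/2"] by auto
  note d = det[OF ge1 T1]
  have fd: "fredholm_det ?T = exp (infsum (\<lambda>b. ln (inner (?T b) b)) B)"
    by (rule conjunct2[OF d])
  have "ln (fredholm_det ?T) = infsum (\<lambda>b. ln (inner (?T b) b)) B"
    by (simp only: fd ln_exp)
  then have "((\<lambda>b. ln (inner (?T b) b)) has_sum ln (fredholm_det ?T)) B"
    using has_sum_infsum[OF conjunct1[OF d]] by (simp only:)
  then have lns: "((\<lambda>b. ln (1 + (sqrt (1 + c * a b) - 1) / 2)) has_sum ln (fredholm_det ?T)) B"
    using has_sum_cong[of B "\<lambda>b. ln (inner (?T b) b)"] Tb by auto
  have det0: "0 < fredholm_det ?T"
    by (simp only: fd exp_gt_zero)
  have a0': "0 \<le> a b" if "b \<in> B" for b by (rule a0)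
  show thesis
    by (rule that[of B a]; fact onb Ab a0' as Ntc Ntr lns det0)
qed

section \<open>Independence from joint characteristic functions\<close>

text \<open>Reweighting by \<open>Z / c\<close> gives a probability measure under which
  \<open>X\<close> has the same characteristic function as under \<open>M\<close>; by Levy's
  uniqueness theorem the laws agree. If \<open>c = 0\<close>, the weight vanishes almost
  everywhere.\<close>

lemma (in prob_space) weighted_char_indicator:
  fixes X Z :: "'a \<Rightarrow> real"
  assumes X [measurable]: "X \<in> borel_measurable M" and Z [measurable]: "Z \<in> borel_measurable M"
    and Z0: "\<And>x. 0 \<le> Z x" and ZK: "\<And>x. Z x \<le> K"
    and cf: "\<And>s. (\<integral>x. Z x *\<^sub>R cis (s * X x) \<partial>M) = complex_of_real (\<integral>x. Z x \<partial>M) * char (distr M borel X) s"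
    and A [measurable]: "A \<in> sets borel"
  shows "(\<integral>x. Z x * indicator A (X x) \<partial>M) = (\<integral>x. Z x \<partial>M) * (\<integral>x. indicator A (X x) \<partial>M)"
proof -
  define c where "c = (\<integral>x. Z x \<partial>M)"
  have int: "integrable M Z"
    by (rule integrable_const_bound[of _ K]) (use Z0 ZK in auto)
  have c0: "0 \<le> c" unfolding c_def by (rule Bochner_Integration.integral_nonneg) (rule Z0)
  show ?thesis
  proof (cases "c = 0")
    case True
    then have ae: "AE x in M. Z x = 0"
      using integral_nonneg_eq_0_iff_AE[OF int] Z0 by (simp add: c_def)
    have "(\<integral>x. Z x * indicator A (X x) \<partial>M) = (\<integral>x. 0 \<partial>M)"
      by (rule integral_cong_AE) (use ae in auto)
    then show ?thesis using True by (simp add: c_def)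
  next
    case False
    then have cpos: "0 < c" using c0 by simp
    define N where "N = density M (\<lambda>x. ennreal (Z x / c))"
    have "(\<integral>\<^sup>+ x. ennreal (Z x / c) \<partial>M) = ennreal (\<integral>x. Z x / c \<partial>M)"
      by (rule nn_integral_eq_integral) (use int Z0 cpos in auto)
    then have mass: "(\<integral>\<^sup>+ x. ennreal (Z x / c) \<partial>M) = 1"
      using False by (simp add: c_def)
    interpret N: prob_space N
      by (rule prob_spaceI) (simp add: N_def emeasure_density mass cong: nn_integral_cong)
    have XN: "X \<in> borel_measurable N" by (simp add: N_def)
    have "char (distr N borel X) s = char (distr M borel X) s" for s
    proof -
      have "char (distr N borel X) s = (\<integral>x. iexp (s * X x) \<partial>N)"
        unfolding char_def by (rule integral_distr) (use XN in auto)
      also have "\<dots> = (\<integral>x. (Z x / c) *\<^sub>R iexp (s * X x) \<partial>M)"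
        unfolding N_def by (rule integral_density) (use Z0 cpos in auto)
      also have "\<dots> = (\<integral>x. complex_of_real (1 / c) * (Z x *\<^sub>R cis (s * X x)) \<partial>M)"
        by (rule Bochner_Integration.integral_cong) (auto simp: cis_conv_exp scaleR_conv_of_real)
      also have "\<dots> = complex_of_real (1 / c) * (complex_of_real c * char (distr M borel X) s)"
        by (subst integral_mult_right_zero) (simp add: cf c_def)
      finally show ?thesis using False by simp
    qed
    then have "distr N borel X = distr M borel X"
      using XN by (intro Levy_uniqueness ext N.real_distribution_distr real_distribution_distr) auto
    then have "(\<integral>x. indicator A x \<partial>distr N borel X) = (\<integral>x. (indicator A x :: real) \<partial>distr M borel X)"
      by simp
    then have "(\<integral>x. indicator A (X x) \<partial>N) = (\<integral>x. (indicator A (X x) :: real) \<partial>M)"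
      using XN by (subst (asm) (1 2) integral_distr) auto
    moreover have "(\<integral>x. indicator A (X x) \<partial>N) = (\<integral>x. (Z x / c) *\<^sub>R (indicator A (X x) :: real) \<partial>M)"
      unfolding N_def by (rule integral_density) (use Z0 cpos in auto)
    ultimately have "(\<integral>x. (Z x * indicator A (X x)) / c \<partial>M) = (\<integral>x. (indicator A (X x) :: real) \<partial>M)"
      by simp
    then show ?thesis using False by (simp add: c_def field_simps)
  qed
qed

text \<open>The preceding lemma needs a nonnegative weight, but \<open>cis (Y x)\<close> is complex.
  It is applied to \<open>W\<close> and to \<open>W * (2 + cos (Y + t))\<close>, and the difference
  isolates \<open>W * cos (Y + t)\<close>; \<open>t = 0\<close> and \<open>t = - pi/2\<close> give
  the real and the imaginary part.\<close>

lemma (in prob_space) weighted_char_cis_indicator: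
  fixes X Y W :: "'a \<Rightarrow> real"
  assumes X [measurable]: "X \<in> borel_measurable M" and Y [measurable]: "Y \<in> borel_measurable M"
    and W [measurable]: "W \<in> borel_measurable M" and W0: "\<And>x. 0 \<le> W x" and W1: "\<And>x. W x \<le> 1"
    and cf: "\<And>r s. (\<integral>x. W x *\<^sub>R cis (r * Y x + s * X x) \<partial>M) =
        (\<integral>x. W x *\<^sub>R cis (r * Y x) \<partial>M) * char (distr M borel X) s"
    and A [measurable]: "A \<in> sets borel"
  shows "(\<integral>x. (W x * indicator A (X x)) *\<^sub>R cis (Y x) \<partial>M) =
      (\<integral>x. W x *\<^sub>R cis (Y x) \<partial>M) * complex_of_real (\<integral>x. indicator A (X x) \<partial>M)"
proof -
  let ?p = "\<integral>x. (indicator A (X x) :: real) \<partial>M"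
  have int: "integrable M (\<lambda>x. (W x * v x) *\<^sub>R cis (r * Y x + s * X x))"
    if [measurable]: "v \<in> borel_measurable M" and v: "\<And>x. \<bar>v x\<bar> \<le> 1" for r s v
  proof (rule integrable_const_bound[of _ 1])
    have "(\<lambda>x. cis (r * Y x + s * X x)) \<in> borel_measurable M"
      unfolding cis_conv_exp by measurable
    then show "(\<lambda>x. (W x * v x) *\<^sub>R cis (r * Y x + s * X x)) \<in> borel_measurable M" by measurable
    show "AE x in M. norm ((W x * v x) *\<^sub>R cis (r * Y x + s * X x)) \<le> 1"
      using W0 W1 v by (auto simp: abs_mult intro!: mult_le_one)
  qed
  note int1 = int[of "\<lambda>_. 1", simplified]
  have key: "(\<integral>x. W x * indicator A (X x) * cos (Y x + t) \<partial>M) = (\<integral>x. W x * cos (Y x + t) \<partial>M) * ?p" for t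
  proof -
    have "(\<integral>x. W x * indicator A (X x) \<partial>M) = (\<integral>x. W x \<partial>M) * ?p"
    proof (rule weighted_char_indicator[where K = 1])
      show "(\<integral>x. W x *\<^sub>R cis (s * X x) \<partial>M) = complex_of_real (\<integral>x. W x \<partial>M) * char (distr M borel X) s" for s
        using cf[of 0 s] by (simp add: scaleR_conv_of_real)
    qed (use W0 W1 in auto)
    moreover have "(\<integral>x. (W x * (2 + cos (Y x + t))) * indicator A (X x) \<partial>M) = (\<integral>x. W x * (2 + cos (Y x + t)) \<partial>M) * ?p"
    proof (rule weighted_char_indicator[where K = 3])
      have exp: "(W x * (2 + cos (Y x + t))) *\<^sub>R cis (s * X x) =
          2 * (W x *\<^sub>R cis (0 * Y x + s * X x)) + (cis t / 2) * (W x *\<^sub>R cis (1 * Y x + s * X x))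
           + (cis (- t) / 2) * (W x *\<^sub>R cis ((-1) * Y x + s * X x))" for x s
      proof -
        have "complex_of_real (cos (Y x + t)) = (cis (Y x) * cis t + cis (- Y x) * cis (- t)) / 2"
          by (simp add: complex_eq_iff cos_add)
        then have eW: "complex_of_real (W x * (2 + cos (Y x + t))) =
            complex_of_real (W x) * (2 + (cis (Y x) * cis t + cis (- Y x) * cis (- t)) / 2)"
          by simp
        have e: "cis ((-1) * Y x + s * X x) = cis (- Y x) * cis (s * X x)"
          "cis (1 * Y x + s * X x) = cis (Y x) * cis (s * X x)"
          by (simp_all only: cis_mult mult_1 mult_minus1)
        have "complex_of_real (W x) * (2 + (cis (Y x) * cis t + cis (- Y x) * cis (- t)) / 2) * cis (s * X x) =
            2 * (complex_of_real (W x) * cis (s * X x)) + (cis t / 2) * (complex_of_real (W x) * (cis (Y x) * cis (s * X x)))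
             + (cis (- t) / 2) * (complex_of_real (W x) * (cis (- Y x) * cis (s * X x)))"
          by (simp add: algebra_simps)
        then show ?thesis
          unfolding scaleR_conv_of_real eW e by (simp only: mult_zero_left add_0_left)
      qed
      have lin: "(\<integral>x. c1 * f x + c2 * g x + c3 * h x \<partial>M) =
          c1 * (\<integral>x. f x \<partial>M) + c2 * (\<integral>x. g x \<partial>M) + c3 * (\<integral>x. h x \<partial>M)"
        if "integrable M f" "integrable M g" "integrable M h" for c1 c2 c3 and f g h :: "'a \<Rightarrow> complex"
        using that by simp
      have I: "(\<integral>x. (W x * (2 + cos (Y x + t))) *\<^sub>R cis (s * X x) \<partial>M) =
          2 * (\<integral>x. W x *\<^sub>R cis (0 * Y x + s * X x) \<partial>M) + (cis t / 2) * (\<integral>x. W x *\<^sub>R cis (1 * Y x + s * X x) \<partial>M)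
           + (cis (- t) / 2) * (\<integral>x. W x *\<^sub>R cis ((-1) * Y x + s * X x) \<partial>M)" for s
        unfolding exp by (rule lin[OF int1 int1 int1])
      show "(\<integral>x. (W x * (2 + cos (Y x + t))) *\<^sub>R cis (s * X x) \<partial>M) =
          complex_of_real (\<integral>x. W x * (2 + cos (Y x + t)) \<partial>M) * char (distr M borel X) s" for s
      proof -
        have c: "complex_of_real (\<integral>x. W x * (2 + cos (Y x + t)) \<partial>M) =
           2 * (\<integral>x. W x *\<^sub>R cis (0 * Y x) \<partial>M) + (cis t / 2) * (\<integral>x. W x *\<^sub>R cis (1 * Y x) \<partial>M)
           + (cis (- t) / 2) * (\<integral>x. W x *\<^sub>R cis ((-1) * Y x) \<partial>M)"
          using I[of 0] by (simp add: scaleR_conv_of_real flip: integral_complex_of_real)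
        show ?thesis unfolding I c cf by (simp add: algebra_simps)
      qed
      show "W x * (2 + cos (Y x + t)) \<le> 3" for x
        using mult_mono[OF W1[of x], of "2 + cos (Y x + t)" 3] cos_le_one[of "Y x + t"] cos_ge_minus_one[of "Y x + t"] W0[of x] by simp
      show "0 \<le> W x * (2 + cos (Y x + t))" for x
      proof -
        have "0 \<le> 2 + cos (Y x + t)" using cos_ge_minus_one[of "Y x + t"] by linarith
        then show ?thesis using W0[of x] by (rule mult_nonneg_nonneg[rotated])
      qed
    qed auto
    moreover have i1: "integrable M (\<lambda>x. W x * v x)" if [measurable]: "v \<in> borel_measurable M" and "\<And>x. \<bar>v x\<bar> \<le> 1" for v
      by (rule integrable_const_bound[of _ 1]) (use W0 W1 that in \<open>auto simp: abs_mult intro!: mult_le_one\<close>)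
    have "integrable M (\<lambda>x. W x * (indicator A (X x) * cos (Y x + t)))" "integrable M (\<lambda>x. W x * cos (Y x + t))"
      "integrable M (\<lambda>x. W x * indicator A (X x))" "integrable M (\<lambda>x. W x * 1)"
      by (rule i1; auto simp: indicator_def)+
    note i = this
    have lin: "(\<integral>x. 2 * f x + g x \<partial>M) = 2 * (\<integral>x. f x \<partial>M) + (\<integral>x. g x \<partial>M)"
      if "integrable M f" "integrable M g" for f g :: "'a \<Rightarrow> real"
      using that by simp
    have
      "(\<integral>x. (W x * (2 + cos (Y x + t))) * indicator A (X x) \<partial>M) =
        2 * (\<integral>x. W x * indicator A (X x) \<partial>M) + (\<integral>x. W x * indicator A (X x) * cos (Y x + t) \<partial>M)"
      "(\<integral>x. W x * (2 + cos (Y x + t)) \<partial>M) = 2 * (\<integral>x. W x \<partial>M) + (\<integral>x. W x * cos (Y x + t) \<partial>M)"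
      using lin[OF i(3) i(1)] lin[OF i(4) i(2)] by (simp_all add: algebra_simps)
    ultimately show ?thesis by (simp add: algebra_simps)
  qed
  have intA: "integrable M (\<lambda>x. (W x * indicator A (X x)) *\<^sub>R cis (Y x))"
    using int[of "\<lambda>x. indicator A (X x)" 1 0] by (simp add: indicator_def)
  have intW: "integrable M (\<lambda>x. W x *\<^sub>R cis (Y x))"
    using int1[of 1 0] by simp
  have sin: "cos (y + - (pi/2)) = sin y" for y :: real
    by (simp add: cos_diff)
  show ?thesis
  proof (rule complex_eqI)
    show "Re (\<integral>x. (W x * indicator A (X x)) *\<^sub>R cis (Y x) \<partial>M) =
      Re ((\<integral>x. W x *\<^sub>R cis (Y x) \<partial>M) * complex_of_real ?p)"
      using key[of 0] intA intW by (simp flip: integral_Re)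
    show "Im (\<integral>x. (W x * indicator A (X x)) *\<^sub>R cis (Y x) \<partial>M) =
      Im ((\<integral>x. W x *\<^sub>R cis (Y x) \<partial>M) * complex_of_real ?p)"
      using key[of "- (pi/2)"] intA intW unfolding sin by (simp flip: integral_Im)
  qed
qed

text \<open>Exponentials are exchanged for indicators one variable at a time. In
  \<open>claim\<close>, \<open>J\<close> is the set of variables already exchanged;
  \<open>J = I\<close> is the product formula for probabilities.\<close>

lemma (in prob_space) indep_vars_char:
  fixes X :: "'i \<Rightarrow> 'a \<Rightarrow> real"
  assumes I: "finite I" and X: "\<And>i. i \<in> I \<Longrightarrow> X i \<in> borel_measurable M"
    and cf: "\<And>t. (\<integral>x. cis (\<Sum>i\<in>I. t i * X i x) \<partial>M) = (\<Prod>i\<in>I. char (distr M borel (X i)) (t i))"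
  shows "indep_vars (\<lambda>_. borel) X I"
proof (cases "I = {}")
  case True
  then show ?thesis by (simp add: indep_vars_def2 indep_sets_def)
next
  case False
  let ?p = "\<lambda>A i. \<integral>x. (indicator (A i) (X i x) :: real) \<partial>M"
  have char0: "char (distr M borel (X i)) 0 = 1" if "i \<in> I" for i
    using X[OF that] by (intro real_distribution.char_zero real_distribution_distr)
  have claim: "J \<subseteq> I \<Longrightarrow> (\<integral>x. (\<Prod>i\<in>J. indicator (A i) (X i x)) *\<^sub>R cis (\<Sum>i\<in>I - J. t i * X i x) \<partial>M) =
      complex_of_real (\<Prod>i\<in>J. ?p A i) * (\<Prod>i\<in>I - J. char (distr M borel (X i)) (t i))"
    if A: "\<And>i. i \<in> I \<Longrightarrow> A i \<in> sets borel" and "finite J" for A J t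
    using \<open>finite J\<close>
  proof (induction J arbitrary: t)
    case empty
    then show ?case using cf[of t] by simp
  next
    case (insert k J)
    then have kI: "k \<in> I" and JI: "J \<subseteq> I" and kJ: "k \<notin> J" and fJ: "finite J" by auto
    let ?R = "I - insert k J"
    have IJ: "I - J = insert k ?R" using kI kJ by auto
    have fR: "finite ?R" "k \<notin> ?R" using I by auto
    define W where "W x = (\<Prod>i\<in>J. indicator (A i) (X i x) :: real)" for x
    define Y where "Y x = (\<Sum>i\<in>?R. t i * X i x)" for x
    have mi: "(\<lambda>x. indicator (A i) (X i x) :: real) \<in> borel_measurable M" if "i \<in> I" for i
      using measurable_compose[OF X[OF that], of "indicator (A i)" borel] A[OF that] by simp
    have cfW: "(\<integral>x. W x *\<^sub>R cis (r * Y x + s * X k x) \<partial>M) =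
        complex_of_real (\<Prod>i\<in>J. ?p A i) * (char (distr M borel (X k)) s * (\<Prod>i\<in>?R. char (distr M borel (X i)) (r * t i)))" for r s
    proof -
      \<comment> \<open>Scaling the remaining frequencies by \<open>r\<close> and setting the k-th
        one to \<open>s\<close> yields the two-parameter factorisation demanded by the exchange
        lemma.\<close>
      let ?t = "\<lambda>i. if i = k then s else r * t i"
      have sm: "(\<Sum>i\<in>I - J. ?t i * X i x) = r * Y x + s * X k x" for x
      proof -
        have "(\<Sum>i\<in>?R. ?t i * X i x) = r * Y x"
          unfolding Y_def sum_distrib_left by (rule sum.cong) auto
        then show ?thesis unfolding IJ using fR by simp
      qed
      have pr: "(\<Prod>i\<in>I - J. char (distr M borel (X i)) (?t i)) =
          char (distr M borel (X k)) s * (\<Prod>i\<in>?R. char (distr M borel (X i)) (r * t i))"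
      proof -
        have "(\<Prod>i\<in>?R. char (distr M borel (X i)) (?t i)) = (\<Prod>i\<in>?R. char (distr M borel (X i)) (r * t i))"
          by (rule prod.cong) auto
        then show ?thesis unfolding IJ using fR by simp
      qed
      show ?thesis
        using insert.IH[OF JI, of ?t] unfolding sm pr W_def .
    qed
    have "(\<integral>x. (W x * indicator (A k) (X k x)) *\<^sub>R cis (Y x) \<partial>M) =
      (\<integral>x. W x *\<^sub>R cis (Y x) \<partial>M) * complex_of_real (?p A k)"
    proof (rule weighted_char_cis_indicator)
      show "X k \<in> borel_measurable M" by (rule X[OF kI])
      show "Y \<in> borel_measurable M"
        unfolding Y_def[abs_def] using X by (intro borel_measurable_sum borel_measurable_times) auto
      show "W \<in> borel_measurable M"
        unfolding W_def[abs_def] using mi JI by (intro borel_measurable_prod) auto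
      show "0 \<le> W x" "W x \<le> 1" for x
        unfolding W_def by (auto intro!: prod_nonneg prod_le_1 simp: indicator_def)
      show "A k \<in> sets borel" by (rule A[OF kI])
      show "(\<integral>x. W x *\<^sub>R cis (r * Y x + s * X k x) \<partial>M) =
        (\<integral>x. W x *\<^sub>R cis (r * Y x) \<partial>M) * char (distr M borel (X k)) s" for r s
        using cfW[of r s] cfW[of r 0] char0[OF kI] by (simp add: mult_ac)
    qed
    also have "(\<integral>x. W x *\<^sub>R cis (Y x) \<partial>M) =
        complex_of_real (\<Prod>i\<in>J. ?p A i) * (\<Prod>i\<in>?R. char (distr M borel (X i)) (t i))"
      using cfW[of 1 0] char0[OF kI] by simp
    finally have "(\<integral>x. (W x * indicator (A k) (X k x)) *\<^sub>R cis (Y x) \<partial>M) =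
        complex_of_real (\<Prod>i\<in>insert k J. ?p A i) * (\<Prod>i\<in>?R. char (distr M borel (X i)) (t i))"
      using fJ kJ by (simp add: mult_ac)
    moreover have "(\<Prod>i\<in>insert k J. indicator (A i) (X i x)) = W x * indicator (A k) (X k x)" for x
      unfolding W_def by (subst prod.insert[OF fJ kJ]) (rule mult.commute)
    ultimately show ?case
      by (simp only: Y_def)
  qed
  show ?thesis
  proof (subst indep_vars_finite[where E = "\<lambda>_. sets borel"])
    show "\<forall>A\<in>I \<rightarrow> sets borel. prob (\<Inter>j\<in>I. X j -` A j \<inter> space M) = (\<Prod>j\<in>I. prob (X j -` A j \<inter> space M))"
    proof
      fix A :: "'i \<Rightarrow> real set" assume A: "A \<in> I \<rightarrow> sets borel"
      have ms: "X j -` A j \<inter> space M \<in> sets M" if "j \<in> I" for j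
        using measurable_sets[OF X[OF that]] A that by auto
      have p: "?p A j = prob (X j -` A j \<inter> space M)" if "j \<in> I" for j
      proof -
        have "?p A j = (\<integral>x. indicator (X j -` A j \<inter> space M) x \<partial>M)"
          by (rule Bochner_Integration.integral_cong) (auto simp: indicator_def)
        then show ?thesis using ms[OF that] by simp
      qed
      have "complex_of_real (prob (\<Inter>j\<in>I. X j -` A j \<inter> space M)) = (\<integral>x. complex_of_real (indicator (\<Inter>j\<in>I. X j -` A j \<inter> space M) x) \<partial>M)"
        using ms I False by (subst integral_complex_of_real) (simp add: sets.finite_INT)
      also have "\<dots> = (\<integral>x. (\<Prod>i\<in>I. indicator (A i) (X i x)) *\<^sub>R cis (\<Sum>i\<in>I - I. 0 * X i x) \<partial>M)"
      proof (rule Bochner_Integration.integral_cong)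
        fix x assume x: "x \<in> space M"
        have "indicator (\<Inter>j\<in>I. X j -` A j \<inter> space M) x = (\<Prod>i\<in>I. indicator (A i) (X i x) :: real)"
        proof (cases "\<forall>i\<in>I. X i x \<in> A i")
          case True
          then have "(\<Prod>i\<in>I. indicator (A i) (X i x) :: real) = 1" by (intro prod.neutral) auto
          then show ?thesis using True x by (auto simp: indicator_def)
        next
          case F: False
          then have "(\<Prod>i\<in>I. indicator (A i) (X i x) :: real) = 0" using I by (auto simp: indicator_def)
          then show ?thesis using F by (auto simp: indicator_def)
        qed
        then show "complex_of_real (indicator (\<Inter>j\<in>I. X j -` A j \<inter> space M) x) =
            (\<Prod>i\<in>I. indicator (A i) (X i x)) *\<^sub>R cis (\<Sum>i\<in>I - I. 0 * X i x)"
          by (simp add: scaleR_conv_of_real)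
      qed simp
      also have "\<dots> = complex_of_real (\<Prod>i\<in>I. ?p A i)"
        using claim[of A I "\<lambda>_. 0"] A I by auto
      finally have "prob (\<Inter>j\<in>I. X j -` A j \<inter> space M) = (\<Prod>i\<in>I. ?p A i)"
        by (simp only: of_real_eq_iff)
      also have "\<dots> = (\<Prod>j\<in>I. prob (X j -` A j \<inter> space M))"
        by (rule prod.cong[OF refl]) (rule p)
      finally show "prob (\<Inter>j\<in>I. X j -` A j \<inter> space M) = (\<Prod>j\<in>I. prob (X j -` A j \<inter> space M))" .
    qed
  qed (use I False X in \<open>auto simp: Int_stable_def sets.sigma_sets_eq[of borel, simplified]\<close>)
qed

section \<open>Gaussian measures\<close>

text \<open>The characteristic function sees only the quadratic form of \<open>C\<close>, so
  self-adjointness has to be assumed alongside it.\<close>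

locale gaussian =
  fixes \<mu> :: "'a::{real_inner,polish_space} measure" and m :: 'a and C :: "'a \<Rightarrow>\<^sub>L 'a"
  assumes gaussian_measure: "gaussian_measure \<mu> m C" and positive_cov: "positive_op C"
begin

sublocale prob_space \<mu>
  using gaussian_measure by (simp add: gaussian_measure_def)

lemma sets_eq [measurable_cong, simp]: "sets \<mu> = sets borel"
  using gaussian_measure by (simp add: gaussian_measure_def)

lemma space_eq [simp]: "space \<mu> = UNIV"
  using sets_eq_imp_space_eq[OF sets_eq] by simp

lemma continuous_measurable:
  "continuous_on UNIV f \<Longrightarrow> f \<in> borel_measurable \<mu>" for f :: "'a \<Rightarrow> 'b::topological_space"
  using borel_measurable_continuous_onI[of f] measurable_cong_sets[OF sets_eq refl] by blast

lemma inner_measurable [measurable]: "(\<lambda>x. inner (x - m) h) \<in> borel_measurable \<mu>"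
  by (intro continuous_measurable continuous_intros)

lemma cov_commute: "inner (C x) y = inner (C y) x"
  using positive_cov by (simp add: positive_op_def selfadj_op_def inner_commute)

lemma cov_nonneg: "0 \<le> inner (C x) x"
  using positive_cov by (simp add: positive_op_def)

lemma char_centered: "(\<integral>x. cis (inner (x - m) h) \<partial>\<mu>) = complex_of_real (exp (- inner (C h) h / 2))"
proof -
  have "(\<integral>x. cis (inner (x - m) h) \<partial>\<mu>) = (\<integral>x. cis (- inner m h) * cis (inner x h) \<partial>\<mu>)"
    by (simp add: cis_mult inner_diff_left)
  also have "\<dots> = cis (- inner m h) * (cis (inner m h) * complex_of_real (exp (- inner (C h) h / 2)))"
    using gaussian_measure by (subst integral_mult_right_zero) (simp add: gaussian_measure_def)
  also have "\<dots> = complex_of_real (exp (- inner (C h) h / 2))"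
    by (simp only: mult.assoc[symmetric] cis_mult) simp
  finally show ?thesis .
qed

lemma char_functional:
  "char (distr \<mu> borel (\<lambda>x. inner (x - m) h)) t = complex_of_real (exp (- t\<^sup>2 * inner (C h) h / 2))"
proof -
  have "char (distr \<mu> borel (\<lambda>x. inner (x - m) h)) t = (\<integral>x. iexp (t * inner (x - m) h) \<partial>\<mu>)"
    unfolding char_def by (rule integral_distr) auto
  also have "\<dots> = (\<integral>x. cis (inner (x - m) (t *\<^sub>R h)) \<partial>\<mu>)"
    by (simp add: cis_conv_exp)
  also have "\<dots> = complex_of_real (exp (- inner (C (t *\<^sub>R h)) (t *\<^sub>R h) / 2))"
    by (rule char_centered)
  finally show ?thesis
    by (simp add: blinfun.scaleR_right power2_eq_square mult.assoc)
qed

text \<open>Orthogonality for the form of \<open>C\<close> makes the exponent of the joint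
  characteristic function diagonal, so it factors.\<close>

lemma orthogonal_indep:
  assumes I: "finite I" and orth: "\<And>i j. i \<in> I \<Longrightarrow> j \<in> I \<Longrightarrow> i \<noteq> j \<Longrightarrow> inner (C (h i)) (h j) = 0"
  shows "indep_vars (\<lambda>_. borel) (\<lambda>i x. inner (x - m) (h i)) I"
proof (rule indep_vars_char[OF I inner_measurable])
  fix t :: "'b \<Rightarrow> real"
  let ?h = "\<Sum>i\<in>I. t i *\<^sub>R h i"
  have "inner (C ?h) ?h = (\<Sum>i\<in>I. \<Sum>j\<in>I. t i * t j * inner (C (h j)) (h i))"
    by (simp add: blinfun.sum_right blinfun.scaleR_right inner_sum_left inner_sum_right sum_distrib_left mult.assoc)
  also have "\<dots> = (\<Sum>i\<in>I. \<Sum>j\<in>I. if i = j then (t i)\<^sup>2 * inner (C (h i)) (h i) else 0)"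
    using orth by (intro sum.cong refl) (auto simp: power2_eq_square)
  also have "\<dots> = (\<Sum>i\<in>I. (t i)\<^sup>2 * inner (C (h i)) (h i))"
    using I by (intro sum.cong refl) simp
  finally have q: "inner (C ?h) ?h = (\<Sum>i\<in>I. (t i)\<^sup>2 * inner (C (h i)) (h i))" .
  have "(\<integral>x. cis (\<Sum>i\<in>I. t i * inner (x - m) (h i)) \<partial>\<mu>) = (\<integral>x. cis (inner (x - m) ?h) \<partial>\<mu>)"
    by (simp add: inner_sum_right)
  also have "\<dots> = complex_of_real (exp (\<Sum>i\<in>I. - (t i)\<^sup>2 * inner (C (h i)) (h i) / 2))"
    unfolding char_centered q by (simp add: sum_negf sum_divide_distrib)
  also have "\<dots> = (\<Prod>i\<in>I. char (distr \<mu> borel (\<lambda>x. inner (x - m) (h i))) (t i))"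
    unfolding char_functional exp_sum[OF I] by simp
  finally show "(\<integral>x. cis (\<Sum>i\<in>I. t i * inner (x - m) (h i)) \<partial>\<mu>) =
      (\<Prod>i\<in>I. char (distr \<mu> borel (\<lambda>x. inner (x - m) (h i))) (t i))" .
qed

lemma distr_std_normal:
  assumes "inner (C h) h = 1"
  shows "distr \<mu> borel (\<lambda>x. inner (x - m) h) = std_normal_distribution"
proof (rule Levy_uniqueness)
  show "char (distr \<mu> borel (\<lambda>x. inner (x - m) h)) = char std_normal_distribution"
    using assms by (simp add: fun_eq_iff char_functional char_std_normal_distribution)
qed (auto intro: real_dist_normal_dist)

lemma nn_integral_std_normal:
  assumes "inner (C h) h = 1" and [measurable]: "f \<in> borel_measurable borel"
  shows "(\<integral>\<^sup>+x. f (inner (x - m) h) \<partial>\<mu>) = (\<integral>\<^sup>+y. f y \<partial>std_normal_distribution)"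
  unfolding distr_std_normal[OF assms(1), symmetric] by (rule nn_integral_distr[symmetric]) auto

lemma integral_std_normal:
  fixes f :: "real \<Rightarrow> real"
  assumes "inner (C h) h = 1" and [measurable]: "f \<in> borel_measurable borel"
  shows "(\<integral>x. f (inner (x - m) h) \<partial>\<mu>) = (\<integral>y. f y \<partial>std_normal_distribution)"
    and "integrable \<mu> (\<lambda>x. f (inner (x - m) h)) \<longleftrightarrow> integrable std_normal_distribution f"
  unfolding distr_std_normal[OF assms(1), symmetric]
  by (rule integral_distr[symmetric] integrable_distr_eq[symmetric]; auto)+

text \<open>With variance 0 the characteristic function is constantly 1, that of the point mass at
  0.\<close>

lemma degenerate_functional:
  assumes "inner (C h) h = 0"
  shows "AE x in \<mu>. inner (x - m) h = 0"
proof -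
  let ?D = "distr \<mu> borel (\<lambda>x. inner (x - m) h)"
  interpret R: prob_space "return borel (0::real)"
    by (rule prob_space_return) simp
  have "char ?D = char (return borel 0)"
    using assms by (simp add: fun_eq_iff char_functional) (simp add: char_def integral_return)
  then have "?D = return borel 0"
    by (intro Levy_uniqueness) (auto simp: real_distribution_def real_distribution_axioms_def R.prob_space_axioms intro!: prob_space_distr)
  moreover have "AE y in return borel (0::real). y = 0" by (simp add: AE_return)
  ultimately have "AE y in ?D. y = 0" by (simp only:)
  then show ?thesis by (subst (asm) AE_distr_iff) auto
qed

lemma functional_moments:
  shows functional_integrable: "integrable \<mu> (\<lambda>x. inner (x - m) h)"
    and functional_mean: "(\<integral>x. inner (x - m) h \<partial>\<mu>) = 0"
    and functional_square_integrable: "integrable \<mu> (\<lambda>x. (inner (x - m) h)\<^sup>2)"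
    and functional_variance: "(\<integral>x. (inner (x - m) h)\<^sup>2 \<partial>\<mu>) = inner (C h) h"
proof -
  let ?s = "inner (C h) h"
  have "integrable \<mu> (\<lambda>x. inner (x - m) h) \<and> (\<integral>x. inner (x - m) h \<partial>\<mu>) = 0 \<and>
    integrable \<mu> (\<lambda>x. (inner (x - m) h)\<^sup>2) \<and> (\<integral>x. (inner (x - m) h)\<^sup>2 \<partial>\<mu>) = ?s"
  proof (cases "?s = 0")
    case True
    note ae = degenerate_functional[OF True]
    have "integrable \<mu> (\<lambda>x. inner (x - m) h) \<longleftrightarrow> integrable \<mu> (\<lambda>x. 0::real)"
      "integrable \<mu> (\<lambda>x. (inner (x - m) h)\<^sup>2) \<longleftrightarrow> integrable \<mu> (\<lambda>x. 0::real)"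
      by (intro integrable_cong_AE; use ae in auto)+
    moreover have "(\<integral>x. inner (x - m) h \<partial>\<mu>) = (\<integral>x. 0 \<partial>\<mu>)"
      "(\<integral>x. (inner (x - m) h)\<^sup>2 \<partial>\<mu>) = (\<integral>x. 0 \<partial>\<mu>)"
      by (intro integral_cong_AE; use ae in auto)+
    ultimately show ?thesis using True by simp
  next
    case False
    then have pos: "0 < ?s" using cov_nonneg[of h] by simp
    define k where "k = h /\<^sub>R sqrt ?s"
    have k: "inner (C k) k = 1"
      using pos by (simp add: k_def blinfun.scaleR_right field_simps)
    have hk: "inner (x - m) h = sqrt ?s * inner (x - m) k" for x
      using pos by (simp add: k_def)
    have i1: "integrable \<mu> (\<lambda>x. inner (x - m) k)" "(\<integral>x. inner (x - m) k \<partial>\<mu>) = 0"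
      using integral_std_normal[OF k, of "\<lambda>y. y"] integrable_std_normal_distribution_moment[of 1]
        integral_std_normal_distribution_moment_odd[of 1] by simp_all
    have i2: "integrable \<mu> (\<lambda>x. (inner (x - m) k)\<^sup>2)" "(\<integral>x. (inner (x - m) k)\<^sup>2 \<partial>\<mu>) = 1"
      using integral_std_normal[OF k, of "\<lambda>y. y\<^sup>2"] std_normal_distribution_even_moments[of 1]
      by (simp_all add: fact_numeral)
    show ?thesis
      unfolding hk using i1 i2 pos by (simp add: power_mult_distrib)
  qed
  then show "integrable \<mu> (\<lambda>x. inner (x - m) h)" "(\<integral>x. inner (x - m) h \<partial>\<mu>) = 0"
    "integrable \<mu> (\<lambda>x. (inner (x - m) h)\<^sup>2)" "(\<integral>x. (inner (x - m) h)\<^sup>2 \<partial>\<mu>) = ?s" by auto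
qed

text \<open>Parseval for \<open>L (x - m)\<close> and monotone convergence. The identity as
  \<open>L\<close> gives the second moment of the measure, the root of \<open>C1\<close> the mean of
  \<open>inner (C1 (x - m0)) (x - m0)\<close>.\<close>

lemma norm_square_moment:
  assumes B: "onb B" and L: "selfadj_op L" and s: "((\<lambda>b. inner (C (L b)) (L b)) has_sum s) B"
  shows "has_bochner_integral \<mu> (\<lambda>x. (norm (L (x - m)))\<^sup>2) s"
proof -
  obtain F where F: "\<And>n. finite (F n)" "\<And>n. F n \<subseteq> B" "incseq F"
    "filterlim F (finite_subsets_at_top B) sequentially"
    using countable_exhaustion[OF orthonormal_countable[OF onb_orthonormal[OF B]]] by blast
  let ?f = "\<lambda>n x. \<Sum>b\<in>F n. (inner (x - m) (L b))\<^sup>2"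
  have adj: "inner (L x) b = inner x (L b)" for x b
    using L by (simp add: selfadj_op_def)
  show ?thesis
  proof (rule has_bochner_integral_monotone_convergence)
    show "integrable \<mu> (?f n)" for n
      by (intro Bochner_Integration.integrable_sum functional_square_integrable)
    show "AE x in \<mu>. mono (\<lambda>n. ?f n x)"
      using F(1,3) by (intro AE_I2 monoI sum_mono2) (auto simp: incseq_def)
    show "AE x in \<mu>. (\<lambda>n. ?f n x) \<longlonglongrightarrow> (norm (L (x - m)))\<^sup>2"
    proof (rule AE_I2)
      fix x
      show "(\<lambda>n. ?f n x) \<longlonglongrightarrow> (norm (L (x - m)))\<^sup>2"
        using filterlim_compose[OF parseval[OF B, of "L (x - m)", unfolded has_sum_def] F(4)]
        by (simp add: adj)
    qed
    have "integral\<^sup>L \<mu> (?f n) = (\<Sum>b\<in>F n. inner (C (L b)) (L b))" for n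
      by (simp add: functional_square_integrable functional_variance)
    then show "(\<lambda>n. integral\<^sup>L \<mu> (?f n)) \<longlonglongrightarrow> s"
      using filterlim_compose[OF s[unfolded has_sum_def] F(4)] by simp
    show "(\<lambda>x. (norm (L (x - m)))\<^sup>2) \<in> borel_measurable \<mu>"
      by (intro continuous_measurable continuous_intros)
  qed
qed

lemma nn_integral_prod_orthonormal:
  assumes F: "finite F" and orth: "\<And>i j. i \<in> F \<Longrightarrow> j \<in> F \<Longrightarrow> inner (C (h i)) (h j) = (if i = j then 1 else 0)"
    and f [measurable]: "\<And>i. i \<in> F \<Longrightarrow> f i \<in> borel_measurable borel" and f0: "\<And>i y. i \<in> F \<Longrightarrow> 0 \<le> f i y"
  shows "(\<integral>\<^sup>+x. ennreal (\<Prod>i\<in>F. f i (inner (x - m) (h i))) \<partial>\<mu>) =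
    (\<Prod>i\<in>F. \<integral>\<^sup>+y. ennreal (f i y) \<partial>std_normal_distribution)"
proof -
  have "indep_vars (\<lambda>_. borel) (\<lambda>i x. inner (x - m) (h i)) F"
    using F orth by (intro orthogonal_indep) auto
  then have ind: "indep_vars (\<lambda>_. borel) (\<lambda>i x. ennreal (f i (inner (x - m) (h i)))) F"
    by (rule indep_vars_compose2[where Y = "\<lambda>i y. ennreal (f i y)"]) auto
  have "(\<integral>\<^sup>+x. ennreal (\<Prod>i\<in>F. f i (inner (x - m) (h i))) \<partial>\<mu>) =
      (\<integral>\<^sup>+x. (\<Prod>i\<in>F. ennreal (f i (inner (x - m) (h i)))) \<partial>\<mu>)"
    using f0 by (simp add: prod_ennreal)
  also have "\<dots> = (\<Prod>i\<in>F. \<integral>\<^sup>+x. ennreal (f i (inner (x - m) (h i))) \<partial>\<mu>)"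
    by (rule indep_vars_nn_integral[OF F ind]) simp
  also have "\<dots> = (\<Prod>i\<in>F. \<integral>\<^sup>+y. ennreal (f i y) \<partial>std_normal_distribution)"
    using orth by (intro prod.cong refl nn_integral_std_normal) auto
  finally show ?thesis .
qed

lemma integral_functional_times_orthogonal:
  assumes F: "finite F" and orth: "\<And>i j. i \<in> F \<Longrightarrow> j \<in> F \<Longrightarrow> inner (C (h i)) (h j) = (if i = j then 1 else 0)"
    and g: "\<And>i. i \<in> F \<Longrightarrow> inner (C g) (h i) = 0"
    and f: "\<And>i. i \<in> F \<Longrightarrow> f i \<in> borel_measurable borel" "\<And>i. i \<in> F \<Longrightarrow> integrable std_normal_distribution (f i)"
  shows "has_bochner_integral \<mu> (\<lambda>x. inner (x - m) g * (\<Prod>i\<in>F. f i (inner (x - m) (h i)))) 0"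
proof -
  \<comment> \<open>The index \<open>None\<close> adjoins \<open>g\<close> to the family, so that
    one independence statement covers all factors; the factor of \<open>g\<close> has mean
    0.\<close>
  let ?I = "insert None (Some ` F)"
  define H where "H j = (case j of None \<Rightarrow> g | Some i \<Rightarrow> h i)" for j
  define \<phi> where "\<phi> j y = (case j of None \<Rightarrow> y | Some i \<Rightarrow> f i y)" for j and y :: real
  have fin: "finite ?I" using F by simp
  have "indep_vars (\<lambda>_. borel) (\<lambda>j x. inner (x - m) (H j)) ?I"
    using orth g cov_commute by (intro orthogonal_indep fin) (auto simp: H_def split: if_splits)
  then have ind: "indep_vars (\<lambda>_. borel) (\<lambda>j x. \<phi> j (inner (x - m) (H j))) ?I"
    by (rule indep_vars_compose2[where Y = \<phi>]) (use f in \<open>auto simp: \<phi>_def[abs_def]\<close>)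
  have int: "integrable \<mu> (\<lambda>x. \<phi> j (inner (x - m) (H j)))" if "j \<in> ?I" for j
    using that f orth integral_std_normal(2) by (auto simp: \<phi>_def H_def functional_integrable)
  have P: "(\<Prod>j\<in>?I. \<phi> j (inner (x - m) (H j))) = inner (x - m) g * (\<Prod>i\<in>F. f i (inner (x - m) (h i)))" for x
    using F by (simp add: prod.reindex \<phi>_def H_def)
  have "integral\<^sup>L \<mu> (\<lambda>x. \<Prod>j\<in>?I. \<phi> j (inner (x - m) (H j))) = (\<Prod>j\<in>?I. \<integral>x. \<phi> j (inner (x - m) (H j)) \<partial>\<mu>)"
    by (rule indep_vars_lebesgue_integral[OF fin ind int])
  also have "\<dots> = 0"
    using F by (simp add: \<phi>_def H_def functional_mean)
  finally show ?thesis
    using indep_vars_integrable[OF fin ind int] unfolding P by (simp add: has_bochner_integral_iff)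
qed

text \<open>\<open>g\<close> splits into its projection onto the \<open>h i\<close> for the form of
  \<open>C\<close> and an uncorrelated, hence independent, remainder that contributes 0. In the
  projection \<open>h k\<close> meets only the k-th factor, with first moment \<open>r k\<close>;
  the other factors integrate to 1.\<close>

lemma integral_functional_times_prod:
  assumes F: "finite F" and orth: "\<And>i j. i \<in> F \<Longrightarrow> j \<in> F \<Longrightarrow> inner (C (h i)) (h j) = (if i = j then 1 else 0)"
    and f: "\<And>i. i \<in> F \<Longrightarrow> f i \<in> borel_measurable borel" "\<And>i. i \<in> F \<Longrightarrow> has_bochner_integral std_normal_distribution (f i) 1"
      "\<And>i. i \<in> F \<Longrightarrow> has_bochner_integral std_normal_distribution (\<lambda>y. y * f i y) (r i)"
  shows "has_bochner_integral \<mu> (\<lambda>x. inner (x - m) g * (\<Prod>i\<in>F. f i (inner (x - m) (h i))))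
    (\<Sum>i\<in>F. inner (C g) (h i) * r i)"
proof -
  have single: "has_bochner_integral \<mu> (\<lambda>x. inner (x - m) (h k) * (\<Prod>i\<in>F. f i (inner (x - m) (h i)))) (r k)"
    if k: "k \<in> F" for k
  proof -
    define \<phi> where "\<phi> i y = (if i = k then y * f i y else f i y)" for i y
    have "indep_vars (\<lambda>_. borel) (\<lambda>i x. inner (x - m) (h i)) F"
      using F orth by (intro orthogonal_indep) auto
    then have ind: "indep_vars (\<lambda>_. borel) (\<lambda>i x. \<phi> i (inner (x - m) (h i))) F"
      by (rule indep_vars_compose2[where Y = \<phi>]) (use f in \<open>auto simp: \<phi>_def[abs_def]\<close>)
    have hbi: "has_bochner_integral \<mu> (\<lambda>x. \<phi> i (inner (x - m) (h i))) (if i = k then r k else 1)" if i: "i \<in> F" for i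
    proof -
      have h1: "inner (C (h i)) (h i) = 1" using orth i by simp
      have ms: "\<phi> i \<in> borel_measurable borel" using f(1)[OF i] by (cases "i = k") (auto simp: \<phi>_def[abs_def])
      have "has_bochner_integral std_normal_distribution (\<phi> i) (if i = k then r k else 1)"
        using f(2,3)[OF i] by (cases "i = k") (auto simp: \<phi>_def[abs_def])
      then show ?thesis
        using integral_std_normal[OF h1 ms] by (simp add: has_bochner_integral_iff)
    qed
    have int: "integrable \<mu> (\<lambda>x. \<phi> i (inner (x - m) (h i)))" if "i \<in> F" for i
      using hbi[OF that] by (simp add: has_bochner_integral_iff)
    have P: "(\<Prod>i\<in>F. \<phi> i (inner (x - m) (h i))) = inner (x - m) (h k) * (\<Prod>i\<in>F. f i (inner (x - m) (h i)))" for x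
    proof -
      have "(\<Prod>i\<in>F - {k}. \<phi> i (inner (x - m) (h i))) = (\<Prod>i\<in>F - {k}. f i (inner (x - m) (h i)))"
        by (rule prod.cong) (auto simp: \<phi>_def)
      then show ?thesis
        unfolding prod.remove[OF F k] by (simp add: \<phi>_def mult.assoc)
    qed
    have "integral\<^sup>L \<mu> (\<lambda>x. \<Prod>i\<in>F. \<phi> i (inner (x - m) (h i))) = (\<Prod>i\<in>F. \<integral>x. \<phi> i (inner (x - m) (h i)) \<partial>\<mu>)"
      by (rule indep_vars_lebesgue_integral[OF F ind int])
    also have "\<dots> = (\<Prod>i\<in>F. if i = k then r k else 1)"
      using hbi by (intro prod.cong refl) (simp add: has_bochner_integral_iff)
    also have "\<dots> = r k"
      using F k by simp
    finally show ?thesis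
      using indep_vars_integrable[OF F ind int] unfolding P by (simp add: has_bochner_integral_iff)
  qed
  define g' where "g' = g - (\<Sum>i\<in>F. inner (C g) (h i) *\<^sub>R h i)"
  have orth': "inner (C g') (h j) = 0" if j: "j \<in> F" for j
  proof -
    have "(\<Sum>i\<in>F. inner (C g) (h i) * inner (C (h i)) (h j)) = (\<Sum>i\<in>F. if i = j then inner (C g) (h i) else 0)"
      using orth j by (intro sum.cong) auto
    also have "\<dots> = inner (C g) (h j)" using F j by simp
    finally show ?thesis
      by (simp add: g'_def blinfun.diff_right blinfun.sum_right blinfun.scaleR_right inner_diff_left inner_sum_left)
  qed
  have rest: "has_bochner_integral \<mu> (\<lambda>x. inner (x - m) g' * (\<Prod>i\<in>F. f i (inner (x - m) (h i)))) 0"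
  proof (rule integral_functional_times_orthogonal[OF F orth orth' f(1)])
    show "integrable std_normal_distribution (f i)" if "i \<in> F" for i
      using f(2)[OF that] by (simp add: has_bochner_integral_iff)
  qed
  have "has_bochner_integral \<mu> (\<lambda>x. inner (x - m) g' * (\<Prod>i\<in>F. f i (inner (x - m) (h i))) +
      (\<Sum>k\<in>F. inner (C g) (h k) * (inner (x - m) (h k) * (\<Prod>i\<in>F. f i (inner (x - m) (h i))))))
      (0 + (\<Sum>k\<in>F. inner (C g) (h k) * r k))"
    by (intro has_bochner_integral_add rest has_bochner_integral_sum has_bochner_integral_mult_right single)
  moreover have "inner (x - m) g' * Q + (\<Sum>k\<in>F. inner (C g) (h k) * (inner (x - m) (h k) * Q)) = inner (x - m) g * Q" for x and Q :: real
  proof -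
    have "inner (x - m) g' = inner (x - m) g - (\<Sum>k\<in>F. inner (C g) (h k) * inner (x - m) (h k))"
      unfolding g'_def by (simp only: inner_diff_right[of "x - m"] inner_sum_right inner_scaleR_right)
    moreover have "(\<Sum>k\<in>F. inner (C g) (h k) * (inner (x - m) (h k) * Q)) =
        (\<Sum>k\<in>F. inner (C g) (h k) * inner (x - m) (h k)) * Q"
      by (simp only: sum_distrib_right mult.assoc)
    ultimately show ?thesis by (simp only: left_diff_distrib)
  qed
  ultimately show ?thesis by simp
qed

end

section \<open>One-dimensional Gaussian kernels\<close>

text \<open>When \<open>b^2 = m (m + 2) / 4\<close>, this is the density of a bivariate normal law
  with standard marginals and correlation \<open>b / (1 + m / 2)\<close> with respect to the product
  of its marginals.\<close>

definition gauss_kernel :: "real \<Rightarrow> real \<Rightarrow> real \<Rightarrow> real \<Rightarrow> real" where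
  "gauss_kernel m b x y = sqrt (1 + m / 2) * exp (b * x * y - m / 4 * (x\<^sup>2 + y\<^sup>2))"

lemma gauss_kernel_commute: "gauss_kernel m b x y = gauss_kernel m b y x"
  by (simp add: gauss_kernel_def algebra_simps)

lemma gauss_kernel_pos: "0 \<le> m \<Longrightarrow> 0 < gauss_kernel m b x y"
  by (simp add: gauss_kernel_def)

lemma gauss_kernel_measurable_compose:
  assumes [measurable]: "f \<in> borel_measurable M" "g \<in> borel_measurable M"
  shows "(\<lambda>p. gauss_kernel m b (f p) (g p)) \<in> borel_measurable M"
  unfolding gauss_kernel_def[abs_def] by measurable

lemma gauss_kernel_measurable [measurable]: "gauss_kernel m b x \<in> borel_measurable borel"
  by (rule gauss_kernel_measurable_compose[of "\<lambda>_. x" borel "\<lambda>y. y"]) simp_all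

text \<open>Complete the square in \<open>y\<close>; the relation between \<open>b\<close> and
  \<open>m\<close> is exactly what absorbs the remaining term in \<open>x^2\<close>. The right side
  is the conditional density of \<open>y\<close> given \<open>x\<close>.\<close>

lemma gauss_kernel_normal_density:
  assumes m: "0 \<le> m" and b: "b\<^sup>2 = m * (m + 2) / 4"
  shows "std_normal_density y * gauss_kernel m b x y = normal_density (b / (1 + m / 2) * x) (1 / sqrt (1 + m / 2)) y"
proof -
  define p where "p = 1 + m / 2"
  have p: "0 < p" using m by (simp add: p_def)
  have bp: "b\<^sup>2 / p = m / 2"
    using p unfolding b by (simp add: p_def field_simps)
  have "- ((y - b / p * x)\<^sup>2) / (2 * (1 / sqrt p)\<^sup>2) = - p * y\<^sup>2 / 2 + b * x * y - (b\<^sup>2 / p) * x\<^sup>2 / 2"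
    using p by (simp add: power2_eq_square field_simps)
  also have "\<dots> = - y\<^sup>2 / 2 + (b * x * y - m / 4 * (x\<^sup>2 + y\<^sup>2))"
    unfolding bp by (simp add: p_def field_simps)
  finally have e: "- ((y - b / p * x)\<^sup>2) / (2 * (1 / sqrt p)\<^sup>2) = - y\<^sup>2 / 2 + (b * x * y - m / 4 * (x\<^sup>2 + y\<^sup>2))" .
  have "sqrt (2 * pi * (1 / sqrt p)\<^sup>2) = sqrt (2 * pi) / sqrt p"
    using p by (simp add: power_divide real_sqrt_divide real_sqrt_mult)
  then show ?thesis
    unfolding p_def[symmetric] normal_density_def e gauss_kernel_def exp_add
    using p by (simp add: p_def)
qed

lemma gauss_kernel_integrals:
  assumes m: "0 \<le> m" and b: "b\<^sup>2 = m * (m + 2) / 4"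
  shows gauss_kernel_mass: "has_bochner_integral std_normal_distribution (gauss_kernel m b x) 1"
    and gauss_kernel_nn_mass: "(\<integral>\<^sup>+y. ennreal (gauss_kernel m b x y) \<partial>std_normal_distribution) = 1"
    and gauss_kernel_mean:
      "has_bochner_integral std_normal_distribution (\<lambda>y. y * gauss_kernel m b x y) (b / (1 + m / 2) * x)"
proof -
  let ?a = "b / (1 + m / 2) * x" and ?s = "1 / sqrt (1 + m / 2)"
  have s: "0 < ?s" using m by simp
  note nd = gauss_kernel_normal_density[OF m b]
  show 1: "has_bochner_integral std_normal_distribution (gauss_kernel m b x) 1"
  proof (rule has_bochner_integral_density)
    show "has_bochner_integral lborel (\<lambda>y. std_normal_density y *\<^sub>R gauss_kernel m b x y) 1"
      using s by (simp add: nd has_bochner_integral_iff)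
  qed auto
  show "has_bochner_integral std_normal_distribution (\<lambda>y. y * gauss_kernel m b x y) ?a"
  proof (rule has_bochner_integral_density)
    have eq: "std_normal_density y *\<^sub>R (y * gauss_kernel m b x y) = normal_density ?a ?s y * y" for y
      using nd[of y x] by (metis mult.assoc mult.commute real_scaleR_def)
    show "has_bochner_integral lborel (\<lambda>y. std_normal_density y *\<^sub>R (y * gauss_kernel m b x y)) ?a"
      unfolding eq by (rule normal_moment_nz_1[OF s])
  qed auto
  show "(\<integral>\<^sup>+y. ennreal (gauss_kernel m b x y) \<partial>std_normal_distribution) = 1"
    using 1 gauss_kernel_pos[OF m] by (subst nn_integral_eq_integral) (auto simp: has_bochner_integral_iff less_imp_le)
qed

section \<open>The variational bound and the entropic optimal transport problem\<close>

text \<open>Integrate \<open>t \<le> exp t - 1\<close> at \<open>t = \<phi> - ln f\<close> against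
  \<pi>, where \<open>f\<close> is the density of \<pi>. The normalisation \<open>le1\<close>
  replaces the usual log-Laplace term.\<close>

lemma donsker_varadhan:
  assumes P: "prob_space P" and \<pi>: "prob_space \<pi>" "sets \<pi> = sets P" "absolutely_continuous P \<pi>"
    and ent: "integrable \<pi> (entropy_density (exp 1) P \<pi>)"
    and \<phi> [measurable]: "\<phi> \<in> borel_measurable P" and int: "integrable \<pi> \<phi>"
    and le1: "(\<integral>\<^sup>+x. ennreal (exp (\<phi> x)) \<partial>P) \<le> 1"
  shows "(\<integral>x. \<phi> x \<partial>\<pi>) \<le> KL_divergence (exp 1) P \<pi>"
proof -
  interpret P: prob_space P by (rule P)
  interpret Q: prob_space \<pi> by (rule \<pi>)
  define f where "f x = enn2real (RN_deriv P \<pi> x)" for x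
  have f [measurable]: "f \<in> borel_measurable P" unfolding f_def by measurable
  have f0: "0 \<le> f x" for x by (simp add: f_def)
  have fin: "AE x in P. RN_deriv P \<pi> x \<noteq> \<infinity>"
    by (rule P.RN_deriv_finite) (use \<pi> in \<open>auto intro: Q.sigma_finite_measure_axioms\<close>)
  have dens: "density P (\<lambda>x. ennreal (f x)) = \<pi>"
  proof -
    have "density P (\<lambda>x. ennreal (f x)) = density P (RN_deriv P \<pi>)"
      by (rule density_cong) (use fin in \<open>auto simp: f_def less_top\<close>)
    then show ?thesis using P.density_RN_deriv[OF \<pi>(3,2)] by simp
  qed
  have ed: "entropy_density (exp 1) P \<pi> x = ln (f x)" for x
    by (simp add: entropy_density_def f_def log_ln)
  have mP: "g \<in> borel_measurable \<pi> \<longleftrightarrow> g \<in> borel_measurable P" for g :: "'a \<Rightarrow> real"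
    using measurable_cong_sets[OF \<pi>(2) refl] by blast
  have posf: "AE x in \<pi>. 0 < f x"
    unfolding dens[symmetric] by (subst AE_density) auto
  let ?h = "\<lambda>x. exp (\<phi> x - ln (f x))"
  have "(\<integral>\<^sup>+x. ennreal (?h x) \<partial>\<pi>) = (\<integral>\<^sup>+x. ennreal (f x) * ennreal (?h x) \<partial>P)"
    by (subst dens[symmetric]) (rule nn_integral_density; measurable)
  \<comment> \<open>Only an inequality: the left side vanishes wherever \<open>f\<close>
    does.\<close>
  also have "\<dots> \<le> (\<integral>\<^sup>+x. ennreal (exp (\<phi> x)) \<partial>P)"
  proof (rule nn_integral_mono)
    fix x
    show "ennreal (f x) * ennreal (?h x) \<le> ennreal (exp (\<phi> x))"
      using f0[of x] by (cases "f x = 0") (auto simp: exp_diff simp flip: ennreal_mult)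
  qed
  finally have h1: "(\<integral>\<^sup>+x. ennreal (?h x) \<partial>\<pi>) \<le> 1" using le1 by simp
  have inth: "integrable \<pi> ?h"
  proof (rule integrableI_nonneg)
    show "?h \<in> borel_measurable \<pi>" unfolding mP by measurable
    show "(\<integral>\<^sup>+x. ennreal (?h x) \<partial>\<pi>) < \<infinity>" using h1 by (rule order_le_less_trans) simp
  qed simp
  have "ennreal (\<integral>x. ?h x \<partial>\<pi>) \<le> ennreal 1"
    using h1 nn_integral_eq_integral[OF inth] by simp
  then have h2: "(\<integral>x. ?h x \<partial>\<pi>) \<le> 1" by simp
  have ed': "entropy_density (exp 1) P \<pi> = (\<lambda>x. ln (f x))" by (rule ext) (rule ed)
  have intl: "integrable \<pi> (\<lambda>x. ln (f x))" using ent unfolding ed' .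
  have "(\<integral>x. \<phi> x - ln (f x) \<partial>\<pi>) \<le> (\<integral>x. ?h x - 1 \<partial>\<pi>)"
  proof (rule integral_mono)
    show "\<phi> x - ln (f x) \<le> ?h x - 1" for x
      using exp_ge_add_one_self[of "\<phi> x - ln (f x)"] by linarith
  qed (use int intl inth in auto)
  also have "\<dots> \<le> 0" using h2 inth by (simp add: Q.prob_space)
  finally show ?thesis
    using int intl by (simp add: KL_divergence_def ed')
qed

text \<open>\<open>RN_deriv\<close> is determined only almost everywhere, so its logarithm is
  exchanged for \<open>ln (D x)\<close> under the integral.\<close>

lemma KL_ext_density:
  assumes P: "prob_space P" and D [measurable]: "D \<in> borel_measurable P" and pos: "\<And>x. 0 < D x"
    and \<gamma>: "\<gamma> = density P (\<lambda>x. ennreal (D x))" and int: "integrable \<gamma> (\<lambda>x. ln (D x))"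
  shows "KL_ext \<gamma> P = ereal (\<integral>x. ln (D x) \<partial>\<gamma>)"
proof -
  interpret P: prob_space P by (rule P)
  have ac: "absolutely_continuous P \<gamma>"
    unfolding \<gamma> by (rule absolutely_continuousI_density) auto
  have "AE x in P. ennreal (D x) = RN_deriv P \<gamma> x"
    by (rule P.RN_deriv_unique) (auto simp: \<gamma>)
  then have "AE x in \<gamma>. ennreal (D x) = RN_deriv P \<gamma> x"
    unfolding \<gamma> by (subst AE_density) auto
  then have ae: "AE x in \<gamma>. entropy_density (exp 1) P \<gamma> x = ln (D x)"
  proof eventually_elim
    case (elim x)
    then have "enn2real (RN_deriv P \<gamma> x) = D x"
      using pos[of x] by (metis enn2real_ennreal less_imp_le)
    then show ?case by (simp add: entropy_density_def log_ln)
  qed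
  have me: "entropy_density (exp 1) P \<gamma> \<in> borel_measurable \<gamma>"
    using measurable_entropy_density[of "exp 1" P \<gamma>] by (subst measurable_cong_sets[of \<gamma> P]) (auto simp: \<gamma>)
  have ml: "(\<lambda>x. ln (D x)) \<in> borel_measurable \<gamma>" by (simp add: \<gamma>)
  have "integrable \<gamma> (entropy_density (exp 1) P \<gamma>)"
    using int integrable_cong_AE[OF me ml ae] by blast
  moreover have "KL_divergence (exp 1) P \<gamma> = (\<integral>x. ln (D x) \<partial>\<gamma>)"
    unfolding KL_divergence_def by (rule integral_cong_AE[OF me ml ae])
  ultimately show ?thesis using ac by (simp add: KL_ext_def)
qed

text \<open>Functions of one coordinate have the same integral under all couplings; this is why the
  cost will depend on the coupling only through the cross term.\<close>

lemma joint_has_bochner_integral: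
  fixes f :: "'a::{real_inner,polish_space} \<Rightarrow> real"
  assumes \<pi>: "\<pi> \<in> joint \<mu> \<nu>"
  shows joint_fst: "has_bochner_integral \<mu> f c \<Longrightarrow> has_bochner_integral \<pi> (\<lambda>p. f (fst p)) c"
    and joint_snd: "has_bochner_integral \<nu> f c \<Longrightarrow> has_bochner_integral \<pi> (\<lambda>p. f (snd p)) c"
proof -
  have s: "sets \<pi> = sets borel" using \<pi> by (simp add: joint_def)
  have m: "fst \<in> measurable \<pi> borel" "snd \<in> measurable \<pi> borel"
    unfolding measurable_cong_sets[OF s refl] by (intro borel_measurable_continuous_onI continuous_intros)+
  have d: "distr \<pi> borel fst = \<mu>" "distr \<pi> borel snd = \<nu>" using \<pi> by (auto simp: joint_def)
  have f: "f \<in> borel_measurable borel" if "has_bochner_integral \<rho> f c" "sets \<rho> = sets borel" for \<rho>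
    using borel_measurable_integrable[of \<rho> f] that measurable_cong_sets[OF that(2) refl] by (auto simp: has_bochner_integral_iff)
  show "has_bochner_integral \<pi> (\<lambda>p. f (fst p)) c" if h: "has_bochner_integral \<mu> f c"
  proof -
    have fm: "f \<in> borel_measurable borel" by (rule f[OF h]) (simp flip: d(1))
    show ?thesis
      using h unfolding d(1)[symmetric] has_bochner_integral_iff integrable_distr_eq[OF m(1) fm] integral_distr[OF m(1) fm] .
  qed
  show "has_bochner_integral \<pi> (\<lambda>p. f (snd p)) c" if h: "has_bochner_integral \<nu> f c"
  proof -
    have fm: "f \<in> borel_measurable borel" by (rule f[OF h]) (simp flip: d(2))
    show ?thesis
      using h unfolding d(2)[symmetric] has_bochner_integral_iff integrable_distr_eq[OF m(2) fm] integral_distr[OF m(2) fm] .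
  qed
qed

section \<open>Couplings correlating finitely many modes\<close>

text \<open>The modes enter only through their covariance relations, so no operator root occurs
  below. In the application \<open>T0\<close> and \<open>T1\<close> are the traces of the
  covariances and \<open>S\<close> that of \<open>R0 C1 R0\<close>. That \<open>X_cross\<close> and
  \<open>s_sum\<close> share the value \<open>S\<close> says that the modes miss no part of the
  cross term.\<close>

locale sinkhorn_frame = X: gaussian \<mu> m0 C0 + Y: gaussian \<nu> m1 C1
  for \<mu> \<nu> :: "'a::{real_inner,polish_space} measure" and m0 m1 :: 'a and C0 C1 :: "'a \<Rightarrow>\<^sub>L 'a" +
  fixes \<epsilon> :: real and K :: "'k set" and u v :: "'k \<Rightarrow> 'a" and s :: "'k \<Rightarrow> real" and T0 T1 S :: real
  assumes eps: "0 < \<epsilon>" and K: "countable K" and s_pos: "\<And>k. k \<in> K \<Longrightarrow> 0 < s k"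
    and C0_u: "\<And>k. k \<in> K \<Longrightarrow> C0 (u k) = s k *\<^sub>R v k"
    and C1_v: "\<And>k. k \<in> K \<Longrightarrow> C1 (v k) = s k *\<^sub>R u k"
    and u_orth: "\<And>k l. k \<in> K \<Longrightarrow> l \<in> K \<Longrightarrow> inner (C0 (u k)) (u l) = (if k = l then 1 else 0)"
    and v_orth: "\<And>k l. k \<in> K \<Longrightarrow> l \<in> K \<Longrightarrow> inner (C1 (v k)) (v l) = (if k = l then 1 else 0)"
    and X_norm: "has_bochner_integral \<mu> (\<lambda>x. (norm (x - m0))\<^sup>2) T0"
    and Y_norm: "has_bochner_integral \<nu> (\<lambda>y. (norm (y - m1))\<^sup>2) T1"
    and X_cross: "has_bochner_integral \<mu> (\<lambda>x. inner (C1 (x - m0)) (x - m0)) S"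
    and s_sum: "((\<lambda>k. (s k)\<^sup>2) has_sum S) K"
begin

sublocale prod: pair_prob_space \<mu> \<nu>
  by unfold_locales

text \<open>In the application \<open>M k\<close> is an eigenvalue of
  \<open>M_eps \<epsilon> C0 C1\<close>. \<open>b k\<close> is the coefficient of the k-th mode in
  the cross term of \<open>-(norm (x - y))^2 / \<epsilon>\<close>, and \<open>r k\<close> the
  correlation of the optimal bivariate normal law.\<close>

definition M :: "'k \<Rightarrow> real" where "M k = sqrt (1 + 16 / \<epsilon>\<^sup>2 * (s k)\<^sup>2) - 1"
definition b :: "'k \<Rightarrow> real" where "b k = 2 * s k / \<epsilon>"
definition r :: "'k \<Rightarrow> real" where "r k = b k / (1 + M k / 2)"
definition \<xi> :: "'k \<Rightarrow> 'a \<Rightarrow> real" where "\<xi> k x = inner (x - m0) (u k)"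
definition \<eta> :: "'k \<Rightarrow> 'a \<Rightarrow> real" where "\<eta> k y = inner (y - m1) (v k)"
definition dens :: "'k set \<Rightarrow> 'a \<times> 'a \<Rightarrow> real" where
  "dens F p = (\<Prod>k\<in>F. gauss_kernel (M k) (b k) (\<xi> k (fst p)) (\<eta> k (snd p)))"

lemma M_nonneg: "0 \<le> M k"
  by (simp add: M_def)

lemma M_le: "M k \<le> 8 / \<epsilon>\<^sup>2 * (s k)\<^sup>2"
  using sqrt_one_plus_le[of "16 / \<epsilon>\<^sup>2 * (s k)\<^sup>2"] by (simp add: M_def)

text \<open>The condition under which \<open>gauss_kernel\<close> has standard normal marginals; it
  is what dictates the formula for \<open>M\<close>.\<close>

lemma b_square: "(b k)\<^sup>2 = M k * (M k + 2) / 4"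
proof -
  have "M k * (M k + 2) = (M k + 1)\<^sup>2 - 1" by (simp add: power2_eq_square algebra_simps)
  also have "\<dots> = 16 / \<epsilon>\<^sup>2 * (s k)\<^sup>2" by (simp add: M_def)
  finally show ?thesis by (simp add: b_def power_divide)
qed

lemma b_r: "b k * r k = M k / 2"
proof -
  have "b k * r k = (b k)\<^sup>2 / (1 + M k / 2)" by (simp add: r_def power2_eq_square)
  also have "(b k)\<^sup>2 = M k / 2 * (1 + M k / 2)" by (simp add: b_square field_simps)
  finally have e: "b k * r k = M k / 2 * (1 + M k / 2) / (1 + M k / 2)" .
  have "1 + M k / 2 \<noteq> 0" using M_nonneg[of k] by linarith
  then show ?thesis unfolding e by (rule nonzero_mult_div_cancel_right)
qed

lemma s_r: "s k * r k = \<epsilon> / 4 * M k"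
  using b_r[of k] eps by (simp add: b_def field_simps)

lemma sets_prod: "sets (\<mu> \<Otimes>\<^sub>M \<nu>) = sets borel"
  unfolding sets_pair_measure_cong[OF X.sets_eq Y.sets_eq] borel_prod ..

lemma prod_measurable:
  "continuous_on UNIV f \<Longrightarrow> f \<in> borel_measurable (\<mu> \<Otimes>\<^sub>M \<nu>)" for f :: "'a \<times> 'a \<Rightarrow> real"
  using borel_measurable_continuous_onI[of f] measurable_cong_sets[OF sets_prod refl] by blast

lemma joint_measurable:
  "\<pi> \<in> joint \<mu> \<nu> \<Longrightarrow> continuous_on UNIV f \<Longrightarrow> f \<in> borel_measurable \<pi>" for f :: "'a \<times> 'a \<Rightarrow> real"
  using borel_measurable_continuous_onI[of f] measurable_cong_sets[of \<pi> borel, OF _ refl] by (auto simp: joint_def)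

lemma dens_continuous: "continuous_on UNIV (dens F)"
  unfolding dens_def[abs_def] gauss_kernel_def \<xi>_def \<eta>_def by (intro continuous_intros)

lemma dens_measurable [measurable]: "dens F \<in> borel_measurable (\<mu> \<Otimes>\<^sub>M \<nu>)"
  by (rule prod_measurable[OF dens_continuous])

lemma dens_pos: "0 < dens F p"
  unfolding dens_def by (intro prod_pos gauss_kernel_pos M_nonneg)

text \<open>Under \<nu> the \<open>\<eta> k\<close> with \<open>k\<close> in \<open>F\<close> are
  independent standard normals, so for fixed \<open>x\<close> the integral is a product of kernel
  masses. Symmetry of the kernel gives the other variable.\<close>

lemma dens_marginal:
  assumes F: "finite F" "F \<subseteq> K"
  shows dens_marginal_fst: "(\<integral>\<^sup>+y. ennreal (dens F (x, y)) \<partial>\<nu>) = 1"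
    and dens_marginal_snd: "(\<integral>\<^sup>+x. ennreal (dens F (x, y)) \<partial>\<mu>) = 1"
proof -
  have vo: "inner (C1 (v i)) (v j) = (if i = j then 1 else 0)" and uo: "inner (C0 (u i)) (u j) = (if i = j then 1 else 0)"
    if "i \<in> F" "j \<in> F" for i j
    using that F(2) u_orth v_orth by (meson subsetD)+
  have "(\<integral>\<^sup>+y. ennreal (dens F (x, y)) \<partial>\<nu>) =
      (\<Prod>k\<in>F. \<integral>\<^sup>+y. ennreal (gauss_kernel (M k) (b k) (\<xi> k x) y) \<partial>std_normal_distribution)"
    unfolding dens_def \<eta>_def fst_conv snd_conv
    by (rule Y.nn_integral_prod_orthonormal[OF F(1) vo gauss_kernel_measurable less_imp_le[OF gauss_kernel_pos[OF M_nonneg]]])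
  then show "(\<integral>\<^sup>+y. ennreal (dens F (x, y)) \<partial>\<nu>) = 1"
    by (simp add: gauss_kernel_nn_mass[OF M_nonneg b_square])
  have "(\<integral>\<^sup>+x. ennreal (dens F (x, y)) \<partial>\<mu>) =
      (\<Prod>k\<in>F. \<integral>\<^sup>+x. ennreal (gauss_kernel (M k) (b k) (\<eta> k y) x) \<partial>std_normal_distribution)"
    unfolding dens_def \<xi>_def fst_conv snd_conv gauss_kernel_commute[of _ _ _ "\<eta> _ y"]
    by (rule X.nn_integral_prod_orthonormal[OF F(1) uo gauss_kernel_measurable less_imp_le[OF gauss_kernel_pos[OF M_nonneg]]])
  then show "(\<integral>\<^sup>+x. ennreal (dens F (x, y)) \<partial>\<mu>) = 1"
    by (simp add: gauss_kernel_nn_mass[OF M_nonneg b_square])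
qed

definition coupling :: "'k set \<Rightarrow> ('a \<times> 'a) measure" where
  "coupling F = density (\<mu> \<Otimes>\<^sub>M \<nu>) (\<lambda>p. ennreal (dens F p))"

lemma coupling_joint:
  assumes F: "finite F" "F \<subseteq> K"
  shows "coupling F \<in> joint \<mu> \<nu>"
proof -
  have sets: "sets (coupling F) = sets borel" unfolding coupling_def sets_density sets_prod ..
  have m: "fst \<in> measurable (coupling F) borel" "snd \<in> measurable (coupling F) borel"
    unfolding measurable_cong_sets[OF sets refl] by (intro borel_measurable_continuous_onI continuous_intros)+
  have vimage_borel: "fst -` A \<in> sets (borel :: ('a \<times> 'a) measure)" "snd -` A \<in> sets (borel :: ('a \<times> 'a) measure)"
    if "A \<in> sets borel" for A :: "'a set"
    using that by (auto intro!: measurable_sets_borel borel_measurable_continuous_onI continuous_intros)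
  have f: "(\<integral>\<^sup>+p. ennreal (dens F p) * indicator (fst -` A) p \<partial>(\<mu> \<Otimes>\<^sub>M \<nu>)) = emeasure \<mu> A"
    if [measurable]: "A \<in> sets borel" for A
  proof -
    have [measurable]: "(\<lambda>p. ennreal (dens F p) * indicator (fst -` A) p) \<in> borel_measurable (\<mu> \<Otimes>\<^sub>M \<nu>)"
      by (intro borel_measurable_times_ennreal borel_measurable_indicator measurable_compose[OF dens_measurable measurable_ennreal])
        (simp only: sets_prod vimage_borel[OF that])
    have "(\<integral>\<^sup>+p. ennreal (dens F p) * indicator (fst -` A) p \<partial>(\<mu> \<Otimes>\<^sub>M \<nu>)) =
        (\<integral>\<^sup>+x. \<integral>\<^sup>+y. ennreal (dens F (x, y)) * indicator (fst -` A) (x, y) \<partial>\<nu> \<partial>\<mu>)"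
      by (rule Y.nn_integral_fst[symmetric]) measurable
    also have "\<dots> = (\<integral>\<^sup>+x. indicator A x \<partial>\<mu>)"
    proof (rule nn_integral_cong)
      fix x
      have [measurable]: "(\<lambda>y. ennreal (dens F (x, y))) \<in> borel_measurable \<nu>"
        by (rule measurable_compose_Pair1[OF _ measurable_compose[OF dens_measurable measurable_ennreal]]) simp
      have "(\<integral>\<^sup>+y. ennreal (dens F (x, y)) * indicator (fst -` A) (x, y) \<partial>\<nu>) =
          (\<integral>\<^sup>+y. indicator A x * ennreal (dens F (x, y)) \<partial>\<nu>)"
        by (intro nn_integral_cong) (auto simp: indicator_def)
      also have "\<dots> = indicator A x"
        by (subst nn_integral_cmult) (auto simp: dens_marginal_fst[OF F])
      finally show "(\<integral>\<^sup>+y. ennreal (dens F (x, y)) * indicator (fst -` A) (x, y) \<partial>\<nu>) = indicator A x" .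
    qed
    finally show ?thesis by simp
  qed
  have g: "(\<integral>\<^sup>+p. ennreal (dens F p) * indicator (snd -` A) p \<partial>(\<mu> \<Otimes>\<^sub>M \<nu>)) = emeasure \<nu> A"
    if [measurable]: "A \<in> sets borel" for A
  proof -
    have [measurable]: "(\<lambda>p. ennreal (dens F p) * indicator (snd -` A) p) \<in> borel_measurable (\<mu> \<Otimes>\<^sub>M \<nu>)"
      by (intro borel_measurable_times_ennreal borel_measurable_indicator measurable_compose[OF dens_measurable measurable_ennreal])
        (simp only: sets_prod vimage_borel[OF that])
    have "(\<integral>\<^sup>+p. ennreal (dens F p) * indicator (snd -` A) p \<partial>(\<mu> \<Otimes>\<^sub>M \<nu>)) =
        (\<integral>\<^sup>+y. \<integral>\<^sup>+x. ennreal (dens F (x, y)) * indicator (snd -` A) (x, y) \<partial>\<mu> \<partial>\<nu>)"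
      by (rule prod.nn_integral_snd[symmetric]) measurable
    also have "\<dots> = (\<integral>\<^sup>+y. indicator A y \<partial>\<nu>)"
    proof (rule nn_integral_cong)
      fix y
      have [measurable]: "(\<lambda>x. ennreal (dens F (x, y))) \<in> borel_measurable \<mu>"
        by (rule measurable_Pair1[OF measurable_compose[OF dens_measurable measurable_ennreal]]) simp
      have "(\<integral>\<^sup>+x. ennreal (dens F (x, y)) * indicator (snd -` A) (x, y) \<partial>\<mu>) =
          (\<integral>\<^sup>+x. indicator A y * ennreal (dens F (x, y)) \<partial>\<mu>)"
        by (intro nn_integral_cong) (auto simp: indicator_def)
      also have "\<dots> = indicator A y"
        by (subst nn_integral_cmult) (auto simp: dens_marginal_snd[OF F])
      finally show "(\<integral>\<^sup>+x. ennreal (dens F (x, y)) * indicator (snd -` A) (x, y) \<partial>\<mu>) = indicator A y" .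
    qed
    finally show ?thesis by simp
  qed
  have em: "emeasure (coupling F) B = (\<integral>\<^sup>+p. ennreal (dens F p) * indicator B p \<partial>(\<mu> \<Otimes>\<^sub>M \<nu>))" if "B \<in> sets borel" for B
    unfolding coupling_def by (rule emeasure_density) (use dens_measurable that in \<open>simp_all only: sets_prod measurable_compose[OF _ measurable_ennreal]\<close>)
  have sp: "space (coupling F) = UNIV" using sets_eq_imp_space_eq[OF sets] by simp
  have "distr (coupling F) borel fst = \<mu>"
  proof (rule measure_eqI)
    fix A assume "A \<in> sets (distr (coupling F) borel fst)"
    then have A: "A \<in> sets borel" by simp
    have "fst -` A \<in> sets (borel :: ('a \<times> 'a) measure)"
      using measurable_sets[OF m(1) A] by (simp add: sp sets)
    then show "emeasure (distr (coupling F) borel fst) A = emeasure \<mu> A"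
      using f[OF A] A m by (simp add: emeasure_distr sp em)
  qed simp
  moreover have "distr (coupling F) borel snd = \<nu>"
  proof (rule measure_eqI)
    fix A assume "A \<in> sets (distr (coupling F) borel snd)"
    then have A: "A \<in> sets borel" by simp
    have "snd -` A \<in> sets (borel :: ('a \<times> 'a) measure)"
      using measurable_sets[OF m(2) A] by (simp add: sp sets)
    then show "emeasure (distr (coupling F) borel snd) A = emeasure \<nu> A"
      using g[OF A] A m by (simp add: emeasure_distr sp em)
  qed simp
  moreover have "prob_space (coupling F)"
  proof (rule prob_spaceI)
    show "emeasure (coupling F) (space (coupling F)) = 1"
      using em[of UNIV] f[of UNIV] X.emeasure_space_1 by (simp add: sp)
  qed
  ultimately show ?thesis using sets by (simp add: joint_def)
qed

text \<open>Expand the square about the means: the linear terms integrate to 0, and the second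
  moments are fixed by the marginals. Nonnegativity is recorded because \<open>ennreal\<close> sends
  negative numbers to 0.\<close>

lemma joint_cost:
  assumes \<pi>: "\<pi> \<in> joint \<mu> \<nu>"
  shows joint_cross_integrable: "integrable \<pi> (\<lambda>p. inner (snd p - m1) (fst p - m0))"
    and joint_cost_eq: "(\<integral>\<^sup>+p. ennreal ((norm (fst p - snd p))\<^sup>2) \<partial>\<pi>) =
      ennreal ((norm (m0 - m1))\<^sup>2 + T0 + T1 - 2 * (\<integral>p. inner (snd p - m1) (fst p - m0) \<partial>\<pi>))"
    and joint_cost_nonneg:
      "0 \<le> (norm (m0 - m1))\<^sup>2 + T0 + T1 - 2 * (\<integral>p. inner (snd p - m1) (fst p - m0) \<partial>\<pi>)"
proof -
  let ?c = "\<lambda>p. inner (snd p - m1) (fst p - m0)" and ?d = "m0 - m1"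
  interpret Q: prob_space \<pi> using \<pi> by (simp add: joint_def)
  have N0: "has_bochner_integral \<pi> (\<lambda>p. (norm (fst p - m0))\<^sup>2) T0"
    by (rule joint_fst[OF \<pi> X_norm])
  have N1: "has_bochner_integral \<pi> (\<lambda>p. (norm (snd p - m1))\<^sup>2) T1"
    by (rule joint_snd[OF \<pi> Y_norm])
  have L0: "has_bochner_integral \<pi> (\<lambda>p. inner (fst p - m0) ?d) 0"
    using X.functional_integrable X.functional_mean by (intro joint_fst[OF \<pi>]) (auto simp: has_bochner_integral_iff)
  have L1: "has_bochner_integral \<pi> (\<lambda>p. inner (snd p - m1) ?d) 0"
    using Y.functional_integrable Y.functional_mean by (intro joint_snd[OF \<pi>]) (auto simp: has_bochner_integral_iff)
  show int: "integrable \<pi> ?c"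
  proof (rule Bochner_Integration.integrable_bound)
    show "integrable \<pi> (\<lambda>p. (norm (fst p - m0))\<^sup>2 + (norm (snd p - m1))\<^sup>2)"
      using N0 N1 by (auto simp: has_bochner_integral_iff)
    show "?c \<in> borel_measurable \<pi>"
      by (intro joint_measurable[OF \<pi>] continuous_intros)
    have "\<bar>inner y x\<bar> \<le> (norm x)\<^sup>2 + (norm y)\<^sup>2" for x y :: 'a
    proof -
      have "\<bar>inner y x\<bar> \<le> norm y * norm x" by (rule Cauchy_Schwarz_ineq2)
      also have "\<dots> \<le> 2 * (norm y * norm x)" by simp
      also have "\<dots> \<le> (norm x)\<^sup>2 + (norm y)\<^sup>2"
        using sum_squares_bound[of "norm x" "norm y"] by (simp add: mult_ac)
      finally show ?thesis .
    qed
    then show "AE p in \<pi>. norm (?c p) \<le> norm ((norm (fst p - m0))\<^sup>2 + (norm (snd p - m1))\<^sup>2)"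
      by simp
  qed
  then have c: "has_bochner_integral \<pi> ?c (integral\<^sup>L \<pi> ?c)" by (rule has_bochner_integral_integrable)
  have "has_bochner_integral \<pi> (\<lambda>p. (norm ?d)\<^sup>2) ((norm ?d)\<^sup>2)"
    by (simp add: has_bochner_integral_iff Q.prob_space)
  from has_bochner_integral_diff[OF has_bochner_integral_add[OF has_bochner_integral_add[OF has_bochner_integral_add[OF this N0] N1]
        has_bochner_integral_diff[OF has_bochner_integral_mult_right[OF L0, of 2] has_bochner_integral_mult_right[OF L1, of 2]]]
      has_bochner_integral_mult_right[OF c, of 2]]
  have "has_bochner_integral \<pi> (\<lambda>p. (norm ?d)\<^sup>2 + (norm (fst p - m0))\<^sup>2 + (norm (snd p - m1))\<^sup>2
      + (2 * inner (fst p - m0) ?d - 2 * inner (snd p - m1) ?d) - 2 * ?c p)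
    ((norm ?d)\<^sup>2 + T0 + T1 + (2 * 0 - 2 * 0) - 2 * integral\<^sup>L \<pi> ?c)"
    by simp
  moreover have "(norm ?d)\<^sup>2 + (norm (fst p - m0))\<^sup>2 + (norm (snd p - m1))\<^sup>2
      + (2 * inner (fst p - m0) ?d - 2 * inner (snd p - m1) ?d) - 2 * ?c p = (norm (fst p - snd p))\<^sup>2" for p :: "'a \<times> 'a"
    unfolding power2_norm_eq_inner by (simp add: inner_diff_left inner_diff_right inner_commute)
  ultimately have hb: "has_bochner_integral \<pi> (\<lambda>p. (norm (fst p - snd p))\<^sup>2)
      ((norm ?d)\<^sup>2 + T0 + T1 - 2 * integral\<^sup>L \<pi> ?c)"
    by simp
  then show "(\<integral>\<^sup>+p. ennreal ((norm (fst p - snd p))\<^sup>2) \<partial>\<pi>) =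
      ennreal ((norm ?d)\<^sup>2 + T0 + T1 - 2 * integral\<^sup>L \<pi> ?c)"
    by (subst nn_integral_eq_integral) (auto simp: has_bochner_integral_iff)
  show "0 \<le> (norm ?d)\<^sup>2 + T0 + T1 - 2 * integral\<^sup>L \<pi> ?c"
  proof -
    have "0 \<le> (\<integral>p. (norm (fst p - snd p))\<^sup>2 \<partial>\<pi>)" by (rule Bochner_Integration.integral_nonneg) simp
    then show ?thesis using hb by (simp only: has_bochner_integral_iff)
  qed
qed

end

text \<open>Pythagoras for the form of \<open>C\<close>, which may be degenerate; with nonnegativity
  of the form it yields Bessel's inequality.\<close>

lemma (in gaussian) cov_residual:
  fixes h :: "'b \<Rightarrow> 'a" and g :: 'a
  assumes F: "finite F" and orth: "\<And>i j. i \<in> F \<Longrightarrow> j \<in> F \<Longrightarrow> inner (C (h i)) (h j) = (if i = j then 1 else 0)"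
  defines "g' \<equiv> g - (\<Sum>i\<in>F. inner (C g) (h i) *\<^sub>R h i)"
  shows "inner (C g') g' = inner (C g) g - (\<Sum>i\<in>F. (inner (C g) (h i))\<^sup>2)"
proof -
  let ?p = "\<Sum>i\<in>F. inner (C g) (h i) *\<^sub>R h i"
  have gp: "inner (C g) ?p = (\<Sum>i\<in>F. (inner (C g) (h i))\<^sup>2)"
    by (simp add: inner_sum_right power2_eq_square)
  have "inner (C ?p) (h j) = inner (C g) (h j)" if j: "j \<in> F" for j
  proof -
    have "inner (C ?p) (h j) = (\<Sum>i\<in>F. inner (C g) (h i) * inner (C (h i)) (h j))"
      by (simp add: blinfun.sum_right blinfun.scaleR_right inner_sum_left)
    also have "\<dots> = (\<Sum>i\<in>F. if i = j then inner (C g) (h i) else 0)"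
      using orth j by (intro sum.cong) auto
    finally show ?thesis using F j by simp
  qed
  then have pp: "inner (C ?p) ?p = (\<Sum>i\<in>F. (inner (C g) (h i))\<^sup>2)"
    by (simp add: inner_sum_right[of "C ?p"] power2_eq_square)
  have "inner (C g') g' = inner (C g) g - inner (C g) ?p - inner (C ?p) g + inner (C ?p) ?p"
    by (simp add: g'_def blinfun.diff_right inner_diff_left inner_diff_right)
  then show ?thesis using gp pp cov_commute[of ?p g] by simp
qed

section \<open>Cost and entropy of the finite couplings\<close>

context sinkhorn_frame
begin

lemma \<xi>_continuous [continuous_intros]: "continuous_on A (\<lambda>x. \<xi> k x)"
  and \<eta>_continuous [continuous_intros]: "continuous_on A (\<lambda>y. \<eta> k y)"
  unfolding \<xi>_def \<eta>_def by (intro continuous_intros)+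

lemma C1_v_inner: "k \<in> K \<Longrightarrow> inner (C1 (x - m0)) (v k) = s k * \<xi> k x"
  using Y.cov_commute[of "x - m0" "v k"] C1_v by (simp add: \<xi>_def inner_commute)

lemma C0_u_inner: "k \<in> K \<Longrightarrow> inner (C0 (y - m1)) (u k) = s k * \<eta> k y"
  using X.cov_commute[of "y - m1" "u k"] C0_u by (simp add: \<eta>_def inner_commute)

lemma \<xi>_variance: "k \<in> K \<Longrightarrow> has_bochner_integral \<mu> (\<lambda>x. (\<xi> k x)\<^sup>2) 1"
  using X.functional_square_integrable X.functional_variance u_orth by (simp add: \<xi>_def has_bochner_integral_iff)

lemma \<eta>_variance: "k \<in> K \<Longrightarrow> has_bochner_integral \<nu> (\<lambda>y. (\<eta> k y)\<^sup>2) 1"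
  using Y.functional_square_integrable Y.functional_variance v_orth by (simp add: \<eta>_def has_bochner_integral_iff)

text \<open>Integrate over \<open>y\<close> first: for fixed \<open>x\<close> the integrand is a
  linear functional of \<open>y\<close> times a product of kernels whose means are
  \<open>r k * \<xi> k x\<close>. The function \<open>f\<close> is left free to serve both the full
  cross term and a single mode.\<close>

lemma coupling_functional:
  assumes F: "finite F" "F \<subseteq> K" and f: "continuous_on UNIV f"
    and int: "integrable (coupling F) (\<lambda>p. inner (snd p - m1) (f (fst p)))"
  shows "(\<integral>p. inner (snd p - m1) (f (fst p)) \<partial>coupling F) =
    (\<integral>x. (\<Sum>k\<in>F. inner (C1 (f x)) (v k) * (r k * \<xi> k x)) \<partial>\<mu>)"
proof -
  let ?G = "\<lambda>p. inner (snd p - m1) (f (fst p))"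
  have vo: "inner (C1 (v i)) (v j) = (if i = j then 1 else 0)" if "i \<in> F" "j \<in> F" for i j
    using that F(2) v_orth by (meson subsetD)
  have Gm: "?G \<in> borel_measurable (\<mu> \<Otimes>\<^sub>M \<nu>)"
    by (intro prod_measurable continuous_intros continuous_on_compose2[OF f]) auto
  have d0: "AE p in \<mu> \<Otimes>\<^sub>M \<nu>. 0 \<le> dens F p" by (simp add: dens_pos less_imp_le)
  have "integrable (\<mu> \<Otimes>\<^sub>M \<nu>) (\<lambda>p. dens F p *\<^sub>R ?G p)"
    using int unfolding coupling_def by (subst (asm) integrable_density[OF Gm dens_measurable d0])
  then have "(\<integral>p. dens F p *\<^sub>R ?G p \<partial>(\<mu> \<Otimes>\<^sub>M \<nu>)) = (\<integral>x. \<integral>y. dens F (x, y) *\<^sub>R ?G (x, y) \<partial>\<nu> \<partial>\<mu>)"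
    by (rule prod.integral_fst'[symmetric])
  moreover have "(\<integral>y. dens F (x, y) *\<^sub>R ?G (x, y) \<partial>\<nu>) = (\<Sum>k\<in>F. inner (C1 (f x)) (v k) * (r k * \<xi> k x))" for x
  proof -
    have "has_bochner_integral \<nu> (\<lambda>y. inner (y - m1) (f x) * (\<Prod>k\<in>F. gauss_kernel (M k) (b k) (\<xi> k x) (inner (y - m1) (v k))))
        (\<Sum>k\<in>F. inner (C1 (f x)) (v k) * (b k / (1 + M k / 2) * \<xi> k x))"
      by (rule Y.integral_functional_times_prod[OF F(1) vo gauss_kernel_measurable
            gauss_kernel_mass[OF M_nonneg b_square] gauss_kernel_mean[OF M_nonneg b_square]])
    then show ?thesis
      by (simp add: has_bochner_integral_iff dens_def \<eta>_def r_def mult.commute)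
  qed
  moreover have "integral\<^sup>L (coupling F) ?G = (\<integral>p. dens F p *\<^sub>R ?G p \<partial>(\<mu> \<Otimes>\<^sub>M \<nu>))"
    unfolding coupling_def by (rule integral_density[OF Gm dens_measurable d0])
  ultimately show ?thesis by simp
qed

lemma coupling_cross:
  assumes F: "finite F" "F \<subseteq> K"
  shows "(\<integral>p. inner (snd p - m1) (fst p - m0) \<partial>coupling F) = \<epsilon> / 4 * (\<Sum>k\<in>F. M k)"
proof -
  have "(\<integral>p. inner (snd p - m1) (fst p - m0) \<partial>coupling F) =
      (\<integral>x. (\<Sum>k\<in>F. inner (C1 (x - m0)) (v k) * (r k * \<xi> k x)) \<partial>\<mu>)"
    using joint_cross_integrable[OF coupling_joint[OF F]]
    by (intro coupling_functional[OF F, where f = "\<lambda>x. x - m0"] continuous_intros)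
  also have "\<dots> = (\<integral>x. (\<Sum>k\<in>F. (s k * r k) * (\<xi> k x)\<^sup>2) \<partial>\<mu>)"
    using F(2) C1_v_inner by (intro Bochner_Integration.integral_cong sum.cong) (auto simp: power2_eq_square subset_iff)
  also have "\<dots> = (\<Sum>k\<in>F. (s k * r k) * 1)"
    by (intro has_bochner_integral_integral_eq has_bochner_integral_sum has_bochner_integral_mult_right \<xi>_variance)
      (use F(2) in auto)
  finally show ?thesis by (simp add: s_r sum_distrib_left)
qed

text \<open>A single mode is the case \<open>f x = \<xi> k x *\<^sub>R v k\<close> of
  \<open>coupling_functional\<close>; orthonormality of the \<open>v\<close> keeps only the k-th
  term.\<close>

lemma coupling_correlation:
  assumes F: "finite F" "F \<subseteq> K" and k: "k \<in> F"
  shows "has_bochner_integral (coupling F) (\<lambda>p. \<xi> k (fst p) * \<eta> k (snd p)) (r k)"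
proof -
  note j = coupling_joint[OF F]
  have kK: "k \<in> K" using F k by auto
  have int: "integrable (coupling F) (\<lambda>p. \<xi> k (fst p) * \<eta> k (snd p))"
  proof (rule Bochner_Integration.integrable_bound)
    show "integrable (coupling F) (\<lambda>p. (\<xi> k (fst p))\<^sup>2 + (\<eta> k (snd p))\<^sup>2)"
      using joint_fst[OF j \<xi>_variance[OF kK]] joint_snd[OF j \<eta>_variance[OF kK]] by (auto simp: has_bochner_integral_iff)
    show "(\<lambda>p. \<xi> k (fst p) * \<eta> k (snd p)) \<in> borel_measurable (coupling F)"
      unfolding \<xi>_def \<eta>_def by (intro joint_measurable[OF j] continuous_intros)
    have "\<bar>x * y\<bar> \<le> x\<^sup>2 + y\<^sup>2" for x y :: real
      using sum_squares_bound[of x y] sum_squares_bound[of x "-y"] zero_le_power2[of x] zero_le_power2[of y]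
      by (simp add: abs_le_iff)
    then show "AE p in coupling F. norm (\<xi> k (fst p) * \<eta> k (snd p)) \<le> norm ((\<xi> k (fst p))\<^sup>2 + (\<eta> k (snd p))\<^sup>2)"
      by simp
  qed
  have eq: "\<xi> k (fst p) * \<eta> k (snd p) = inner (snd p - m1) (\<xi> k (fst p) *\<^sub>R v k)" for p :: "'a \<times> 'a"
    by (simp add: \<eta>_def)
  have "integral\<^sup>L (coupling F) (\<lambda>p. \<xi> k (fst p) * \<eta> k (snd p)) =
      (\<integral>x. (\<Sum>j\<in>F. inner (C1 (\<xi> k x *\<^sub>R v k)) (v j) * (r j * \<xi> j x)) \<partial>\<mu>)"
    unfolding eq using int unfolding eq
    by (intro coupling_functional[OF F, where f = "\<lambda>x. \<xi> k x *\<^sub>R v k"] continuous_intros)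
  also have "\<dots> = (\<integral>x. r k * (\<xi> k x)\<^sup>2 \<partial>\<mu>)"
  proof (rule Bochner_Integration.integral_cong[OF refl])
    fix x
    have "(\<Sum>j\<in>F. inner (C1 (\<xi> k x *\<^sub>R v k)) (v j) * (r j * \<xi> j x)) = (\<Sum>j\<in>F. if j = k then r k * (\<xi> k x)\<^sup>2 else 0)"
      using F(2) kK v_orth by (intro sum.cong) (auto simp: blinfun.scaleR_right power2_eq_square subset_iff)
    then show "(\<Sum>j\<in>F. inner (C1 (\<xi> k x *\<^sub>R v k)) (v j) * (r j * \<xi> j x)) = r k * (\<xi> k x)\<^sup>2"
      using F(1) k by simp
  qed
  also have "\<dots> = r k * 1"
    by (intro has_bochner_integral_integral_eq has_bochner_integral_mult_right \<xi>_variance kK)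
  finally show ?thesis using int by (simp add: has_bochner_integral_iff)
qed

lemma ln_dens:
  assumes F: "finite F"
  shows "ln (dens F p) = (\<Sum>k\<in>F. ln (1 + M k / 2) / 2 + b k * (\<xi> k (fst p) * \<eta> k (snd p))
    - M k / 4 * ((\<xi> k (fst p))\<^sup>2 + (\<eta> k (snd p))\<^sup>2))"
proof -
  have "ln (gauss_kernel (M k) (b k) x y) = ln (1 + M k / 2) / 2 + b k * (x * y) - M k / 4 * (x\<^sup>2 + y\<^sup>2)" for k x y
  proof -
    have "0 < sqrt (1 + M k / 2)" using M_nonneg[of k] by simp
    then show ?thesis
      unfolding gauss_kernel_def using M_nonneg[of k] by (subst ln_mult) (auto simp: ln_sqrt mult.assoc)
  qed
  moreover have "gauss_kernel (M k) (b k) x y \<noteq> 0" for k x y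
    using gauss_kernel_pos[OF M_nonneg] by (metis less_irrefl)
  ultimately show ?thesis
    unfolding dens_def using F by (subst ln_prod) auto
qed

text \<open>By \<open>b_r\<close> the mean of the cross term cancels that of the quadratic terms, so
  only the logarithms of the normalising constants survive.\<close>

lemma coupling_entropy:
  assumes F: "finite F" "F \<subseteq> K"
  shows "KL_ext (coupling F) (\<mu> \<Otimes>\<^sub>M \<nu>) = ereal (\<Sum>k\<in>F. ln (1 + M k / 2) / 2)"
proof -
  note j = coupling_joint[OF F]
  interpret c: prob_space "coupling F" using j by (simp add: joint_def)
  have "has_bochner_integral (coupling F) (\<lambda>p. ln (dens F p))
      (\<Sum>k\<in>F. ln (1 + M k / 2) / 2 + b k * r k - M k / 4 * (1 + 1))"
    unfolding ln_dens[OF F(1)]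
  proof (intro has_bochner_integral_sum has_bochner_integral_diff has_bochner_integral_add has_bochner_integral_mult_right)
    fix k assume k: "k \<in> F"
    then have kK: "k \<in> K" using F by auto
    show "has_bochner_integral (coupling F) (\<lambda>p. ln (1 + M k / 2) / 2) (ln (1 + M k / 2) / 2)"
      by (simp add: has_bochner_integral_iff c.prob_space)
    show "has_bochner_integral (coupling F) (\<lambda>p. \<xi> k (fst p) * \<eta> k (snd p)) (r k)"
      by (rule coupling_correlation[OF F k])
    show "has_bochner_integral (coupling F) (\<lambda>p. (\<xi> k (fst p))\<^sup>2) 1"
      by (rule joint_fst[OF j \<xi>_variance[OF kK]])
    show "has_bochner_integral (coupling F) (\<lambda>p. (\<eta> k (snd p))\<^sup>2) 1"
      by (rule joint_snd[OF j \<eta>_variance[OF kK]])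
  qed
  then have hb: "has_bochner_integral (coupling F) (\<lambda>p. ln (dens F p)) (\<Sum>k\<in>F. ln (1 + M k / 2) / 2)"
    by (simp add: b_r)
  have "KL_ext (coupling F) (\<mu> \<Otimes>\<^sub>M \<nu>) = ereal (\<integral>p. ln (dens F p) \<partial>coupling F)"
    using hb by (intro KL_ext_density[OF prod.prob_space_axioms dens_measurable dens_pos coupling_def])
      (simp add: has_bochner_integral_iff)
  then show ?thesis using hb by (simp add: has_bochner_integral_iff)
qed

lemma OT_eps_le:
  assumes F: "finite F" "F \<subseteq> K"
  shows "OT_eps \<epsilon> \<mu> \<nu> \<le>
    ereal ((norm (m0 - m1))\<^sup>2 + T0 + T1 - \<epsilon> / 2 * (\<Sum>k\<in>F. M k) + \<epsilon> / 2 * (\<Sum>k\<in>F. ln (1 + M k / 2)))"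
proof -
  note j = coupling_joint[OF F]
  let ?T = "(norm (m0 - m1))\<^sup>2 + T0 + T1"
  have "OT_eps \<epsilon> \<mu> \<nu> \<le> enn2ereal (\<integral>\<^sup>+ p. ennreal ((norm (fst p - snd p))\<^sup>2) \<partial>coupling F)
      + ereal \<epsilon> * KL_ext (coupling F) (\<mu> \<Otimes>\<^sub>M \<nu>)"
    unfolding OT_eps_def by (rule INF_lower[OF j])
  also have "\<dots> = ereal (?T - 2 * (\<epsilon> / 4 * (\<Sum>k\<in>F. M k))) + ereal \<epsilon> * ereal (\<Sum>k\<in>F. ln (1 + M k / 2) / 2)"
    unfolding joint_cost_eq[OF j] coupling_entropy[OF F]
    using joint_cost_nonneg[OF j] by (simp add: coupling_cross[OF F] enn2ereal_ennreal)
  also have "\<dots> = ereal (?T - \<epsilon> / 2 * (\<Sum>k\<in>F. M k) + \<epsilon> / 2 * (\<Sum>k\<in>F. ln (1 + M k / 2)))"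
    by (simp add: sum_divide_distrib[symmetric])
  finally show ?thesis .
qed

section \<open>The limiting log density and the lower bound\<close>

lemma M_summable: "M summable_on K"
proof (rule summable_on_comparison_test)
  show "(\<lambda>k. 8 / \<epsilon>\<^sup>2 * (s k)\<^sup>2) summable_on K"
    using s_sum by (intro summable_on_cmult_right) (auto simp: summable_on_def)
qed (use M_le M_nonneg in auto)

lemma ln_M_summable: "(\<lambda>k. ln (1 + M k / 2)) summable_on K"
proof (rule summable_on_comparison_test[OF M_summable])
  show "ln (1 + M k / 2) \<le> M k" for k
    using ln_add_one_self_le_self[of "M k / 2"] M_nonneg[of k] by linarith
  show "0 \<le> ln (1 + M k / 2)" for k using M_nonneg[of k] by simp
qed

text \<open>\<open>inner (C1 (x - m0)) (v k)\<close> equals \<open>s k * \<xi> k x\<close>, so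
  \<open>h x\<close> is what remains of \<open>x - m0\<close> after projection onto the
  \<open>v k\<close> for the form of \<open>C1\<close>.\<close>

lemma residual_variance:
  assumes F: "finite F" "F \<subseteq> K"
  defines "h \<equiv> \<lambda>x. x - m0 - (\<Sum>k\<in>F. (s k * \<xi> k x) *\<^sub>R v k)"
  shows "inner (C1 (h x)) (h x) = inner (C1 (x - m0)) (x - m0) - (\<Sum>k\<in>F. (s k)\<^sup>2 * (\<xi> k x)\<^sup>2)"
proof -
  have "(\<Sum>k\<in>F. inner (C1 (x - m0)) (v k) *\<^sub>R v k) = (\<Sum>k\<in>F. (s k * \<xi> k x) *\<^sub>R v k)"
    "(\<Sum>k\<in>F. (inner (C1 (x - m0)) (v k))\<^sup>2) = (\<Sum>k\<in>F. (s k)\<^sup>2 * (\<xi> k x)\<^sup>2)"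
    using F(2) C1_v_inner by (auto intro!: sum.cong simp: power_mult_distrib)
  then show ?thesis
    unfolding h_def using Y.cov_residual[OF F(1), of v "x - m0"] F(2) v_orth by (auto simp: subset_iff)
qed

text \<open>Holds at every point, not just almost everywhere: \<open>M k\<close> is at most a
  constant times the square of \<open>s k\<close>, and Bessel's inequality for the forms of
  \<open>C1\<close> and \<open>C0\<close> bounds the resulting sums.\<close>

lemma quadratic_summable:
  shows \<xi>_summable: "(\<lambda>k. M k / 4 * (\<xi> k x)\<^sup>2) summable_on K"
    and \<eta>_summable: "(\<lambda>k. M k / 4 * (\<eta> k y)\<^sup>2) summable_on K"
proof -
  have "(\<lambda>k. (s k)\<^sup>2 * (\<xi> k x)\<^sup>2) summable_on K"
  proof (rule nonneg_bdd_above_summable_on)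
    have "(\<Sum>k\<in>F. (s k)\<^sup>2 * (\<xi> k x)\<^sup>2) \<le> inner (C1 (x - m0)) (x - m0)" if "finite F" "F \<subseteq> K" for F
      using residual_variance[OF that, of x] Y.cov_nonneg by (smt (verit))
    then show "bdd_above (sum (\<lambda>k. (s k)\<^sup>2 * (\<xi> k x)\<^sup>2) ` {F. F \<subseteq> K \<and> finite F})"
      by (auto intro!: bdd_aboveI[of _ "inner (C1 (x - m0)) (x - m0)"])
  qed simp
  then have 1: "(\<lambda>k. 2 / \<epsilon>\<^sup>2 * ((s k)\<^sup>2 * (\<xi> k x)\<^sup>2)) summable_on K"
    by (rule summable_on_cmult_right)
  have le: "M k / 4 * t\<^sup>2 \<le> 2 / \<epsilon>\<^sup>2 * ((s k)\<^sup>2 * t\<^sup>2)" for k t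
    using mult_right_mono[OF M_le[of k], of "t\<^sup>2 / 4"] by (simp add: field_simps)
  show "(\<lambda>k. M k / 4 * (\<xi> k x)\<^sup>2) summable_on K"
    by (rule summable_on_comparison_test[OF 1 le]) (simp add: M_nonneg)
  have "(\<lambda>k. (s k)\<^sup>2 * (\<eta> k y)\<^sup>2) summable_on K"
  proof (rule nonneg_bdd_above_summable_on)
    have "(\<Sum>k\<in>F. (s k)\<^sup>2 * (\<eta> k y)\<^sup>2) \<le> inner (C0 (y - m1)) (y - m1)" if F: "finite F" "F \<subseteq> K" for F
    proof -
      have uo: "inner (C0 (u i)) (u j) = (if i = j then 1 else 0)" if "i \<in> F" "j \<in> F" for i j
        using that F(2) u_orth by (meson subsetD)
      have "(\<Sum>k\<in>F. (inner (C0 (y - m1)) (u k))\<^sup>2) \<le> inner (C0 (y - m1)) (y - m1)"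
        using X.cov_residual[OF F(1) uo, of "y - m1"] X.cov_nonneg by (smt (verit))
      moreover have "(\<Sum>k\<in>F. (inner (C0 (y - m1)) (u k))\<^sup>2) = (\<Sum>k\<in>F. (s k)\<^sup>2 * (\<eta> k y)\<^sup>2)"
        using F(2) C0_u_inner by (auto intro!: sum.cong simp: power_mult_distrib)
      ultimately show ?thesis by simp
    qed
    then show "bdd_above (sum (\<lambda>k. (s k)\<^sup>2 * (\<eta> k y)\<^sup>2) ` {F. F \<subseteq> K \<and> finite F})"
      by (auto intro!: bdd_aboveI[of _ "inner (C0 (y - m1)) (y - m1)"])
  qed simp
  then have 2: "(\<lambda>k. 2 / \<epsilon>\<^sup>2 * ((s k)\<^sup>2 * (\<eta> k y)\<^sup>2)) summable_on K"
    by (rule summable_on_cmult_right)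
  show "(\<lambda>k. M k / 4 * (\<eta> k y)\<^sup>2) summable_on K"
    by (rule summable_on_comparison_test[OF 2 le]) (simp add: M_nonneg)
qed

text \<open>Together with \<open>potential1\<close>, these are the Schroedinger potentials of the
  problem up to sign, scaling, constants and the terms obtained by expanding the squared
  distance.\<close>

definition potential0 :: "'a \<Rightarrow> real" where "potential0 x = (\<Sum>\<^sub>\<infinity>k\<in>K. M k / 4 * (\<xi> k x)\<^sup>2)"
definition potential1 :: "'a \<Rightarrow> real" where "potential1 y = (\<Sum>\<^sub>\<infinity>k\<in>K. M k / 4 * (\<eta> k y)\<^sup>2)"

text \<open>The inner product replaces the series of the \<open>b k * (\<xi> k * \<eta> k)\<close>:
  it is defined everywhere and is the very cross term of the transport cost, so it can be integrated
  under any coupling.\<close>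

definition log_density :: "'a \<times> 'a \<Rightarrow> real" where
  "log_density p = (\<Sum>\<^sub>\<infinity>k\<in>K. ln (1 + M k / 2)) / 2
    + 2 / \<epsilon> * inner (snd p - m1) (fst p - m0) - potential0 (fst p) - potential1 (snd p)"

lemma potential_integral:
  shows potential0_integral: "has_bochner_integral \<mu> potential0 (infsum M K / 4)"
    and potential1_integral: "has_bochner_integral \<nu> potential1 (infsum M K / 4)"
proof -
  obtain F where F: "\<And>n. finite (F n)" "\<And>n. F n \<subseteq> K" "incseq F"
    "filterlim F (finite_subsets_at_top K) sequentially"
    using countable_exhaustion[OF K] by blast
  have lim: "(\<lambda>n. sum f (F n)) \<longlonglongrightarrow> infsum f K" if "f summable_on K" for f :: "'k \<Rightarrow> real"
    using filterlim_compose[OF has_sum_infsum[OF that, unfolded has_sum_def] F(4)] .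
  have mono: "mono (\<lambda>n. \<Sum>k\<in>F n. M k / 4 * (t k)\<^sup>2)" for t :: "'k \<Rightarrow> real"
    using F(1,3) M_nonneg by (intro monoI sum_mono2) (auto simp: incseq_def)
  have ilim: "(\<lambda>n. \<Sum>k\<in>F n. M k / 4 * 1) \<longlonglongrightarrow> infsum M K / 4"
    using tendsto_divide[OF lim[OF M_summable] tendsto_const[of 4]] by (simp add: sum_divide_distrib)
  show "has_bochner_integral \<mu> potential0 (infsum M K / 4)"
  proof (rule has_bochner_integral_monotone_convergence)
    have i: "has_bochner_integral \<mu> (\<lambda>x. \<Sum>k\<in>F n. M k / 4 * (\<xi> k x)\<^sup>2) (\<Sum>k\<in>F n. M k / 4 * 1)" for n
      using F(2) by (intro has_bochner_integral_sum has_bochner_integral_mult_right \<xi>_variance) auto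
    then show int: "integrable \<mu> (\<lambda>x. \<Sum>k\<in>F n. M k / 4 * (\<xi> k x)\<^sup>2)" for n
      by (simp only: has_bochner_integral_iff)
    have pt: "(\<lambda>n. \<Sum>k\<in>F n. M k / 4 * (\<xi> k x)\<^sup>2) \<longlonglongrightarrow> potential0 x" for x
      unfolding potential0_def by (rule lim[OF \<xi>_summable])
    then show "AE x in \<mu>. (\<lambda>n. \<Sum>k\<in>F n. M k / 4 * (\<xi> k x)\<^sup>2) \<longlonglongrightarrow> potential0 x" by simp
    show "potential0 \<in> borel_measurable \<mu>"
      by (rule borel_measurable_LIMSEQ_real[OF pt]) (use int in auto)
    show "(\<lambda>n. \<integral>x. (\<Sum>k\<in>F n. M k / 4 * (\<xi> k x)\<^sup>2) \<partial>\<mu>) \<longlonglongrightarrow> infsum M K / 4"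
      using ilim i by (simp only: has_bochner_integral_iff)
  qed (use mono in auto)
  show "has_bochner_integral \<nu> potential1 (infsum M K / 4)"
  proof (rule has_bochner_integral_monotone_convergence)
    have i: "has_bochner_integral \<nu> (\<lambda>y. \<Sum>k\<in>F n. M k / 4 * (\<eta> k y)\<^sup>2) (\<Sum>k\<in>F n. M k / 4 * 1)" for n
      using F(2) by (intro has_bochner_integral_sum has_bochner_integral_mult_right \<eta>_variance) auto
    then show int: "integrable \<nu> (\<lambda>y. \<Sum>k\<in>F n. M k / 4 * (\<eta> k y)\<^sup>2)" for n
      by (simp only: has_bochner_integral_iff)
    have pt: "(\<lambda>n. \<Sum>k\<in>F n. M k / 4 * (\<eta> k y)\<^sup>2) \<longlonglongrightarrow> potential1 y" for y
      unfolding potential1_def by (rule lim[OF \<eta>_summable])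
    then show "AE y in \<nu>. (\<lambda>n. \<Sum>k\<in>F n. M k / 4 * (\<eta> k y)\<^sup>2) \<longlonglongrightarrow> potential1 y" by simp
    show "potential1 \<in> borel_measurable \<nu>"
      by (rule borel_measurable_LIMSEQ_real[OF pt]) (use int in auto)
    show "(\<lambda>n. \<integral>y. (\<Sum>k\<in>F n. M k / 4 * (\<eta> k y)\<^sup>2) \<partial>\<nu>) \<longlonglongrightarrow> infsum M K / 4"
      using ilim i by (simp only: has_bochner_integral_iff)
  qed (use mono in auto)
qed

lemma log_density_measurable [measurable]: "log_density \<in> borel_measurable (\<mu> \<Otimes>\<^sub>M \<nu>)"
proof -
  have [measurable]: "potential0 \<in> borel_measurable \<mu>" "potential1 \<in> borel_measurable \<nu>"
    using potential0_integral potential1_integral by (auto simp: has_bochner_integral_iff)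
  have [measurable]: "(\<lambda>p. inner (snd p - m1) (fst p - m0)) \<in> borel_measurable (\<mu> \<Otimes>\<^sub>M \<nu>)"
    by (intro prod_measurable continuous_intros)
  have "(\<lambda>p. potential0 (fst p)) \<in> borel_measurable (\<mu> \<Otimes>\<^sub>M \<nu>)" "(\<lambda>p. potential1 (snd p)) \<in> borel_measurable (\<mu> \<Otimes>\<^sub>M \<nu>)"
    by (rule measurable_compose[OF measurable_fst] measurable_compose[OF measurable_snd]; measurable)+
  then show ?thesis
    unfolding log_density_def[abs_def] by (intro borel_measurable_diff borel_measurable_add borel_measurable_times borel_measurable_const) measurable
qed

text \<open>The mean square error of the truncated cross term is \<open>E \<langle>C1 (x - m0), x - m0\<rangle> - (\<Sum>k\<in>F. (s k)\<^sup>2)\<close>, which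
  tends to 0 because the singular values exhaust the trace \<open>S\<close>.\<close>

lemma cross_residual:
  assumes F: "finite F" "F \<subseteq> K"
  defines "R \<equiv> \<lambda>p. inner (snd p - m1) (fst p - m0) - (\<Sum>k\<in>F. s k * (\<xi> k (fst p) * \<eta> k (snd p)))"
  shows "has_bochner_integral (\<mu> \<Otimes>\<^sub>M \<nu>) (\<lambda>p. (R p)\<^sup>2) (S - (\<Sum>k\<in>F. (s k)\<^sup>2))"
proof -
  define h where "h x = x - m0 - (\<Sum>k\<in>F. (s k * \<xi> k x) *\<^sub>R v k)" for x
  have R: "R (x, y) = inner (y - m1) (h x)" for x y
    by (simp add: R_def h_def inner_diff_right[of "y - m1" "x - m0"] inner_sum_right \<eta>_def mult.assoc)
  have Rm: "(\<lambda>p. (R p)\<^sup>2) \<in> borel_measurable (\<mu> \<Otimes>\<^sub>M \<nu>)"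
    unfolding R_def \<xi>_def \<eta>_def by (intro prod_measurable continuous_intros)
  have hb: "has_bochner_integral \<mu> (\<lambda>x. inner (C1 (h x)) (h x)) (S - (\<Sum>k\<in>F. (s k)\<^sup>2 * 1))"
    unfolding h_def residual_variance[OF F]
    using F(2) by (intro has_bochner_integral_diff X_cross has_bochner_integral_sum has_bochner_integral_mult_right \<xi>_variance) auto
  have "(\<integral>\<^sup>+p. ennreal ((R p)\<^sup>2) \<partial>(\<mu> \<Otimes>\<^sub>M \<nu>)) = (\<integral>\<^sup>+x. \<integral>\<^sup>+y. ennreal ((R (x, y))\<^sup>2) \<partial>\<nu> \<partial>\<mu>)"
    by (rule Y.nn_integral_fst[symmetric]) (rule measurable_compose[OF Rm measurable_ennreal])
  also have "\<dots> = (\<integral>\<^sup>+x. ennreal (inner (C1 (h x)) (h x)) \<partial>\<mu>)"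
    unfolding R by (intro nn_integral_cong)
      (simp add: nn_integral_eq_integral[OF Y.functional_square_integrable] Y.functional_variance)
  also have "\<dots> = ennreal (S - (\<Sum>k\<in>F. (s k)\<^sup>2 * 1))"
    using hb Y.cov_nonneg by (subst nn_integral_eq_integral) (auto simp: has_bochner_integral_iff)
  finally have eq: "(\<integral>\<^sup>+p. ennreal ((R p)\<^sup>2) \<partial>(\<mu> \<Otimes>\<^sub>M \<nu>)) = ennreal (S - (\<Sum>k\<in>F. (s k)\<^sup>2))" by simp
  show ?thesis
  proof (rule has_bochner_integral_nn_integral[OF Rm _ _ eq])
    have "0 \<le> (\<integral>x. inner (C1 (h x)) (h x) \<partial>\<mu>)"
      by (rule Bochner_Integration.integral_nonneg) (rule Y.cov_nonneg)
    then show "0 \<le> S - (\<Sum>k\<in>F. (s k)\<^sup>2)" using hb by (simp add: has_bochner_integral_iff)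
  qed simp
qed

lemma dens_total:
  assumes F: "finite F" "F \<subseteq> K"
  shows "(\<integral>\<^sup>+p. ennreal (dens F p) \<partial>(\<mu> \<Otimes>\<^sub>M \<nu>)) = 1"
proof -
  have "(\<integral>\<^sup>+p. ennreal (dens F p) \<partial>(\<mu> \<Otimes>\<^sub>M \<nu>)) = (\<integral>\<^sup>+x. \<integral>\<^sup>+y. ennreal (dens F (x, y)) \<partial>\<nu> \<partial>\<mu>)"
    by (rule Y.nn_integral_fst[symmetric]) (rule measurable_compose[OF dens_measurable measurable_ennreal])
  then show ?thesis
    using X.emeasure_space_1 by (simp add: dens_marginal_fst[OF F])
qed

text \<open>The truncated cross terms converge only in mean square, so a subsequence is taken along
  which they converge almost everywhere; the other terms converge everywhere. Fatou's lemma loses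
  equality, but an upper bound on the mass is all that the variational inequality asks for.\<close>

lemma log_density_mass: "(\<integral>\<^sup>+p. ennreal (exp (log_density p)) \<partial>(\<mu> \<Otimes>\<^sub>M \<nu>)) \<le> 1"
proof -
  obtain F where F: "\<And>n. finite (F n)" "\<And>n. F n \<subseteq> K" "incseq F"
    "filterlim F (finite_subsets_at_top K) sequentially"
    using countable_exhaustion[OF K] by blast
  have lim: "(\<lambda>n. sum f (F n)) \<longlonglongrightarrow> infsum f K" if "f summable_on K" for f :: "'k \<Rightarrow> real"
    using filterlim_compose[OF has_sum_infsum[OF that, unfolded has_sum_def] F(4)] .
  define Z where "Z n p = (\<Sum>k\<in>F n. s k * (\<xi> k (fst p) * \<eta> k (snd p)))" for n and p :: "'a \<times> 'a"
  define R where "R n p = inner (snd p - m1) (fst p - m0) - Z n p" for n p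
  have hb: "has_bochner_integral (\<mu> \<Otimes>\<^sub>M \<nu>) (\<lambda>p. (R n p)\<^sup>2) (S - (\<Sum>k\<in>F n. (s k)\<^sup>2))" for n
    unfolding R_def Z_def by (rule cross_residual[OF F(1,2)])
  have "(\<lambda>n. S - (\<Sum>k\<in>F n. (s k)\<^sup>2)) \<longlonglongrightarrow> S - S"
    by (intro tendsto_diff tendsto_const filterlim_compose[OF s_sum[unfolded has_sum_def] F(4)])
  then have "(\<lambda>n. \<integral>p. norm ((R n p)\<^sup>2) \<partial>(\<mu> \<Otimes>\<^sub>M \<nu>)) \<longlonglongrightarrow> 0"
    using hb by (simp add: has_bochner_integral_iff)
  then obtain \<rho> where \<rho>: "strict_mono \<rho>" "AE p in \<mu> \<Otimes>\<^sub>M \<nu>. (\<lambda>n. (R (\<rho> n) p)\<^sup>2) \<longlonglongrightarrow> 0"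
    using tendsto_L1_AE_subseq[of "\<mu> \<Otimes>\<^sub>M \<nu>" "\<lambda>n p. (R n p)\<^sup>2"] hb by (auto simp: has_bochner_integral_iff)
  have "AE p in \<mu> \<Otimes>\<^sub>M \<nu>. (\<lambda>n. dens (F (\<rho> n)) p) \<longlonglongrightarrow> exp (log_density p)"
    using \<rho>(2)
  proof eventually_elim
    case (elim p)
    have Rl: "(\<lambda>n. R (\<rho> n) p) \<longlonglongrightarrow> 0"
      using tendsto_real_sqrt[OF elim] by (simp add: tendsto_rabs_zero_iff)
    have sub: "(\<lambda>n. sum f (F (\<rho> n))) \<longlonglongrightarrow> infsum f K" if "f summable_on K" for f :: "'k \<Rightarrow> real"
      using LIMSEQ_subseq_LIMSEQ[OF lim[OF that] \<rho>(1)] by (simp add: o_def)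
    have "ln (dens (F (\<rho> n)) p) = (\<Sum>k\<in>F (\<rho> n). ln (1 + M k / 2)) / 2
        + 2 / \<epsilon> * (inner (snd p - m1) (fst p - m0) - R (\<rho> n) p)
        - (\<Sum>k\<in>F (\<rho> n). M k / 4 * (\<xi> k (fst p))\<^sup>2) - (\<Sum>k\<in>F (\<rho> n). M k / 4 * (\<eta> k (snd p))\<^sup>2)" for n
      unfolding ln_dens[OF F(1)] R_def Z_def b_def
      by (simp add: sum.distrib sum_subtractf sum_distrib_left sum_divide_distrib distrib_left mult.assoc)
    moreover have "(\<lambda>n. (\<Sum>k\<in>F (\<rho> n). ln (1 + M k / 2)) / 2
        + 2 / \<epsilon> * (inner (snd p - m1) (fst p - m0) - R (\<rho> n) p)
        - (\<Sum>k\<in>F (\<rho> n). M k / 4 * (\<xi> k (fst p))\<^sup>2) - (\<Sum>k\<in>F (\<rho> n). M k / 4 * (\<eta> k (snd p))\<^sup>2)) \<longlonglongrightarrow>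
      (\<Sum>\<^sub>\<infinity>k\<in>K. ln (1 + M k / 2)) / 2 + 2 / \<epsilon> * (inner (snd p - m1) (fst p - m0) - 0)
        - potential0 (fst p) - potential1 (snd p)"
      unfolding potential0_def potential1_def
      by (intro tendsto_intros sub Rl ln_M_summable \<xi>_summable \<eta>_summable) auto
    ultimately have "(\<lambda>n. ln (dens (F (\<rho> n)) p)) \<longlonglongrightarrow> log_density p"
      by (simp add: log_density_def)
    then have "(\<lambda>n. exp (ln (dens (F (\<rho> n)) p))) \<longlonglongrightarrow> exp (log_density p)"
      by (rule tendsto_exp)
    then show ?case by (simp add: dens_pos)
  qed
  then have "AE p in \<mu> \<Otimes>\<^sub>M \<nu>. ennreal (exp (log_density p)) = liminf (\<lambda>n. ennreal (dens (F (\<rho> n)) p))"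
    by eventually_elim (intro lim_imp_Liminf[symmetric] tendsto_ennrealI; simp)
  then have "(\<integral>\<^sup>+p. ennreal (exp (log_density p)) \<partial>(\<mu> \<Otimes>\<^sub>M \<nu>)) =
      (\<integral>\<^sup>+p. liminf (\<lambda>n. ennreal (dens (F (\<rho> n)) p)) \<partial>(\<mu> \<Otimes>\<^sub>M \<nu>))"
    by (rule nn_integral_cong_AE)
  also have "\<dots> \<le> liminf (\<lambda>n. \<integral>\<^sup>+p. ennreal (dens (F (\<rho> n)) p) \<partial>(\<mu> \<Otimes>\<^sub>M \<nu>))"
    by (intro nn_integral_liminf measurable_compose[OF dens_measurable measurable_ennreal])
  also have "\<dots> = 1" by (simp add: dens_total[OF F(1,2)] Liminf_const)
  finally show ?thesis .
qed

text \<open>The marginals fix everything except the cross term, which enters with the factor needed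
  to cancel its counterpart in the cost.\<close>

lemma joint_log_density:
  assumes \<pi>: "\<pi> \<in> joint \<mu> \<nu>"
  shows "has_bochner_integral \<pi> log_density ((\<Sum>\<^sub>\<infinity>k\<in>K. ln (1 + M k / 2)) / 2
    + 2 / \<epsilon> * (\<integral>p. inner (snd p - m1) (fst p - m0) \<partial>\<pi>) - infsum M K / 4 - infsum M K / 4)"
proof -
  interpret Q: prob_space \<pi> using \<pi> by (simp add: joint_def)
  show ?thesis
    unfolding log_density_def[abs_def]
  proof (intro has_bochner_integral_diff has_bochner_integral_add has_bochner_integral_mult_right)
    show "has_bochner_integral \<pi> (\<lambda>p. (\<Sum>\<^sub>\<infinity>k\<in>K. ln (1 + M k / 2)) / 2) ((\<Sum>\<^sub>\<infinity>k\<in>K. ln (1 + M k / 2)) / 2)"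
      by (simp add: has_bochner_integral_iff Q.prob_space)
    show "has_bochner_integral \<pi> (\<lambda>p. inner (snd p - m1) (fst p - m0)) (\<integral>p. inner (snd p - m1) (fst p - m0) \<partial>\<pi>)"
      using joint_cross_integrable[OF \<pi>] by (rule has_bochner_integral_integrable)
    show "has_bochner_integral \<pi> (\<lambda>p. potential0 (fst p)) (infsum M K / 4)"
      by (rule joint_fst[OF \<pi> potential0_integral])
    show "has_bochner_integral \<pi> (\<lambda>p. potential1 (snd p)) (infsum M K / 4)"
      by (rule joint_snd[OF \<pi> potential1_integral])
  qed
qed

theorem OT_eps_eq:
  "OT_eps \<epsilon> \<mu> \<nu> = ereal ((norm (m0 - m1))\<^sup>2 + T0 + T1 - \<epsilon> / 2 * infsum M K
    + \<epsilon> / 2 * (\<Sum>\<^sub>\<infinity>k\<in>K. ln (1 + M k / 2)))"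
proof (rule antisym)
  let ?T = "(norm (m0 - m1))\<^sup>2 + T0 + T1" and ?L = "\<Sum>\<^sub>\<infinity>k\<in>K. ln (1 + M k / 2)"
  show "OT_eps \<epsilon> \<mu> \<nu> \<le> ereal (?T - \<epsilon> / 2 * infsum M K + \<epsilon> / 2 * ?L)"
  proof (rule tendsto_lowerbound)
    show "((\<lambda>F. ereal (?T - \<epsilon> / 2 * (\<Sum>k\<in>F. M k) + \<epsilon> / 2 * (\<Sum>k\<in>F. ln (1 + M k / 2)))) \<longlongrightarrow>
        ereal (?T - \<epsilon> / 2 * infsum M K + \<epsilon> / 2 * ?L)) (finite_subsets_at_top K)"
      using has_sum_infsum[OF M_summable] has_sum_infsum[OF ln_M_summable]
      unfolding has_sum_def by (intro tendsto_intros)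
    show "\<forall>\<^sub>F F in finite_subsets_at_top K. OT_eps \<epsilon> \<mu> \<nu> \<le>
        ereal (?T - \<epsilon> / 2 * (\<Sum>k\<in>F. M k) + \<epsilon> / 2 * (\<Sum>k\<in>F. ln (1 + M k / 2)))"
      by (rule eventually_finite_subsets_at_top_weakI) (rule OT_eps_le)
  qed simp
  show "ereal (?T - \<epsilon> / 2 * infsum M K + \<epsilon> / 2 * ?L) \<le> OT_eps \<epsilon> \<mu> \<nu>"
    unfolding OT_eps_def
  proof (rule INF_greatest)
    fix \<pi> assume \<pi>: "\<pi> \<in> joint \<mu> \<nu>"
    let ?I = "\<integral>p. inner (snd p - m1) (fst p - m0) \<partial>\<pi>"
    have c: "enn2ereal (\<integral>\<^sup>+ p. ennreal ((norm (fst p - snd p))\<^sup>2) \<partial>\<pi>) = ereal (?T - 2 * ?I)"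
      unfolding joint_cost_eq[OF \<pi>] using joint_cost_nonneg[OF \<pi>] by (rule enn2ereal_ennreal)
    show "ereal (?T - \<epsilon> / 2 * infsum M K + \<epsilon> / 2 * ?L) \<le>
      enn2ereal (\<integral>\<^sup>+ p. ennreal ((norm (fst p - snd p))\<^sup>2) \<partial>\<pi>) + ereal \<epsilon> * KL_ext \<pi> (\<mu> \<Otimes>\<^sub>M \<nu>)"
    proof (cases "absolutely_continuous (\<mu> \<Otimes>\<^sub>M \<nu>) \<pi> \<and> integrable \<pi> (entropy_density (exp 1) (\<mu> \<Otimes>\<^sub>M \<nu>) \<pi>)")
      case True
      let ?KL = "KL_divergence (exp 1) (\<mu> \<Otimes>\<^sub>M \<nu>) \<pi>"
      have ps: "prob_space \<pi>" "sets \<pi> = sets (\<mu> \<Otimes>\<^sub>M \<nu>)"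
        using \<pi> unfolding sets_prod by (auto simp: joint_def)
      have "(\<integral>p. log_density p \<partial>\<pi>) \<le> ?KL"
        using joint_log_density[OF \<pi>] True
        by (intro donsker_varadhan[OF prod.prob_space_axioms ps _ _ log_density_measurable _ log_density_mass])
          (auto simp: has_bochner_integral_iff)
      then have "?L / 2 + 2 / \<epsilon> * ?I - infsum M K / 2 \<le> ?KL"
        using joint_log_density[OF \<pi>] by (simp add: has_bochner_integral_iff)
      \<comment> \<open>After multiplication by \<epsilon> the cross term is \<open>2 * ?I\<close>,
        which cancels the \<open>- 2 * ?I\<close> of the transport cost and makes the bound
        independent of \<pi>.\<close>
      then have "\<epsilon> * (?L / 2 + 2 / \<epsilon> * ?I - infsum M K / 2) \<le> \<epsilon> * ?KL"
        using eps by (intro mult_left_mono) auto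
      then have "?T - \<epsilon> / 2 * infsum M K + \<epsilon> / 2 * ?L \<le> ?T - 2 * ?I + \<epsilon> * ?KL"
        using eps by (simp add: algebra_simps)
      then show ?thesis using True by (simp add: c KL_ext_def)
    next
      case False
      then have "KL_ext \<pi> (\<mu> \<Otimes>\<^sub>M \<nu>) = \<infinity>" by (auto simp: KL_ext_def)
      then show ?thesis using eps by (simp add: c)
    qed
  qed
qed

end

section \<open>The Sinkhorn divergence\<close>

lemma pos_trace_class_positive: "pos_trace_class C \<Longrightarrow> positive_op C"
  by (simp add: pos_trace_class_def)

lemma has_sum_restrict_support:
  assumes "(f has_sum s) B" "\<And>b. b \<in> B \<Longrightarrow> f b \<noteq> 0 \<Longrightarrow> P b"
  shows "(f has_sum s) {b \<in> B. P b}"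
  using assms(1) by (rule has_sum_cong_neutral[THEN iffD1, rotated -1]) (use assms(2) in auto)

text \<open>Equal measures are allowed, so the self-transport terms of the divergence are instances.
  The first two claims are what the trace and logarithm rules of the final computation
  require.\<close>

theorem OT_eps_gaussian:
  fixes \<mu> \<nu> :: "'a::{real_inner,polish_space} measure"
  assumes C0: "pos_trace_class C0" and C1: "pos_trace_class C1"
    and \<mu>: "gaussian_measure \<mu> m0 C0" and \<nu>: "gaussian_measure \<nu> m1 C1" and eps: "0 < \<epsilon>"
  shows "pos_trace_class (M_eps \<epsilon> C0 C1)"
    and "0 < fredholm_det (id_blinfun + (1/2) *\<^sub>R M_eps \<epsilon> C0 C1)"
    and "OT_eps \<epsilon> \<mu> \<nu> = ereal ((norm (m0 - m1))\<^sup>2 + op_trace C0 + op_trace C1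
      - \<epsilon> / 2 * op_trace (M_eps \<epsilon> C0 C1) + \<epsilon> / 2 * ln (fredholm_det (id_blinfun + (1/2) *\<^sub>R M_eps \<epsilon> C0 C1)))"
proof -
  define R0 where "R0 = op_sqrt C0"
  define R1 where "R1 = op_sqrt C1"
  have R0: "positive_op R0" "R0 o\<^sub>L R0 = C0" unfolding R0_def by (rule pos_trace_class_op_sqrt[OF C0])+
  have R1: "positive_op R1" "R1 o\<^sub>L R1 = C1" unfolding R1_def by (rule pos_trace_class_op_sqrt[OF C1])+
  have RR0: "R0 (R0 x) = C0 x" for x using arg_cong[OF R0(2), of "\<lambda>X. X x"] by simp
  have adj0: "inner (R0 x) y = inner x (R0 y)" for x y using R0(1) by (simp add: positive_op_def selfadj_op_def)
  have adj1: "inner (R1 x) y = inner x (R1 y)" for x y using R1(1) by (simp add: positive_op_def selfadj_op_def)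
  have q0: "inner (C0 x) x = (norm (R0 x))\<^sup>2" for x using square_root_inner[OF R0(1), of x] R0(2) by simp
  have q1: "inner (C1 x) x = (norm (R1 x))\<^sup>2" for x using square_root_inner[OF R1(1), of x] R1(2) by simp
  define A where "A = R0 o\<^sub>L C1 o\<^sub>L R0"
  have A: "pos_trace_class A"
    unfolding A_def by (rule pos_trace_class_conj[OF pos_trace_class_positive[OF C1] R0(1)]) (simp add: R0(2) C0)
  have N: "M_eps \<epsilon> C0 C1 = - id_blinfun + op_sqrt (id_blinfun + (16 / \<epsilon>\<^sup>2) *\<^sub>R A)"
    by (simp add: M_eps_def A_def R0_def)
  have c: "0 < 16 / \<epsilon>\<^sup>2" using eps by simp
  obtain B a where B: "onb B" and Ab: "\<And>b. b \<in> B \<Longrightarrow> A b = a b *\<^sub>R b" and a0: "\<And>b. b \<in> B \<Longrightarrow> 0 \<le> a b"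
    and asum: "(a has_sum op_trace A) B"
    and tc: "pos_trace_class (M_eps \<epsilon> C0 C1)"
    and tr: "((\<lambda>b. sqrt (1 + 16 / \<epsilon>\<^sup>2 * a b) - 1) has_sum op_trace (M_eps \<epsilon> C0 C1)) B"
    and ld: "((\<lambda>b. ln (1 + (sqrt (1 + 16 / \<epsilon>\<^sup>2 * a b) - 1) / 2)) has_sum
      ln (fredholm_det (id_blinfun + (1/2) *\<^sub>R M_eps \<epsilon> C0 C1))) B"
    and det0: "0 < fredholm_det (id_blinfun + (1/2) *\<^sub>R M_eps \<epsilon> C0 C1)"
    by (rule sqrt_id_plus_eigenbasis[OF A c, folded N]) (rule that; assumption)
  show "pos_trace_class (M_eps \<epsilon> C0 C1)" by (rule tc)
  show "0 < fredholm_det (id_blinfun + (1/2) *\<^sub>R M_eps \<epsilon> C0 C1)" by (rule det0)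
  define K where "K = {b \<in> B. 0 < a b}"
  define s where "s b = sqrt (a b)" for b
  \<comment> \<open>The indices are the basis vectors themselves. By construction
    \<open>R0 (u b) = b\<close> for \<open>b\<close> in \<open>K\<close>: formally
    \<open>u b\<close> is the inverse root of \<open>C0\<close> applied to \<open>b\<close>, and
    dividing by \<open>s b > 0\<close> realises it as a vector.\<close>
  define v where "v b = R0 b /\<^sub>R s b" for b
  define u where "u b = C1 (v b) /\<^sub>R s b" for b
  have s2: "(s b)\<^sup>2 = a b" if "b \<in> B" for b using a0[OF that] by (simp add: s_def)
  have KB: "b \<in> B" "0 < s b" if "b \<in> K" for b using that by (auto simp: K_def s_def)
  \<comment> \<open>Where \<open>a b = 0\<close> the summands \<open>sqrt 1 - 1\<close> and
    \<open>ln 1\<close> vanish, so all sums over \<open>B\<close> reduce to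
    \<open>K\<close>.\<close>
  have supp: "P b \<noteq> 0 \<Longrightarrow> 0 < a b" if "b \<in> B" "a b = 0 \<Longrightarrow> P b = 0" for b and P :: "'a \<Rightarrow> real"
    using that a0[of b] by force
  interpret X: gaussian \<mu> m0 C0 by unfold_locales (use \<mu> C0 pos_trace_class_positive in auto)
  interpret Y: gaussian \<nu> m1 C1 by unfold_locales (use \<nu> C1 pos_trace_class_positive in auto)
  have v_orth: "inner (C1 (v k)) (v l) = (if k = l then 1 else 0)" if k: "k \<in> K" and l: "l \<in> K" for k l
  proof -
    have "inner (C1 (v k)) (v l) = inner (A k) l / (s k * s l)"
      by (simp add: v_def A_def blinfun.scaleR_right adj0 divide_inverse)
    also have "\<dots> = a k * (if k = l then 1 else 0) / (s k * s l)"
      using KB(1)[OF k] KB(1)[OF l] by (simp add: Ab orthonormal_inner[OF onb_orthonormal[OF B]])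
    also have "\<dots> = (if k = l then 1 else 0)"
      using s2[OF KB(1)[OF k]] KB(2)[OF k] by (auto simp: power2_eq_square simp flip: s2[OF KB(1)[OF k]])
    finally show ?thesis .
  qed
  have C1_v: "C1 (v k) = s k *\<^sub>R u k" if "k \<in> K" for k
    using KB(2)[OF that] by (simp add: u_def)
  have C0_u: "C0 (u k) = s k *\<^sub>R v k" if k: "k \<in> K" for k
  proof -
    have "C0 (u k) = R0 (A k) /\<^sub>R (s k * s k)"
      by (simp add: u_def v_def A_def RR0 blinfun.scaleR_right)
    also have "\<dots> = R0 k"
    proof -
      have "s k * s k = a k" "inverse (a k) * a k = 1"
        using k s2[OF KB(1)[OF k]] by (auto simp: K_def power2_eq_square)
      then show ?thesis by (simp only: Ab[OF KB(1)[OF k]] blinfun.scaleR_right scaleR_scaleR scaleR_one)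
    qed
    finally show ?thesis using KB(2)[OF k] by (simp add: v_def)
  qed
  have u_orth: "inner (C0 (u k)) (u l) = (if k = l then 1 else 0)" if k: "k \<in> K" and l: "l \<in> K" for k l
  proof -
    have "inner (C0 (u k)) (u l) = s k / s l * inner (C1 (v l)) (v k)"
      unfolding C0_u[OF k] u_def[of l] by (simp add: inner_commute divide_inverse)
    then show ?thesis using KB(2)[OF k] by (auto simp: v_orth[OF l k])
  qed
  have id_sum: "((\<lambda>b. inner (C (id_blinfun b)) (id_blinfun b)) has_sum op_trace C) B" if "pos_trace_class C" for C
    using op_trace_has_sum[OF that B] by simp
  have idsa: "selfadj_op id_blinfun" by (simp add: selfadj_op_def)
  \<comment> \<open>The direct computation gives the trace of \<open>R1 C0 R1\<close>; since
    \<open>R0 R1\<close> is the adjoint of \<open>R1 R0\<close>, it agrees with that of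
    \<open>R0 C1 R0\<close>.\<close>
  have cross: "has_bochner_integral \<mu> (\<lambda>x. inner (C1 (x - m0)) (x - m0)) (op_trace A)"
    unfolding q1
  proof (rule X.norm_square_moment[OF B])
    show "selfadj_op R1" using R1(1) by (simp add: positive_op_def)
    have "((\<lambda>b. (norm ((R1 o\<^sub>L R0) b))\<^sup>2) has_sum op_trace A) B"
    proof -
      have "inner (A b) b = (norm ((R1 o\<^sub>L R0) b))\<^sup>2" for b
        by (simp add: A_def adj0 flip: q1)
      then show ?thesis using op_trace_has_sum[OF A B] by simp
    qed
    from hilbert_schmidt_swap[OF B B _ this, of "R0 o\<^sub>L R1"]
    have "((\<lambda>b. (norm ((R0 o\<^sub>L R1) b))\<^sup>2) has_sum op_trace A) B"
      by (simp add: adj0 adj1)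
    then show "((\<lambda>b. inner (C0 (R1 b)) (R1 b)) has_sum op_trace A) B"
      by (simp add: q0)
  qed
  have ssum: "((\<lambda>k. (s k)\<^sup>2) has_sum op_trace A) K"
  proof -
    have "(a has_sum op_trace A) K"
      unfolding K_def using asum by (rule has_sum_restrict_support) (rule supp)
    then show ?thesis
      using has_sum_cong[of K "\<lambda>k. (s k)\<^sup>2" a] s2 KB(1) by auto
  qed
  interpret F: sinkhorn_frame \<mu> \<nu> m0 m1 C0 C1 \<epsilon> K u v s "op_trace C0" "op_trace C1" "op_trace A"
  proof
    show "countable K"
      using orthonormal_countable[OF onb_orthonormal[OF B]] by (simp add: K_def)
    show "has_bochner_integral \<mu> (\<lambda>x. (norm (x - m0))\<^sup>2) (op_trace C0)"
      using X.norm_square_moment[OF B idsa id_sum[OF C0]] by simp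
    show "has_bochner_integral \<nu> (\<lambda>y. (norm (y - m1))\<^sup>2) (op_trace C1)"
      using Y.norm_square_moment[OF B idsa id_sum[OF C1]] by simp
  qed (fact eps KB(2) C0_u C1_v u_orth v_orth cross ssum)+
  have M: "F.M k = sqrt (1 + 16 / \<epsilon>\<^sup>2 * a k) - 1" if "k \<in> K" for k
    using s2[OF KB(1)[OF that]] by (simp add: F.M_def)
  have "((\<lambda>b. sqrt (1 + 16 / \<epsilon>\<^sup>2 * a b) - 1) has_sum op_trace (M_eps \<epsilon> C0 C1)) K"
    unfolding K_def using tr by (rule has_sum_restrict_support) (rule supp, auto)
  then have 1: "infsum F.M K = op_trace (M_eps \<epsilon> C0 C1)"
    using infsum_cong[of K F.M] M by (simp add: infsumI)
  have "((\<lambda>b. ln (1 + (sqrt (1 + 16 / \<epsilon>\<^sup>2 * a b) - 1) / 2)) has_sum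
      ln (fredholm_det (id_blinfun + (1/2) *\<^sub>R M_eps \<epsilon> C0 C1))) K"
    unfolding K_def using ld by (rule has_sum_restrict_support) (rule supp, auto)
  then have 2: "(\<Sum>\<^sub>\<infinity>k\<in>K. ln (1 + F.M k / 2)) = ln (fredholm_det (id_blinfun + (1/2) *\<^sub>R M_eps \<epsilon> C0 C1))"
    using infsum_cong[of K "\<lambda>k. ln (1 + F.M k / 2)" "\<lambda>b. ln (1 + (sqrt (1 + 16 / \<epsilon>\<^sup>2 * a b) - 1) / 2)"] M
    by (simp add: infsumI)
  show "OT_eps \<epsilon> \<mu> \<nu> = ereal ((norm (m0 - m1))\<^sup>2 + op_trace C0 + op_trace C1
      - \<epsilon> / 2 * op_trace (M_eps \<epsilon> C0 C1) + \<epsilon> / 2 * ln (fredholm_det (id_blinfun + (1/2) *\<^sub>R M_eps \<epsilon> C0 C1)))"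
    using F.OT_eps_eq unfolding 1 2 .
qed

theorem mainTheorem7:
  fixes \<mu>0 \<mu>1 :: "'a::{real_inner,polish_space} measure"
    and m0 m1 :: 'a and C0 C1 :: "'a \<Rightarrow>\<^sub>L 'a" and \<epsilon> :: real
  assumes "pos_trace_class C0" and "pos_trace_class C1"
    and "gaussian_measure \<mu>0 m0 C0" and "gaussian_measure \<mu>1 m1 C1"
    and "\<epsilon> > 0"
  shows "sinkhorn_div \<epsilon> \<mu>0 \<mu>1 = ereal (
      (norm (m0 - m1))\<^sup>2
      + \<epsilon> / 4 * op_trace (M_eps \<epsilon> C0 C0 - 2 *\<^sub>R M_eps \<epsilon> C0 C1 + M_eps \<epsilon> C1 C1)
      + \<epsilon> / 4 * ln ((fredholm_det (id_blinfun + (1/2) *\<^sub>R M_eps \<epsilon> C0 C1))\<^sup>2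
          / (fredholm_det (id_blinfun + (1/2) *\<^sub>R M_eps \<epsilon> C0 C0)
             * fredholm_det (id_blinfun + (1/2) *\<^sub>R M_eps \<epsilon> C1 C1))))"
proof -
  note OT01 = OT_eps_gaussian[OF assms(1,2,3,4,5)]
  note OT00 = OT_eps_gaussian[OF assms(1,1,3,3,5)]
  note OT11 = OT_eps_gaussian[OF assms(2,2,4,4,5)]
  let ?d = "\<lambda>N. fredholm_det (id_blinfun + (1/2) *\<^sub>R N)"
  \<comment> \<open>\<open>op_trace_has_sum\<close> covers positive operators only, and the
    combination of the three is not known to be positive. Its trace is therefore computed in the
    very basis selected by \<open>op_trace\<close>, where the three separate traces add up.\<close>
  define B where "B = (SOME B::'a set. onb B)"
  have B: "onb B"
    using assms(1) unfolding B_def pos_trace_class_def by (metis someI)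
  have "((\<lambda>b. inner (M_eps \<epsilon> C0 C0 b) b + - 2 * inner (M_eps \<epsilon> C0 C1 b) b + inner (M_eps \<epsilon> C1 C1 b) b) has_sum
      (op_trace (M_eps \<epsilon> C0 C0) + - 2 * op_trace (M_eps \<epsilon> C0 C1) + op_trace (M_eps \<epsilon> C1 C1))) B"
    by (intro has_sum_add has_sum_cmult_right op_trace_has_sum B OT00(1) OT01(1) OT11(1))
  then have "((\<lambda>b. inner ((M_eps \<epsilon> C0 C0 - 2 *\<^sub>R M_eps \<epsilon> C0 C1 + M_eps \<epsilon> C1 C1) b) b) has_sum
      (op_trace (M_eps \<epsilon> C0 C0) - 2 * op_trace (M_eps \<epsilon> C0 C1) + op_trace (M_eps \<epsilon> C1 C1))) B"
    by (simp add: blinfun.add_left blinfun.diff_left blinfun.scaleR_left inner_add_left inner_diff_left)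
  then have tr: "op_trace (M_eps \<epsilon> C0 C0 - 2 *\<^sub>R M_eps \<epsilon> C0 C1 + M_eps \<epsilon> C1 C1) =
      op_trace (M_eps \<epsilon> C0 C0) - 2 * op_trace (M_eps \<epsilon> C0 C1) + op_trace (M_eps \<epsilon> C1 C1)"
    unfolding op_trace_def[of "_ + _"] B_def[symmetric] by (rule infsumI)
  have ln: "ln (x\<^sup>2 / (y * z)) = 2 * ln x - (ln y + ln z)" if "0 < x" "0 < y" "0 < z" for x y z :: real
    using that by (simp add: ln_div ln_mult ln_realpow)
  have half: "ereal x - (ereal y + ereal z) / 2 = ereal (x - (y + z) / 2)" for x y z :: real
  proof -
    have "(ereal y + ereal z) / 2 = ereal (y + z) / ereal 2" by simp
    also have "\<dots> = ereal ((y + z) / 2)" by (simp only: ereal_divide) simp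
    finally show ?thesis by simp
  qed
  \<comment> \<open>The traces of \<open>C0\<close> and \<open>C1\<close> in the mixed cost equal
    half of those in the two self costs and cancel; halving the self costs turns \<epsilon>/2 into
    \<epsilon>/4.\<close>
  show ?thesis
    unfolding sinkhorn_div_def OT01(3) OT00(3) OT11(3) half tr ln[OF OT01(2) OT00(2) OT11(2)]
    by (simp add: field_simps)
qed

end
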